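(* Let $\mathcal C$ be a path category with weak (resp. strong) homotopy $\Pi$-types, i.e. every composable pair of fibrations has a weak (resp. strong) homotopy $\Pi$-type. Let $X$ be an object, $p:Y\to Z$ a fibration, and $(Z^X,\varepsilon_Z)$ a weak (resp. strong) homotopy exponential for $X$ and $Z$. Then there is a weak (resp. strong) homotopy exponential $(Y^X,\varepsilon_Y)$ for $X$ and $Y$ and a fibration $p^X:Y^X\to Z^X$ such that $$p\,\varepsilon_Y=\varepsilon_Z\,(p^X\times 1_X): Y^X\times X\to Z .$$
   Context: A path category is a category $\mathcal C$ with two classes of maps, fibrations and weak equivalences (a map in both classes is an acyclic fibration), such that: (1) fibrations are closed under composition; (2) the pullback of a fibration along any map exists and is a fibration; (3) the pullback of an acyclic fibration along any map is an acyclic fibration; (4) weak equivalences satisfy 2-out-of-6: if $hg$ and $gf$ are weak equivalences, then so are $f,g,h,hgf$; (5) isomorphisms are acyclic fibrations and every acyclic fibration has a section; (6) there is a terminal object $1$ and every map $X\to 1$ is a fibration; (7) every object $X$ has a path object, i.e. a factorization $X\xrightarrow{r}PX\xrightarrow{(s,t)}X\times X$ of the diagonal with $r$ a weak equivalence and $(s,t)$ a fibration. For an object $I$, the full subcategory $\mathcal C(I)$ of $\mathcal C/I$ on the fibrations $Y\to I$ is again a path category (inherited fibrations and weak equivalences); $P_IY$ denotes a path object of $Y\to I$ in $\mathcal C(I)$, with $r:Y\to P_IY$ and $(s,t):P_IY\to Y\times_I Y$. For a fibration $p:Y\to I$, maps $f,g:X\to Y$ with $pf=pg$ are fiberwise homotopic,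 $f\simeq_I g$, if for some path object $P_IY$ there is $H:X\to P_IY$ with $sH=f$, $tH=g$. Hom-groupoids. For $T\to J$ any map and $Z\to J$ a fibration, $(\mathcal C/J)(T,Z)$ is the groupoid whose objects are the maps $T\to Z$ over $J$ and whose arrows $u\to v$ are $\simeq_{Z\times_JZ}$-classes of maps $H:T\to P_JZ$ with $sH=u$, $tH=v$; the identity on $u$ is $[ru]$, and the composite of $[H]:u\to v$ and $[K]:v\to w$ is $[\tau(H,K)]$, where $\tau:P_JZ\times_{t,Z,s}P_JZ\to P_JZ$ is any map with $(s,t)\tau=(s\pi_1,t\pi_2)$ and $\tau(r,r)\simeq_{Z\times_JZ}r$ (unique up to $\simeq_{Z\times_JZ}$). For $J=1$ write $\mathcal C(T,Z)$. For $\varepsilon:A\to B$ a map over $J$ between fibrations over $J$, the functor $\varepsilon*-:(\mathcal C/J)(T,A)\to(\mathcal C/J)(T,B)$ sends $u\mapsto\varepsilon u$ and $[H]\mapsto[(P_J\varepsilon)H]$, where $P_J\varepsilon:P_JA\to P_JB$ is any map with $(s,t)P_J\varepsilon=(\varepsilon s,\varepsilon t)$ and $(P_J\varepsilon)r\simeq_{B\times_JB}r\varepsilon$ (exists, unique up to $\simeq_{B\times_JB}$). For an object $X$, the functor $-\times X:\mathcal C(T,A)\to\mathcal C(T\times X,A\times X)$ sends $u\mapsto u\times 1_X$ and $[H]\mapsto[H\times r]$, where $PA\times PX$ is used as path object of $A\times X$. For a fibration $g:I\to J$, the functor $-\times_JI:(\mathcal C/J)(T,A)\to(\mathcal C/I)(T\times_JI,A\times_JI)$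 sends $u\mapsto u\times_J1_I$ and $[H]\mapsto[H\times_J1_I]$, where $(P_JA)\times_JI$ is used as path object of $A\times_JI$ over $I$. A functor is e.s. if it is essentially surjective and e.s.f. if it is essentially surjective and full. A weak (resp. strong) homotopy exponential for objects $X,Y$ is an object $Y^X$ with a map $\varepsilon_Y:Y^X\times X\to Y$ such that for every object $T$ the functor $(\varepsilon_Y*-)(-\times X):\mathcal C(T,Y^X)\to\mathcal C(T\times X,Y)$ is e.s. (resp. e.s.f.). A weak (resp. strong) homotopy $\Pi$-type for fibrations $f:X\to I$ and $g:I\to J$ is a fibration $\Pi_gf:\Pi_gX\to J$ with a map $\varepsilon_X:(\Pi_gX)\times_JI\to X$ over $I$ such that for every map $T\to J$ the functor $(\varepsilon_X*-)(-\times_JI):(\mathcal C/J)(T,\Pi_gX)\to(\mathcal C/I)(T\times_JI,X)$ is e.s. (resp. e.s.f.). *)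

theory Defs
  imports Main
begin

record ('o, 'm) fwcat =
  Ob   :: "'o set"
  Arr  :: "'m set"
  Dom  :: "'m \<Rightarrow> 'o"
  Cod  :: "'m \<Rightarrow> 'o"
  Id   :: "'o \<Rightarrow> 'm"
  Comp :: "'m \<Rightarrow> 'm \<Rightarrow> 'm"  (infixl "\<cdot>\<index>" 70)
  Fib  :: "'m set"
  WE   :: "'m set"

definition hom :: "('o, 'm) fwcat \<Rightarrow> 'o \<Rightarrow> 'o \<Rightarrow> 'm set" where
  "hom C x y = {f \<in> Arr C. Dom C f = x \<and> Cod C f = y}"

text \<open>\<^term>\<open>Comp C g f\<close> is the composite of g after f; it is unspecified when f and g
  are not composable.\<close>

locale category =
  fixes C :: "('o, 'm) fwcat" (structure)
  assumes dom_ob: "f \<in> Arr C \<Longrightarrow> Dom C f \<in> Ob C"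
    and cod_ob: "f \<in> Arr C \<Longrightarrow> Cod C f \<in> Ob C"
    and id_hom: "x \<in> Ob C \<Longrightarrow> Id C x \<in> hom C x x"
    and comp_hom: "\<lbrakk>f \<in> hom C x y; g \<in> hom C y z\<rbrakk> \<Longrightarrow> g \<cdot> f \<in> hom C x z"
    and comp_id: "f \<in> hom C x y \<Longrightarrow> f \<cdot> Id C x = f"
    and id_comp: "f \<in> hom C x y \<Longrightarrow> Id C y \<cdot> f = f"
    and comp_assoc: "\<lbrakk>f \<in> hom C w x; g \<in> hom C x y; h \<in> hom C y z\<rbrakk>
                      \<Longrightarrow> (h \<cdot> g) \<cdot> f = h \<cdot> (g \<cdot> f)"

definition is_iso :: "('o, 'm) fwcat \<Rightarrow> 'm \<Rightarrow> bool" where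
  "is_iso C f \<longleftrightarrow> f \<in> Arr C \<and>
     (\<exists>g \<in> hom C (Cod C f) (Dom C f).
        g \<cdot>\<^bsub>C\<^esub> f = Id C (Dom C f) \<and> f \<cdot>\<^bsub>C\<^esub> g = Id C (Cod C f))"

definition terminal :: "('o, 'm) fwcat \<Rightarrow> 'o \<Rightarrow> bool" where
  "terminal C x \<longleftrightarrow> x \<in> Ob C \<and> (\<forall>y \<in> Ob C. \<exists>!f. f \<in> hom C y x)"

definition is_pullback :: "('o, 'm) fwcat \<Rightarrow> 'm \<Rightarrow> 'm \<Rightarrow> 'm \<Rightarrow> 'm \<Rightarrow> bool" where
  "is_pullback C f g p q \<longleftrightarrow>
     f \<in> Arr C \<and> g \<in> Arr C \<and> Cod C f = Cod C g \<and>
     p \<in> Arr C \<and> q \<in> Arr C \<and> Dom C p = Dom C q \<and> Cod C p = Dom C f \<and> Cod C q = Dom C g \<and>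
     f \<cdot>\<^bsub>C\<^esub> p = g \<cdot>\<^bsub>C\<^esub> q \<and>
     (\<forall>w. \<forall>a \<in> hom C w (Dom C f). \<forall>b \<in> hom C w (Dom C g).
        f \<cdot>\<^bsub>C\<^esub> a = g \<cdot>\<^bsub>C\<^esub> b \<longrightarrow>
        (\<exists>!m. m \<in> hom C w (Dom C p) \<and> p \<cdot>\<^bsub>C\<^esub> m = a \<and> q \<cdot>\<^bsub>C\<^esub> m = b))"

text \<open>Terminal object, pullbacks and (further below) path objects exist but are not part of the
  structure; the notation for them refers to an arbitrary fixed choice.\<close>

definition one :: "('o, 'm) fwcat \<Rightarrow> 'o" where
  "one C = (SOME x. terminal C x)"

definition bang :: "('o, 'm) fwcat \<Rightarrow> 'o \<Rightarrow> 'm" where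
  "bang C x = (THE f. f \<in> hom C x (one C))"

definition pb :: "('o, 'm) fwcat \<Rightarrow> 'm \<Rightarrow> 'm \<Rightarrow> 'm \<times> 'm" where
  "pb C f g = (SOME (p, q). is_pullback C f g p q)"

definition pr1 :: "('o, 'm) fwcat \<Rightarrow> 'm \<Rightarrow> 'm \<Rightarrow> 'm" where
  "pr1 C f g = fst (pb C f g)"

definition pr2 :: "('o, 'm) fwcat \<Rightarrow> 'm \<Rightarrow> 'm \<Rightarrow> 'm" where
  "pr2 C f g = snd (pb C f g)"

definition pb_ob :: "('o, 'm) fwcat \<Rightarrow> 'm \<Rightarrow> 'm \<Rightarrow> 'o" where
  "pb_ob C f g = Dom C (pr1 C f g)"

definition pair :: "('o, 'm) fwcat \<Rightarrow> 'm \<Rightarrow> 'm \<Rightarrow> 'm \<Rightarrow> 'm \<Rightarrow> 'm" where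
  "pair C f g a b =
     (THE m. m \<in> hom C (Dom C a) (pb_ob C f g) \<and>
             pr1 C f g \<cdot>\<^bsub>C\<^esub> m = a \<and> pr2 C f g \<cdot>\<^bsub>C\<^esub> m = b)"

text \<open>Products are pullbacks over the terminal object, so that the non-fibered notions below are
  the fibered ones with base 1.\<close>

definition prod_ob :: "('o, 'm) fwcat \<Rightarrow> 'o \<Rightarrow> 'o \<Rightarrow> 'o" where
  "prod_ob C x y = pb_ob C (bang C x) (bang C y)"

definition prod_map :: "('o, 'm) fwcat \<Rightarrow> 'm \<Rightarrow> 'm \<Rightarrow> 'm" where
  "prod_map C u v =
     pair C (bang C (Cod C u)) (bang C (Cod C v))
       (u \<cdot>\<^bsub>C\<^esub> pr1 C (bang C (Dom C u)) (bang C (Dom C v)))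
       (v \<cdot>\<^bsub>C\<^esub> pr2 C (bang C (Dom C u)) (bang C (Dom C v)))"

text \<open>For g from I to J, a from A to J and u from T to A, the map from the pullback of T (viewed
  over J by the composite of a and u) along g to the pullback of A along g, induced by u and the
  identity of I.\<close>

definition base_change :: "('o, 'm) fwcat \<Rightarrow> 'm \<Rightarrow> 'm \<Rightarrow> 'm \<Rightarrow> 'm" where
  "base_change C g a u =
     pair C a g (u \<cdot>\<^bsub>C\<^esub> pr1 C (a \<cdot>\<^bsub>C\<^esub> u) g) (pr2 C (a \<cdot>\<^bsub>C\<^esub> u) g)"

record 'm path =
  prefl :: 'm
  psrc  :: 'm
  ptgt  :: 'm

definition path_ob :: "('o, 'm) fwcat \<Rightarrow> 'm path \<Rightarrow> 'o" where
  "path_ob C P = Cod C (prefl P)"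

text \<open>The map (s,t) into the fibered square of the domain of p.\<close>

definition st :: "('o, 'm) fwcat \<Rightarrow> 'm \<Rightarrow> 'm path \<Rightarrow> 'm" where
  "st C p P = pair C p p (psrc P) (ptgt P)"

text \<open>Path objects of a fibration p from Y to I in the full subcategory of fibrations of the slice
  over I. The structure map of the path object is p after s, which equals p after t and is
  automatically a fibration.\<close>

definition is_path_object :: "('o, 'm) fwcat \<Rightarrow> 'm \<Rightarrow> 'm path \<Rightarrow> bool" where
  "is_path_object C p P \<longleftrightarrow>
     p \<in> Fib C \<and>
     prefl P \<in> WE C \<and> prefl P \<in> hom C (Dom C p) (path_ob C P) \<and>
     psrc P \<in> hom C (path_ob C P) (Dom C p) \<and>
     ptgt P \<in> hom C (path_ob C P) (Dom C p) \<and>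
     psrc P \<cdot>\<^bsub>C\<^esub> prefl P = Id C (Dom C p) \<and>
     ptgt P \<cdot>\<^bsub>C\<^esub> prefl P = Id C (Dom C p) \<and>
     p \<cdot>\<^bsub>C\<^esub> psrc P = p \<cdot>\<^bsub>C\<^esub> ptgt P \<and>
     st C p P \<in> Fib C"

locale path_category = category C
  for C :: "('o, 'm) fwcat" (structure) +
  assumes fib_arr: "Fib C \<subseteq> Arr C"
    and we_arr: "WE C \<subseteq> Arr C"
    and fib_comp: "\<lbrakk>f \<in> Fib C; g \<in> Fib C; Cod C f = Dom C g\<rbrakk> \<Longrightarrow> g \<cdot> f \<in> Fib C"
    and pullback_ex: "\<lbrakk>p \<in> Fib C; f \<in> Arr C; Cod C f = Cod C p\<rbrakk>
                        \<Longrightarrow> \<exists>u v. is_pullback C f p u v"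
    and pullback_fib: "\<lbrakk>p \<in> Fib C; is_pullback C f p u v\<rbrakk> \<Longrightarrow> u \<in> Fib C"
    and pullback_acyclic: "\<lbrakk>p \<in> Fib C \<inter> WE C; is_pullback C f p u v\<rbrakk> \<Longrightarrow> u \<in> Fib C \<inter> WE C"
    and two_out_of_six:
      "\<lbrakk>f \<in> hom C w x; g \<in> hom C x y; h \<in> hom C y z; h \<cdot> g \<in> WE C; g \<cdot> f \<in> WE C\<rbrakk>
         \<Longrightarrow> f \<in> WE C \<and> g \<in> WE C \<and> h \<in> WE C \<and> h \<cdot> (g \<cdot> f) \<in> WE C"
    and iso_acyclic: "is_iso C f \<Longrightarrow> f \<in> Fib C \<inter> WE C"
    and acyclic_section: "f \<in> Fib C \<inter> WE C
         \<Longrightarrow> \<exists>s \<in> hom C (Cod C f) (Dom C f). f \<cdot> s = Id C (Cod C f)"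
    and terminal_ex: "\<exists>x. terminal C x \<and> (\<forall>f \<in> Arr C. Cod C f = x \<longrightarrow> f \<in> Fib C)"
    and path_object_ex: "x \<in> Ob C \<Longrightarrow> \<exists>P. is_path_object C (bang C x) P"

definition the_path :: "('o, 'm) fwcat \<Rightarrow> 'm \<Rightarrow> 'm path" where
  "the_path C p = (SOME P. is_path_object C p P)"

definition fib_homotopic :: "('o, 'm) fwcat \<Rightarrow> 'm \<Rightarrow> 'm \<Rightarrow> 'm \<Rightarrow> bool" where
  "fib_homotopic C p f g \<longleftrightarrow>
     f \<in> Arr C \<and> g \<in> Arr C \<and> Dom C f = Dom C g \<and> Cod C f = Dom C p \<and> Cod C g = Dom C p \<and>
     p \<cdot>\<^bsub>C\<^esub> f = p \<cdot>\<^bsub>C\<^esub> g \<and>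
     (\<exists>P. is_path_object C p P \<and>
        (\<exists>H \<in> hom C (Dom C f) (path_ob C P). psrc P \<cdot>\<^bsub>C\<^esub> H = f \<and> ptgt P \<cdot>\<^bsub>C\<^esub> H = g))"

record ('a, 'b) gpd =
  GOb   :: "'a set"
  GHom  :: "'a \<Rightarrow> 'a \<Rightarrow> 'b set"
  GId   :: "'a \<Rightarrow> 'b"
  GComp :: "'b \<Rightarrow> 'b \<Rightarrow> 'b"

record ('a, 'b, 'c, 'd) ftor =
  fob  :: "'a \<Rightarrow> 'c"
  farr :: "'b \<Rightarrow> 'd"

definition ftor_comp ::
  "('c, 'd, 'e, 'f) ftor \<Rightarrow> ('a, 'b, 'c, 'd) ftor \<Rightarrow> ('a, 'b, 'e, 'f) ftor" where
  "ftor_comp G F = \<lparr>fob = fob G \<circ> fob F, farr = farr G \<circ> farr F\<rparr>"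

definition isomorphic_in :: "('a, 'b) gpd \<Rightarrow> 'a \<Rightarrow> 'a \<Rightarrow> bool" where
  "isomorphic_in G u v \<longleftrightarrow>
     (\<exists>m \<in> GHom G u v. \<exists>n \<in> GHom G v u. GComp G n m = GId G u \<and> GComp G m n = GId G v)"

definition ess_surj :: "('a, 'b) gpd \<Rightarrow> ('c, 'd) gpd \<Rightarrow> ('a, 'b, 'c, 'd) ftor \<Rightarrow> bool" where
  "ess_surj G H F \<longleftrightarrow> (\<forall>v \<in> GOb H. \<exists>u \<in> GOb G. isomorphic_in H (fob F u) v)"

definition full :: "('a, 'b) gpd \<Rightarrow> ('c, 'd) gpd \<Rightarrow> ('a, 'b, 'c, 'd) ftor \<Rightarrow> bool" where
  "full G H F \<longleftrightarrow>
     (\<forall>u \<in> GOb G. \<forall>u' \<in> GOb G. \<forall>m \<in> GHom H (fob F u) (fob F u'). \<exists>k \<in> GHom G u u'. farr F k = m)"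

definition ess_surj_full :: "('a, 'b) gpd \<Rightarrow> ('c, 'd) gpd \<Rightarrow> ('a, 'b, 'c, 'd) ftor \<Rightarrow> bool" where
  "ess_surj_full G H F \<longleftrightarrow> ess_surj G H F \<and> full G H F"

text \<open>The class of H, a map into the path object P of z, up to homotopy over the fibered square
  of the domain of z.\<close>

definition hclass :: "('o, 'm) fwcat \<Rightarrow> 'm \<Rightarrow> 'm path \<Rightarrow> 'm \<Rightarrow> 'm set" where
  "hclass C z P H = {K. fib_homotopic C (st C z P) H K}"

definition is_concat :: "('o, 'm) fwcat \<Rightarrow> 'm \<Rightarrow> 'm path \<Rightarrow> 'm \<Rightarrow> bool" where
  "is_concat C z P \<tau> \<longleftrightarrow>
     \<tau> \<in> hom C (pb_ob C (ptgt P) (psrc P)) (path_ob C P) \<and>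
     psrc P \<cdot>\<^bsub>C\<^esub> \<tau> = psrc P \<cdot>\<^bsub>C\<^esub> pr1 C (ptgt P) (psrc P) \<and>
     ptgt P \<cdot>\<^bsub>C\<^esub> \<tau> = ptgt P \<cdot>\<^bsub>C\<^esub> pr2 C (ptgt P) (psrc P) \<and>
     fib_homotopic C (st C z P)
       (\<tau> \<cdot>\<^bsub>C\<^esub> pair C (ptgt P) (psrc P) (prefl P) (prefl P)) (prefl P)"

text \<open>The hom-groupoid between y from T to J and a fibration z from Z to J, formed with the path
  object P of z. Operations on classes are unions over all representatives and all admissible
  auxiliary maps; these choices do not affect the class, so such a union is a single class.
  \<^term>\<open>GComp G k h\<close> is k after h.\<close>

definition hom_gpd :: "('o, 'm) fwcat \<Rightarrow> 'm \<Rightarrow> 'm \<Rightarrow> 'm path \<Rightarrow> ('m, 'm set) gpd" where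
  "hom_gpd C y z P =
     \<lparr>GOb = {u \<in> hom C (Dom C y) (Dom C z). z \<cdot>\<^bsub>C\<^esub> u = y},
      GHom = (\<lambda>u v. {hclass C z P H | H.
                H \<in> hom C (Dom C y) (path_ob C P) \<and>
                psrc P \<cdot>\<^bsub>C\<^esub> H = u \<and> ptgt P \<cdot>\<^bsub>C\<^esub> H = v}),
      GId = (\<lambda>u. hclass C z P (prefl P \<cdot>\<^bsub>C\<^esub> u)),
      GComp = (\<lambda>k h. \<Union>H \<in> h. \<Union>K \<in> k. \<Union>\<tau> \<in> {\<tau>. is_concat C z P \<tau>}.
                 hclass C z P (\<tau> \<cdot>\<^bsub>C\<^esub> pair C (ptgt P) (psrc P) H K))\<rparr>"

text \<open>The functor induced by a map e over J from (the domain of) a to (the domain of) b, formed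
  with path objects P of a and Q of b.\<close>

definition is_path_map ::
  "('o, 'm) fwcat \<Rightarrow> 'm \<Rightarrow> 'm path \<Rightarrow> 'm path \<Rightarrow> 'm \<Rightarrow> 'm \<Rightarrow> bool" where
  "is_path_map C b P Q e k \<longleftrightarrow>
     k \<in> hom C (path_ob C P) (path_ob C Q) \<and>
     psrc Q \<cdot>\<^bsub>C\<^esub> k = e \<cdot>\<^bsub>C\<^esub> psrc P \<and>
     ptgt Q \<cdot>\<^bsub>C\<^esub> k = e \<cdot>\<^bsub>C\<^esub> ptgt P \<and>
     fib_homotopic C (st C b Q) (k \<cdot>\<^bsub>C\<^esub> prefl P) (prefl Q \<cdot>\<^bsub>C\<^esub> e)"

definition post_ftor ::
  "('o, 'm) fwcat \<Rightarrow> 'm \<Rightarrow> 'm path \<Rightarrow> 'm path \<Rightarrow> 'm \<Rightarrow> ('m, 'm set, 'm, 'm set) ftor" where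
  "post_ftor C b P Q e =
     \<lparr>fob = (\<lambda>u. e \<cdot>\<^bsub>C\<^esub> u),
      farr = (\<lambda>h. \<Union>H \<in> h. \<Union>k \<in> {k. is_path_map C b P Q e k}. hclass C b Q (k \<cdot>\<^bsub>C\<^esub> H))\<rparr>"

definition prod_path :: "('o, 'm) fwcat \<Rightarrow> 'm path \<Rightarrow> 'm path \<Rightarrow> 'm path" where
  "prod_path C P Q =
     \<lparr>prefl = prod_map C (prefl P) (prefl Q),
      psrc = prod_map C (psrc P) (psrc Q),
      ptgt = prod_map C (ptgt P) (ptgt Q)\<rparr>"

text \<open>P and Q are path objects of A and X. The target groupoid is formed with their product as
  path object of the product of A and X.\<close>

definition times_ftor ::
  "('o, 'm) fwcat \<Rightarrow> 'o \<Rightarrow> 'o \<Rightarrow> 'm path \<Rightarrow> 'm path \<Rightarrow> ('m, 'm set, 'm, 'm set) ftor" where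
  "times_ftor C A X P Q =
     \<lparr>fob = (\<lambda>u. prod_map C u (Id C X)),
      farr = (\<lambda>h. \<Union>H \<in> h.
                hclass C (bang C (prod_ob C A X)) (prod_path C P Q) (prod_map C H (prefl Q)))\<rparr>"

definition bc_path :: "('o, 'm) fwcat \<Rightarrow> 'm \<Rightarrow> 'm \<Rightarrow> 'm path \<Rightarrow> 'm path" where
  "bc_path C g a P =
     \<lparr>prefl = base_change C g (a \<cdot>\<^bsub>C\<^esub> psrc P) (prefl P),
      psrc = base_change C g a (psrc P),
      ptgt = base_change C g a (ptgt P)\<rparr>"

text \<open>P is a path object of a. The target groupoid is formed with its base change along g as path
  object of the base change of a.\<close>

definition bc_ftor ::
  "('o, 'm) fwcat \<Rightarrow> 'm \<Rightarrow> 'm \<Rightarrow> 'm path \<Rightarrow> ('m, 'm set, 'm, 'm set) ftor" where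
  "bc_ftor C g a P =
     \<lparr>fob = (\<lambda>u. base_change C g a u),
      farr = (\<lambda>h. \<Union>H \<in> h.
                hclass C (pr2 C a g) (bc_path C g a P) (base_change C g (a \<cdot>\<^bsub>C\<^esub> psrc P) H))\<rparr>"

definition exp_ftor ::
  "('o, 'm) fwcat \<Rightarrow> 'o \<Rightarrow> 'o \<Rightarrow> 'o \<Rightarrow> 'm \<Rightarrow> ('m, 'm set, 'm, 'm set) ftor" where
  "exp_ftor C X Y E e =
     (let P = the_path C (bang C E); Q = the_path C (bang C X); R = the_path C (bang C Y)
      in ftor_comp (post_ftor C (bang C Y) (prod_path C P Q) R e) (times_ftor C E X P Q))"

definition hom_gpd1 :: "('o, 'm) fwcat \<Rightarrow> 'o \<Rightarrow> 'o \<Rightarrow> ('m, 'm set) gpd" where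
  "hom_gpd1 C T A = hom_gpd C (bang C T) (bang C A) (the_path C (bang C A))"

definition weak_exponential :: "('o, 'm) fwcat \<Rightarrow> 'o \<Rightarrow> 'o \<Rightarrow> 'o \<Rightarrow> 'm \<Rightarrow> bool" where
  "weak_exponential C X Y E e \<longleftrightarrow>
     X \<in> Ob C \<and> Y \<in> Ob C \<and> E \<in> Ob C \<and> e \<in> hom C (prod_ob C E X) Y \<and>
     (\<forall>T \<in> Ob C. ess_surj (hom_gpd1 C T E) (hom_gpd1 C (prod_ob C T X) Y) (exp_ftor C X Y E e))"

definition strong_exponential :: "('o, 'm) fwcat \<Rightarrow> 'o \<Rightarrow> 'o \<Rightarrow> 'o \<Rightarrow> 'm \<Rightarrow> bool" where
  "strong_exponential C X Y E e \<longleftrightarrow>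
     X \<in> Ob C \<and> Y \<in> Ob C \<and> E \<in> Ob C \<and> e \<in> hom C (prod_ob C E X) Y \<and>
     (\<forall>T \<in> Ob C. ess_surj_full (hom_gpd1 C T E) (hom_gpd1 C (prod_ob C T X) Y)
                    (exp_ftor C X Y E e))"

definition pi_ftor ::
  "('o, 'm) fwcat \<Rightarrow> 'm \<Rightarrow> 'm \<Rightarrow> 'm \<Rightarrow> 'm \<Rightarrow> ('m, 'm set, 'm, 'm set) ftor" where
  "pi_ftor C f g \<pi> e =
     (let P = the_path C \<pi>
      in ftor_comp (post_ftor C f (bc_path C g \<pi> P) (the_path C f) e) (bc_ftor C g \<pi> P))"

text \<open>Here f from X to I and g from I to J are composable fibrations, \<^term>\<open>\<pi>\<close> is the fibration
  over J, and e is the map over I from its base change along g to X.\<close>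

definition weak_Pi_type :: "('o, 'm) fwcat \<Rightarrow> 'm \<Rightarrow> 'm \<Rightarrow> 'm \<Rightarrow> 'm \<Rightarrow> bool" where
  "weak_Pi_type C f g \<pi> e \<longleftrightarrow>
     f \<in> Fib C \<and> g \<in> Fib C \<and> Cod C f = Dom C g \<and> \<pi> \<in> Fib C \<and> Cod C \<pi> = Cod C g \<and>
     e \<in> hom C (pb_ob C \<pi> g) (Dom C f) \<and> f \<cdot>\<^bsub>C\<^esub> e = pr2 C \<pi> g \<and>
     (\<forall>y \<in> Arr C. Cod C y = Cod C g \<longrightarrow>
        ess_surj (hom_gpd C y \<pi> (the_path C \<pi>)) (hom_gpd C (pr2 C y g) f (the_path C f))
          (pi_ftor C f g \<pi> e))"

definition strong_Pi_type :: "('o, 'm) fwcat \<Rightarrow> 'm \<Rightarrow> 'm \<Rightarrow> 'm \<Rightarrow> 'm \<Rightarrow> bool" where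
  "strong_Pi_type C f g \<pi> e \<longleftrightarrow>
     f \<in> Fib C \<and> g \<in> Fib C \<and> Cod C f = Dom C g \<and> \<pi> \<in> Fib C \<and> Cod C \<pi> = Cod C g \<and>
     e \<in> hom C (pb_ob C \<pi> g) (Dom C f) \<and> f \<cdot>\<^bsub>C\<^esub> e = pr2 C \<pi> g \<and>
     (\<forall>y \<in> Arr C. Cod C y = Cod C g \<longrightarrow>
        ess_surj_full (hom_gpd C y \<pi> (the_path C \<pi>)) (hom_gpd C (pr2 C y g) f (the_path C f))
          (pi_ftor C f g \<pi> e))"

definition has_weak_Pi_types :: "('o, 'm) fwcat \<Rightarrow> bool" where
  "has_weak_Pi_types C \<longleftrightarrow>
     (\<forall>f \<in> Fib C. \<forall>g \<in> Fib C. Cod C f = Dom C g \<longrightarrow> (\<exists>\<pi> e. weak_Pi_type C f g \<pi> e))"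

definition has_strong_Pi_types :: "('o, 'm) fwcat \<Rightarrow> bool" where
  "has_strong_Pi_types C \<longleftrightarrow>
     (\<forall>f \<in> Fib C. \<forall>g \<in> Fib C. Cod C f = Dom C g \<longrightarrow> (\<exists>\<pi> e. strong_Pi_type C f g \<pi> e))"

end

theory Submission
  imports Defs
begin

text \<open>Let \<open>B\<close> be an exponential of \<open>Z\<close> by \<open>X\<close> with evaluation \<open>d : B \<times> X \<rightarrow> Z\<close>. A map \<open>T \<times> X \<rightarrow> Y\<close> amounts to a map \<open>w : T \<rightarrow> B\<close>
  together with a lift of \<open>d (w \<times> 1)\<close> through \<open>p\<close>. The lifts are the sections over \<open>w\<close> of the pullback of \<open>p\<close> along
  \<open>d\<close>, and sections along the projection \<open>g : B \<times> X \<rightarrow> B\<close> are what a Pi-type classifies. So the exponential of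
  \<open>Y\<close> is the total space \<open>E\<close> of the Pi-type of that pullback along \<open>g\<close>, the fibration is its structure map \<open>\<pi>\<close> to \<open>B\<close>,
  and evaluation is the evaluation \<open>e\<close> of the Pi-type followed by the projection to \<open>Y\<close>. The required
  square commutes strictly because \<open>e\<close> is a map over \<open>B \<times> X\<close> (\<open>eval_over\<close>).

  Both universal properties only represent maps and paths up to homotopy, while the construction
  needs strict equalities over the base. Homotopy lifting for \<open>p\<close> repairs this. For essential
  surjectivity, \<open>p v\<close> is only homotopic to some \<open>d (w \<times> 1)\<close>; lifting the homotopy replaces \<open>v\<close> by a homotopic map that lies
  strictly over it (\<open>eval_ess_surj\<close>). For fullness, a path in \<open>Y\<close> is pushed to \<open>Z\<close>, represented by a path in \<open>B\<close>
  and lifted to \<open>E\<close>. The evaluation of the lift and the given path have the same source and homotopic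
  images in \<open>Z\<close>, and then they differ by a path inside the fibers of \<open>p\<close> (\<open>corner_homotopicI\<close> and
  \<open>corner_homotopic_concat\<close>), which the Pi-type represents (\<open>eval_full\<close>).

  The homotopy theory behind this rests on one fact: a weak equivalence lifts against a fibration,
  strictly below the diagonal and up to fiberwise homotopy above it, and uniquely up to fiberwise homotopy
  (\<open>lift\<close> and \<open>lift_unique\<close>). Applied to the reflexivity \<open>r\<close> it becomes a principle of path induction for
  natural constructions on paths (\<open>path_induction\<close>), from which concatenation, inversion, transport and
  the compatibility of the functors with concatenation follow.\<close>

section \<open>Composition, isomorphisms and pullbacks\<close>

context category
begin

lemma comp_arr [simp]:
  assumes "f \<in> Arr C" "g \<in> Arr C" "Cod C f = Dom C g"
  shows "g \<cdot> f \<in> Arr C" "Dom C (g \<cdot> f) = Dom C f" "Cod C (g \<cdot> f) = Cod C g"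
  using comp_hom[of f "Dom C f" "Cod C f" g "Cod C g"] assms by (auto simp: hom_def)

lemma id_arr [simp]:
  assumes "x \<in> Ob C"
  shows "Id C x \<in> Arr C" "Dom C (Id C x) = x" "Cod C (Id C x) = x"
  using id_hom[OF assms] by (auto simp: hom_def)

lemma comp_id_arr [simp]: "f \<in> Arr C \<Longrightarrow> Dom C f = x \<Longrightarrow> f \<cdot> Id C x = f"
  using comp_id[of f x "Cod C f"] by (simp add: hom_def)

lemma id_comp_arr [simp]: "f \<in> Arr C \<Longrightarrow> Cod C f = x \<Longrightarrow> Id C x \<cdot> f = f"
  using id_comp[of f "Dom C f" x] by (simp add: hom_def)

lemma comp_assoc_arr [simp]:
  assumes "f \<in> Arr C" "g \<in> Arr C" "h \<in> Arr C" "Cod C f = Dom C g" "Cod C g = Dom C h"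
  shows "(h \<cdot> g) \<cdot> f = h \<cdot> (g \<cdot> f)"
  using comp_assoc[of f "Dom C f" "Cod C f" g "Cod C g" h "Cod C h"] assms by (simp add: hom_def)

lemma hom_ob: "f \<in> hom C x y \<Longrightarrow> x \<in> Ob C" "f \<in> hom C x y \<Longrightarrow> y \<in> Ob C"
  using dom_ob cod_ob by (auto simp: hom_def)

lemma homD:
  assumes "f \<in> hom C x y"
  shows "f \<in> Arr C" "Dom C f = x" "Cod C f = y" "x \<in> Ob C" "y \<in> Ob C"
  using assms hom_ob[OF assms] by (auto simp: hom_def)

text \<open>Composites are kept bracketed to the right, so an equation between composites is also
  used with a further map in front.\<close>

lemma comp_eq_ext:
  assumes "a \<cdot> b = c" "a \<in> Arr C" "b \<in> Arr C" "Cod C b = Dom C a" "x \<in> Arr C" "Cod C x = Dom C b"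
  shows "a \<cdot> (b \<cdot> x) = c \<cdot> x"
  using comp_assoc_arr[of x b a] assms by simp

lemma comp_eq_ext2:
  assumes "a \<cdot> b = c \<cdot> d" "a \<in> Arr C" "b \<in> Arr C" "Cod C b = Dom C a"
    "c \<in> Arr C" "d \<in> Arr C" "Cod C d = Dom C c" "x \<in> Arr C" "Cod C x = Dom C b"
  shows "a \<cdot> (b \<cdot> x) = c \<cdot> (d \<cdot> x)"
proof -
  have "Dom C d = Dom C b" using assms(1-7) comp_arr(2) by metis
  then show ?thesis using comp_assoc_arr[of x b a] comp_assoc_arr[of x d c] assms by simp
qed

lemma is_isoI:
  assumes "f \<in> hom C x y" "g \<in> hom C y x" "g \<cdot> f = Id C x" "f \<cdot> g = Id C y"
  shows "is_iso C f"
  using assms unfolding is_iso_def hom_def by auto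

lemma is_pullback_sym: "is_pullback C f g p q \<Longrightarrow> is_pullback C g f q p"
  unfolding is_pullback_def by (auto; metis)

text \<open>Existence of the mediating map and its uniqueness are separated, since the former is given
  by an explicit formula and the latter is checked on components.\<close>

lemma is_pullbackI:
  assumes "f \<in> hom C a d" "g \<in> hom C b d" "p \<in> hom C e a" "q \<in> hom C e b" "f \<cdot> p = g \<cdot> q"
    and "\<And>w x y. \<lbrakk>x \<in> hom C w a; y \<in> hom C w b; f \<cdot> x = g \<cdot> y\<rbrakk>
            \<Longrightarrow> \<exists>m. m \<in> hom C w e \<and> p \<cdot> m = x \<and> q \<cdot> m = y"
    and "\<And>w m n. \<lbrakk>m \<in> hom C w e; n \<in> hom C w e; p \<cdot> m = p \<cdot> n; q \<cdot> m = q \<cdot> n\<rbrakk> \<Longrightarrow> m = n"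
  shows "is_pullback C f g p q"
  unfolding is_pullback_def
proof (intro conjI allI ballI impI)
  fix w x y
  assume h: "x \<in> hom C w (Dom C f)" "y \<in> hom C w (Dom C g)" "f \<cdot> x = g \<cdot> y"
  obtain m where "m \<in> hom C w e \<and> p \<cdot> m = x \<and> q \<cdot> m = y"
    using assms(1,2) assms(6)[of x w y] h by (auto simp: hom_def)
  moreover have "Dom C p = e" using assms(3) by (simp add: hom_def)
  ultimately show "\<exists>!m. m \<in> hom C w (Dom C p) \<and> p \<cdot> m = x \<and> q \<cdot> m = y"
    using assms(7) by (metis (mono_tags, lifting))
qed (use assms(1-5) in \<open>auto simp: hom_def\<close>)

end

context path_category
begin

lemma fibD [simp, dest]: "f \<in> Fib C \<Longrightarrow> f \<in> Arr C"
  using fib_arr by auto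

lemma weD [dest]: "f \<in> WE C \<Longrightarrow> f \<in> Arr C"
  using we_arr by auto

lemma id_iso: "x \<in> Ob C \<Longrightarrow> is_iso C (Id C x)"
  by (rule is_isoI[of _ x x "Id C x"]) (auto simp: hom_def)

lemma id_fib [simp]: "x \<in> Ob C \<Longrightarrow> Id C x \<in> Fib C"
  and id_we [simp]: "x \<in> Ob C \<Longrightarrow> Id C x \<in> WE C"
  using iso_acyclic[OF id_iso] by auto

lemma we_comp:
  assumes "f \<in> WE C" "g \<in> WE C" "Cod C f = Dom C g"
  shows "g \<cdot> f \<in> WE C"
  using two_out_of_six[of f "Dom C f" "Cod C f" "Id C (Dom C g)" "Cod C f" g "Cod C g"] assms
  by (auto simp: hom_def weD cod_ob dom_ob)

lemma we_cancel_left: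
  assumes "g \<cdot> f \<in> WE C" "g \<in> WE C" "f \<in> Arr C" "Cod C f = Dom C g"
  shows "f \<in> WE C"
  using two_out_of_six[of f "Dom C f" "Cod C f" g "Cod C g" "Id C (Cod C g)" "Cod C g"] assms
  by (auto simp: hom_def weD cod_ob dom_ob)

lemma we_cancel_right:
  assumes "g \<cdot> f \<in> WE C" "f \<in> WE C" "g \<in> Arr C" "Cod C f = Dom C g"
  shows "g \<in> WE C"
  using two_out_of_six[of "Id C (Dom C f)" "Dom C f" "Dom C f" f "Cod C f" g "Cod C g"] assms
  by (auto simp: hom_def weD cod_ob dom_ob)

lemma section_we:
  assumes "p \<cdot> s = Id C x" "p \<in> WE C" "s \<in> Arr C" "Cod C s = Dom C p" "x \<in> Ob C"
  shows "s \<in> WE C"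
  using we_cancel_left[of p s] assms by simp

lemma fib_comp' [simp]: "\<lbrakk>f \<in> Fib C; g \<in> Fib C; Cod C f = Dom C g\<rbrakk> \<Longrightarrow> g \<cdot> f \<in> Fib C"
  by (rule fib_comp)

lemma pullback_fib': "\<lbrakk>p \<in> Fib C; is_pullback C p f u v\<rbrakk> \<Longrightarrow> v \<in> Fib C"
  using pullback_fib is_pullback_sym by blast

lemma pullback_we: "\<lbrakk>p \<in> Fib C; p \<in> WE C; is_pullback C f p u v\<rbrakk> \<Longrightarrow> u \<in> WE C"
  using pullback_acyclic by blast

lemma pullback_we': "\<lbrakk>p \<in> Fib C; p \<in> WE C; is_pullback C p f u v\<rbrakk> \<Longrightarrow> v \<in> WE C"
  using pullback_we is_pullback_sym by blast

text \<open>One leg being a fibration is what makes the chosen pullback exist.\<close>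

definition cospan :: "'m \<Rightarrow> 'm \<Rightarrow> bool" where
  "cospan f g \<longleftrightarrow> f \<in> Arr C \<and> g \<in> Arr C \<and> Cod C f = Cod C g \<and> (f \<in> Fib C \<or> g \<in> Fib C)"

lemma pb_is_pullback:
  assumes "cospan f g"
  shows "is_pullback C f g (pr1 C f g) (pr2 C f g)"
proof -
  have "\<exists>u v. is_pullback C f g u v"
    using assms pullback_ex[of g f] pullback_ex[of f g] is_pullback_sym
    unfolding cospan_def by metis
  then have "case pb C f g of (p, q) \<Rightarrow> is_pullback C f g p q"
    unfolding pb_def by (intro someI_ex[of "\<lambda>(p, q). is_pullback C f g p q"]) auto
  then show ?thesis by (simp add: pr1_def pr2_def case_prod_beta)
qed

lemma pr_arr [simp]:
  assumes "cospan f g"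
  shows "pr1 C f g \<in> Arr C" "pr2 C f g \<in> Arr C"
    "Dom C (pr1 C f g) = pb_ob C f g" "Dom C (pr2 C f g) = pb_ob C f g"
    "Cod C (pr1 C f g) = Dom C f" "Cod C (pr2 C f g) = Dom C g"
    "pb_ob C f g \<in> Ob C"
proof -
  note pb = pb_is_pullback[OF assms, unfolded is_pullback_def]
  show "pr1 C f g \<in> Arr C" "pr2 C f g \<in> Arr C"
    "Cod C (pr1 C f g) = Dom C f" "Cod C (pr2 C f g) = Dom C g"
    using pb by blast+
  show "Dom C (pr1 C f g) = pb_ob C f g" by (simp add: pb_ob_def)
  show "Dom C (pr2 C f g) = pb_ob C f g" using pb by (metis pb_ob_def)
  show "pb_ob C f g \<in> Ob C" using pb by (metis pb_ob_def dom_ob)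
qed

lemma pr_eq:
  assumes "cospan f g"
  shows "f \<cdot> pr1 C f g = g \<cdot> pr2 C f g"
  using pb_is_pullback[OF assms] unfolding is_pullback_def by auto

lemma pr_fib [simp]:
  "cospan f g \<Longrightarrow> g \<in> Fib C \<Longrightarrow> pr1 C f g \<in> Fib C"
  "cospan f g \<Longrightarrow> f \<in> Fib C \<Longrightarrow> pr2 C f g \<in> Fib C"
  using pb_is_pullback pullback_fib pullback_fib' by blast+

lemma pr_we:
  "cospan f g \<Longrightarrow> g \<in> Fib C \<Longrightarrow> g \<in> WE C \<Longrightarrow> pr1 C f g \<in> WE C"
  "cospan f g \<Longrightarrow> f \<in> Fib C \<Longrightarrow> f \<in> WE C \<Longrightarrow> pr2 C f g \<in> WE C"
  using pb_is_pullback pullback_we pullback_we' by blast+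

text \<open>The pairs of maps for which the paired map into the chosen pullback is defined.\<close>

definition cone :: "'m \<Rightarrow> 'm \<Rightarrow> 'm \<Rightarrow> 'm \<Rightarrow> bool" where
  "cone f g a b \<longleftrightarrow> cospan f g \<and> a \<in> Arr C \<and> b \<in> Arr C \<and> Dom C a = Dom C b \<and>
     Cod C a = Dom C f \<and> Cod C b = Dom C g \<and> f \<cdot> a = g \<cdot> b"

lemma pair_ex1:
  assumes "cone f g a b"
  shows "\<exists>!m. m \<in> hom C (Dom C a) (pb_ob C f g) \<and> pr1 C f g \<cdot> m = a \<and> pr2 C f g \<cdot> m = b"
proof -
  have c: "cospan f g" and h: "a \<in> hom C (Dom C a) (Dom C f)" "b \<in> hom C (Dom C a) (Dom C g)"
    "f \<cdot> a = g \<cdot> b" using assms by (simp_all add: cone_def hom_def)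
  then show ?thesis
    using pb_is_pullback[OF c] unfolding is_pullback_def pb_ob_def by blast
qed

lemma pair_props:
  assumes "cone f g a b"
  shows "pair C f g a b \<in> hom C (Dom C a) (pb_ob C f g)"
    "pr1 C f g \<cdot> pair C f g a b = a" "pr2 C f g \<cdot> pair C f g a b = b"
  using theI'[OF pair_ex1[OF assms]] unfolding pair_def by auto

lemma pair_arr [simp]:
  assumes "cone f g a b"
  shows "pair C f g a b \<in> Arr C" "Dom C (pair C f g a b) = Dom C a"
    "Cod C (pair C f g a b) = pb_ob C f g"
    "pr1 C f g \<cdot> pair C f g a b = a" "pr2 C f g \<cdot> pair C f g a b = b"
  using pair_props[OF assms] by (auto simp: hom_def)

lemma pb_ext:
  assumes "cospan f g" "m \<in> Arr C" "n \<in> Arr C" "Dom C m = Dom C n"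
    "Cod C m = pb_ob C f g" "Cod C n = pb_ob C f g"
    "pr1 C f g \<cdot> m = pr1 C f g \<cdot> n" "pr2 C f g \<cdot> m = pr2 C f g \<cdot> n"
  shows "m = n"
proof -
  have "cone f g (pr1 C f g \<cdot> n) (pr2 C f g \<cdot> n)"
    using assms pr_eq[OF assms(1)] comp_eq_ext2[OF pr_eq[OF assms(1)], of n]
    unfolding cone_def by (auto simp: cospan_def)
  from pair_ex1[OF this] show ?thesis using assms by (auto simp: hom_def)
qed

lemma cone_comp:
  assumes "cone f g a b" "x \<in> Arr C" "Cod C x = Dom C a"
  shows "cone f g (a \<cdot> x) (b \<cdot> x)"
  using assms comp_eq_ext2[of f a g b x] unfolding cone_def by (auto simp: cospan_def)

lemma pair_comp [simp]:
  assumes "cone f g a b" "x \<in> Arr C" "Cod C x = Dom C a"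
  shows "pair C f g a b \<cdot> x = pair C f g (a \<cdot> x) (b \<cdot> x)"
proof -
  have c: "cone f g (a \<cdot> x) (b \<cdot> x)" by (rule cone_comp[OF assms])
  have cs: "cospan f g" using assms(1) by (simp add: cone_def)
  show ?thesis
  proof (rule pb_ext[OF cs])
    have "Dom C a = Dom C b" using assms by (simp add: cone_def)
    then show "pr1 C f g \<cdot> (pair C f g a b \<cdot> x) = pr1 C f g \<cdot> pair C f g (a \<cdot> x) (b \<cdot> x)"
      "pr2 C f g \<cdot> (pair C f g a b \<cdot> x) = pr2 C f g \<cdot> pair C f g (a \<cdot> x) (b \<cdot> x)"
      using comp_eq_ext[OF pair_arr(4)[OF assms(1)]] comp_eq_ext[OF pair_arr(5)[OF assms(1)]]
      using assms c cs by auto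
  qed (use assms c cs in \<open>auto simp: cone_def\<close>)
qed

lemma pair_pr_comp [simp]:
  assumes "cone f g a b" "x \<in> Arr C" "Cod C x = Dom C a"
  shows "pr1 C f g \<cdot> (pair C f g a b \<cdot> x) = a \<cdot> x" "pr2 C f g \<cdot> (pair C f g a b \<cdot> x) = b \<cdot> x"
  using cone_comp[OF assms] assms by auto

lemma pair_eta [simp]:
  assumes "cospan f g" "m \<in> Arr C" "Cod C m = pb_ob C f g"
  shows "pair C f g (pr1 C f g \<cdot> m) (pr2 C f g \<cdot> m) = m"
proof -
  have c: "cone f g (pr1 C f g \<cdot> m) (pr2 C f g \<cdot> m)"
    using assms comp_eq_ext2[OF pr_eq[OF assms(1)], of m] unfolding cone_def
    by (auto simp: cospan_def)
  show ?thesis by (rule pb_ext[OF assms(1)]) (use assms c in auto)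
qed

lemma pair_eta_id [simp]:
  assumes "cospan f g"
  shows "pair C f g (pr1 C f g) (pr2 C f g) = Id C (pb_ob C f g)"
  using pair_eta[OF assms, of "Id C (pb_ob C f g)"] assms by simp

section \<open>Products\<close>

lemma terminal_one: "terminal C (one C)"
  using terminal_ex unfolding one_def by (metis someI_ex)

lemma one_ob [simp]: "one C \<in> Ob C"
  using terminal_one by (simp add: terminal_def)

lemma bang_hom: "x \<in> Ob C \<Longrightarrow> bang C x \<in> hom C x (one C)"
  using terminal_one unfolding terminal_def bang_def
  by (intro theI'[of "\<lambda>f. f \<in> hom C x (one C)"]) blast

lemma bang_arr [simp]:
  assumes "x \<in> Ob C"
  shows "bang C x \<in> Arr C" "Dom C (bang C x) = x" "Cod C (bang C x) = one C"
  using bang_hom[OF assms] by (auto simp: hom_def)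

lemma to_one_unique:
  assumes "f \<in> hom C x (one C)" "g \<in> hom C x (one C)"
  shows "f = g"
  using terminal_one assms hom_ob unfolding terminal_def by blast

lemma bang_comp [simp]:
  assumes "f \<in> Arr C" "Cod C f = x"
  shows "bang C x \<cdot> f = bang C (Dom C f)"
  by (rule to_one_unique[of _ "Dom C f"]) (use assms dom_ob cod_ob in \<open>auto simp: hom_def\<close>)

lemma bang_fib [simp]:
  assumes "x \<in> Ob C"
  shows "bang C x \<in> Fib C"
proof -
  obtain t where t: "terminal C t" "\<forall>f \<in> Arr C. Cod C f = t \<longrightarrow> f \<in> Fib C"
    using terminal_ex by auto
  have tob: "t \<in> Ob C" using t by (simp add: terminal_def)
  obtain a where a: "a \<in> hom C x t" using t assms unfolding terminal_def by blast
  obtain b where b: "b \<in> hom C (one C) t" using t unfolding terminal_def by (meson one_ob)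
  have "is_iso C (bang C t)"
  proof (rule is_isoI[OF bang_hom[OF tob] b])
    show "b \<cdot> bang C t = Id C t"
      using t tob b bang_hom[OF tob] id_hom[OF tob] comp_hom unfolding terminal_def by blast
    show "bang C t \<cdot> b = Id C (one C)"
      by (rule to_one_unique[of _ "one C"]) (use b tob in \<open>auto simp: hom_def\<close>)
  qed
  then have "bang C t \<cdot> a \<in> Fib C"
    using a t iso_acyclic tob by (intro fib_comp) (auto simp: hom_def)
  then show ?thesis using a by (auto simp: hom_def)
qed

lemma cospan_bang [simp]: "x \<in> Ob C \<Longrightarrow> y \<in> Ob C \<Longrightarrow> cospan (bang C x) (bang C y)"
  by (simp add: cospan_def)

lemma cone_bang [simp]:
  assumes "a \<in> Arr C" "b \<in> Arr C" "Dom C a = Dom C b" "Cod C a = x" "Cod C b = y"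
  shows "cone (bang C x) (bang C y) a b"
  using assms cod_ob by (auto simp: cone_def)

abbreviation "prod_pair x y \<equiv> pair C (bang C x) (bang C y)"
abbreviation "prod_pr1 x y \<equiv> pr1 C (bang C x) (bang C y)"
abbreviation "prod_pr2 x y \<equiv> pr2 C (bang C x) (bang C y)"

lemma prod_ob_ob [simp]: "x \<in> Ob C \<Longrightarrow> y \<in> Ob C \<Longrightarrow> prod_ob C x y \<in> Ob C"
  by (simp add: prod_ob_def)

lemma prod_map_arr [simp]:
  assumes "u \<in> Arr C" "v \<in> Arr C"
  shows "prod_map C u v \<in> Arr C"
    "Dom C (prod_map C u v) = prod_ob C (Dom C u) (Dom C v)"
    "Cod C (prod_map C u v) = prod_ob C (Cod C u) (Cod C v)"
  using assms dom_ob[OF assms(1)] dom_ob[OF assms(2)] cod_ob[OF assms(1)] cod_ob[OF assms(2)]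
  by (simp_all add: prod_map_def prod_ob_def)

lemma prod_map_pair [simp]:
  assumes "u \<in> Arr C" "v \<in> Arr C" "a \<in> Arr C" "b \<in> Arr C" "Dom C a = Dom C b"
    "Cod C a = Dom C u" "Cod C b = Dom C v" "Dom C u = x" "Dom C v = y"
  shows "prod_map C u v \<cdot> prod_pair x y a b =
    prod_pair (Cod C u) (Cod C v) (u \<cdot> a) (v \<cdot> b)"
  using assms dom_ob[OF assms(1)] dom_ob[OF assms(2)] cod_ob[OF assms(1)] cod_ob[OF assms(2)]
  by (auto simp: prod_map_def)

section \<open>Path objects and lifting\<close>

abbreviation paths :: "'o \<Rightarrow> 'm path \<Rightarrow> 'm set" where
  "paths T P \<equiv> hom C T (path_ob C P)"

lemma pb_ob_dom: "cospan f g \<Longrightarrow> m \<in> Arr C \<Longrightarrow> Cod C m = pb_ob C f g \<Longrightarrow>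
  f \<cdot> (pr1 C f g \<cdot> m) = g \<cdot> (pr2 C f g \<cdot> m)"
  by (rule comp_eq_ext2[OF pr_eq]) (auto simp: cospan_def)

lemma path_objectD:
  assumes "is_path_object C p P"
  shows "p \<in> Fib C" "p \<in> Arr C" "cospan p p" "path_ob C P \<in> Ob C" "Dom C p \<in> Ob C"
    "prefl P \<in> WE C" "prefl P \<in> Arr C" "Dom C (prefl P) = Dom C p" "Cod C (prefl P) = path_ob C P"
    "psrc P \<in> Arr C" "Dom C (psrc P) = path_ob C P" "Cod C (psrc P) = Dom C p"
    "ptgt P \<in> Arr C" "Dom C (ptgt P) = path_ob C P" "Cod C (ptgt P) = Dom C p"
    "psrc P \<cdot> prefl P = Id C (Dom C p)" "ptgt P \<cdot> prefl P = Id C (Dom C p)"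
    "p \<cdot> psrc P = p \<cdot> ptgt P" "cone p p (psrc P) (ptgt P)"
    "st C p P \<in> Fib C" "st C p P \<in> Arr C" "Dom C (st C p P) = path_ob C P"
    "Cod C (st C p P) = pb_ob C p p"
    "pr1 C p p \<cdot> st C p P = psrc P" "pr2 C p p \<cdot> st C p P = ptgt P"
proof -
  note P = assms[unfolded is_path_object_def]
  show p: "p \<in> Fib C" "p \<in> Arr C" using P by auto
  show cs: "cospan p p" using p by (simp add: cospan_def)
  show r: "prefl P \<in> WE C" "prefl P \<in> Arr C" "Dom C (prefl P) = Dom C p"
    "Cod C (prefl P) = path_ob C P"
    and s: "psrc P \<in> Arr C" "Dom C (psrc P) = path_ob C P" "Cod C (psrc P) = Dom C p"
    and t: "ptgt P \<in> Arr C" "Dom C (ptgt P) = path_ob C P" "Cod C (ptgt P) = Dom C p"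
    and eq: "psrc P \<cdot> prefl P = Id C (Dom C p)" "ptgt P \<cdot> prefl P = Id C (Dom C p)"
      "p \<cdot> psrc P = p \<cdot> ptgt P"
    and st: "st C p P \<in> Fib C"
    using P by (auto simp: hom_def)
  show "path_ob C P \<in> Ob C" using s dom_ob by metis
  show "Dom C p \<in> Ob C" using p by (simp add: dom_ob)
  show c: "cone p p (psrc P) (ptgt P)" using s t eq cs by (simp add: cone_def)
  show "st C p P \<in> Arr C" using st by simp
  show "Dom C (st C p P) = path_ob C P" "Cod C (st C p P) = pb_ob C p p"
    "pr1 C p p \<cdot> st C p P = psrc P" "pr2 C p p \<cdot> st C p P = ptgt P"
    using c s unfolding st_def by auto
qed

lemma path_object_ext:
  assumes "is_path_object C p P" "x \<in> Arr C"
  shows "Cod C x = Dom C p \<Longrightarrow> psrc P \<cdot> (prefl P \<cdot> x) = x"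
    "Cod C x = Dom C p \<Longrightarrow> ptgt P \<cdot> (prefl P \<cdot> x) = x"
    "Cod C x = path_ob C P \<Longrightarrow> p \<cdot> (psrc P \<cdot> x) = p \<cdot> (ptgt P \<cdot> x)"
    "Cod C x = path_ob C P \<Longrightarrow> pr1 C p p \<cdot> (st C p P \<cdot> x) = psrc P \<cdot> x"
    "Cod C x = path_ob C P \<Longrightarrow> pr2 C p p \<cdot> (st C p P \<cdot> x) = ptgt P \<cdot> x"
  using assms(2) path_objectD[OF assms(1)]
    comp_eq_ext[of "psrc P" "prefl P" _ x] comp_eq_ext[of "ptgt P" "prefl P" _ x]
    comp_eq_ext2[of p "psrc P" p "ptgt P" x] comp_eq_ext[of "pr1 C p p" "st C p P" _ x]
    comp_eq_ext[of "pr2 C p p" "st C p P" _ x]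
  by auto

lemmas path_simps = path_objectD path_object_ext

lemma path_src_acyclic:
  assumes "is_path_object C p P"
  shows "psrc P \<in> Fib C" "psrc P \<in> WE C"
proof -
  note [simp] = path_simps[OF assms]
  have "pr1 C p p \<cdot> st C p P \<in> Fib C" by (rule fib_comp) auto
  then show "psrc P \<in> Fib C" by simp
  show "psrc P \<in> WE C" using we_cancel_right[of "psrc P" "prefl P"] by simp
qed

lemma path_tgt_acyclic:
  assumes "is_path_object C p P"
  shows "ptgt P \<in> Fib C" "ptgt P \<in> WE C"
proof -
  note [simp] = path_simps[OF assms]
  have "pr2 C p p \<cdot> st C p P \<in> Fib C" by (rule fib_comp) auto
  then show "ptgt P \<in> Fib C" by simp
  show "ptgt P \<in> WE C" using we_cancel_right[of "ptgt P" "prefl P"] by simp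
qed

lemma st_eqI:
  assumes "is_path_object C p P" "H \<in> paths T P" "K \<in> paths T P"
    "psrc P \<cdot> H = psrc P \<cdot> K" "ptgt P \<cdot> H = ptgt P \<cdot> K"
  shows "st C p P \<cdot> H = st C p P \<cdot> K"
  by (simp add: path_simps[OF assms(1)] homD[OF assms(2)] homD[OF assms(3)] assms(4,5) st_def)

lemma st_eqD:
  assumes "is_path_object C p P" "H \<in> paths T P" "K \<in> paths T P"
    "st C p P \<cdot> H = st C p P \<cdot> K"
  shows "psrc P \<cdot> H = psrc P \<cdot> K" "ptgt P \<cdot> H = ptgt P \<cdot> K"
proof -
  note [simp] = path_simps[OF assms(1)] homD[OF assms(2)] homD[OF assms(3)]
  show "psrc P \<cdot> H = psrc P \<cdot> K"
    using arg_cong[OF assms(4), of "Comp C (pr1 C p p)"] by simp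
  show "ptgt P \<cdot> H = ptgt P \<cdot> K"
    using arg_cong[OF assms(4), of "Comp C (pr2 C p p)"] by simp
qed

text \<open>The mapping path space: points of the domain together with a path starting at their image.
  Sending such a path to its end is a fibration because the space is a pullback of
  \<open>(s,t)\<close> along \<open>f \<times> 1\<close>.\<close>

lemma factorization:
  assumes f: "f \<in> hom C Y X"
  obtains w d D where "w \<in> WE C" "w \<in> hom C Y D" "d \<in> Fib C" "d \<in> hom C D X" "d \<cdot> w = f"
proof -
  have ob [simp]: "X \<in> Ob C" "Y \<in> Ob C" using hom_ob[OF f] by auto
  obtain P where P: "is_path_object C (bang C X) P" using path_object_ex[of X] by auto
  define s t D where "s = psrc P" and "t = ptgt P" and "D = pb_ob C f s"
  note [simp] = homD[OF f] path_simps[OF P, folded s_def t_def]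
    path_src_acyclic[OF P, folded s_def]
  have cs [simp]: "cospan f s" by (simp add: cospan_def)
  note [simp] = pr_eq[OF cs]
  have pe: "f \<cdot> (pr1 C f s \<cdot> m) = s \<cdot> (pr2 C f s \<cdot> m)" if "m \<in> Arr C" "Cod C m = D" for m
    using pb_ob_dom[OF cs, of m] that by (simp add: D_def)
  define c where "c = prod_pair Y X (pr1 C f s) (t \<cdot> pr2 C f s)"
  define h where "h = prod_pair X X (f \<cdot> prod_pr1 Y X)
      (prod_pr2 Y X)"
  let ?YX = "pb_ob C (bang C Y) (bang C X)"
  have c [simp]: "c \<in> Arr C" "Dom C c = D" "Cod C c = ?YX" by (simp_all add: c_def D_def)
  have h [simp]: "h \<in> Arr C" "Dom C h = ?YX" "Cod C h = pb_ob C (bang C X) (bang C X)"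
    by (simp_all add: h_def)
  have hx: "h \<cdot> x = prod_pair X X (f \<cdot> (prod_pr1 Y X \<cdot> x))
      (prod_pr2 Y X \<cdot> x)" if "x \<in> Arr C" "Cod C x = ?YX" for x
    using that by (simp add: h_def)
  have stx: "st C (bang C X) P \<cdot> y = prod_pair X X (s \<cdot> y) (t \<cdot> y)"
    if "y \<in> Arr C" "Cod C y = path_ob C P" for y
    using that by (simp add: st_def s_def[symmetric] t_def[symmetric])
  have "is_pullback C h (st C (bang C X) P) c (pr2 C f s)"
  proof (rule is_pullbackI)
    show "h \<in> hom C ?YX (pb_ob C (bang C X) (bang C X))"
      "st C (bang C X) P \<in> hom C (path_ob C P) (pb_ob C (bang C X) (bang C X))"
      "c \<in> hom C D ?YX" "pr2 C f s \<in> paths D P"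
      by (simp_all add: hom_def D_def)
    show "h \<cdot> c = st C (bang C X) P \<cdot> pr2 C f s"
      by (simp add: hx stx) (simp add: c_def)
  next
    fix w x y
    assume x: "x \<in> hom C w ?YX" and y: "y \<in> paths w P"
      and e: "h \<cdot> x = st C (bang C X) P \<cdot> y"
    note [simp] = homD[OF x] homD[OF y]
    have e1: "f \<cdot> (prod_pr1 Y X \<cdot> x) = s \<cdot> y"
      using arg_cong[OF e, of "Comp C (prod_pr1 X X)"] by (simp add: hx stx)
    have e2: "prod_pr2 Y X \<cdot> x = t \<cdot> y"
      using arg_cong[OF e, of "Comp C (prod_pr2 X X)"] by (simp add: hx stx)
    have co: "cone f s (prod_pr1 Y X \<cdot> x) y" using e1 by (simp add: cone_def)
    have "c \<cdot> pair C f s (prod_pr1 Y X \<cdot> x) y = x"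
      using co by (simp add: c_def D_def e2[symmetric])
    then show "\<exists>m. m \<in> hom C w D \<and> c \<cdot> m = x \<and> pr2 C f s \<cdot> m = y"
      using co by (intro exI[of _ "pair C f s (prod_pr1 Y X \<cdot> x) y"])
        (simp add: hom_def D_def)
  next
    fix w m n
    assume m: "m \<in> hom C w D" and n: "n \<in> hom C w D" and e: "c \<cdot> m = c \<cdot> n"
      "pr2 C f s \<cdot> m = pr2 C f s \<cdot> n"
    note [simp] = homD[OF m] homD[OF n]
    have "pr1 C f s \<cdot> m = pr1 C f s \<cdot> n"
      using arg_cong[OF e(1), of "Comp C (prod_pr1 Y X)"]
      by (simp add: c_def D_def)
    then show "m = n" by (rule pb_ext[OF cs, rotated -2]) (use e(2) in \<open>auto simp: D_def\<close>)
  qed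
  then have "c \<in> Fib C" using pullback_fib[of "st C (bang C X) P"] by simp
  then have "prod_pr2 Y X \<cdot> c \<in> Fib C" by (rule fib_comp) auto
  then have d: "t \<cdot> pr2 C f s \<in> Fib C" by (simp add: c_def)
  have co: "cone f s (Id C Y) (prefl P \<cdot> f)" by (simp add: cone_def)
  have "pair C f s (Id C Y) (prefl P \<cdot> f) \<in> WE C"
    by (rule section_we[of "pr1 C f s"]) (use co pr_we(1)[OF cs] in auto)
  then show ?thesis
    using that[of "pair C f s (Id C Y) (prefl P \<cdot> f)" D "t \<cdot> pr2 C f s"] d co
    by (simp add: hom_def D_def)
qed

text \<open>Path objects of a fibration over any base come from factoring its fiberwise diagonal, so the fiberwise
  theory needs path objects of single objects only.\<close>

lemma fib_path_object_ex:
  assumes "p \<in> Fib C"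
  obtains P where "is_path_object C p P"
proof -
  have cs [simp]: "cospan p p" using assms by (simp add: cospan_def)
  have [simp]: "p \<in> Arr C" "Dom C p \<in> Ob C" using assms by (auto simp: dom_ob)
  have co [simp]: "cone p p (Id C (Dom C p)) (Id C (Dom C p))" by (simp add: cone_def)
  have "pair C p p (Id C (Dom C p)) (Id C (Dom C p)) \<in> hom C (Dom C p) (pb_ob C p p)"
    by (simp add: hom_def)
  from factorization[OF this] obtain w d D where wd: "w \<in> WE C" "w \<in> hom C (Dom C p) D"
    "d \<in> Fib C" "d \<in> hom C D (pb_ob C p p)"
    "d \<cdot> w = pair C p p (Id C (Dom C p)) (Id C (Dom C p))" by metis
  note [simp] = homD[OF wd(2)] homD[OF wd(4)]
  have "pair C p p (pr1 C p p \<cdot> d) (pr2 C p p \<cdot> d) = d" by simp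
  moreover have "p \<cdot> (pr1 C p p \<cdot> d) = p \<cdot> (pr2 C p p \<cdot> d)" using pb_ob_dom[OF cs, of d] by simp
  ultimately have "is_path_object C p \<lparr>prefl = w, psrc = pr1 C p p \<cdot> d, ptgt = pr2 C p p \<cdot> d\<rparr>"
    using wd assms unfolding is_path_object_def st_def path_ob_def
    by (simp add: hom_def)
  then show ?thesis by (rule that)
qed

lemma the_path: "p \<in> Fib C \<Longrightarrow> is_path_object C p (the_path C p)"
  unfolding the_path_def by (rule someI_ex) (meson fib_path_object_ex)

text \<open>Factoring the induced map from \<open>A\<close> to the pullback of \<open>p\<close> along \<open>b\<close> as a weak
  equivalence followed by a fibration produces an object \<open>D\<close> whose projection to \<open>B\<close> is an
  acyclic fibration; a section of it gives the lift. The upper triangle commutes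
  only up to homotopy, since \<open>\<sigma> w\<close> and \<open>i\<close> are two points of the same fibers of \<open>D\<close> that may differ.\<close>

lemma lift_through_acyclic:
  assumes w: "w \<in> WE C" "w \<in> hom C A B" and p: "p \<in> Fib C" "p \<in> hom C Y X"
    and a: "a \<in> hom C A Y" and b: "b \<in> hom C B X" and e: "p \<cdot> a = b \<cdot> w"
  obtains D d h i \<sigma> where "d \<in> Fib C" "d \<in> WE C" "d \<in> hom C D B" "h \<in> hom C D Y" "p \<cdot> h = b \<cdot> d"
    "i \<in> hom C A D" "d \<cdot> i = w" "h \<cdot> i = a" "\<sigma> \<in> hom C B D" "d \<cdot> \<sigma> = Id C B"
proof -
  note [simp] = homD[OF w(2)] homD[OF p(2)] homD[OF a] homD[OF b]
  have cs [simp]: "cospan b p" using p by (simp add: cospan_def)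
  have co [simp]: "cone b p w a" using e by (simp add: cone_def)
  have "pair C b p w a \<in> hom C A (pb_ob C b p)" by (simp add: hom_def)
  from factorization[OF this] obtain i d D where i: "i \<in> WE C" "i \<in> hom C A D"
    and d: "d \<in> Fib C" "d \<in> hom C D (pb_ob C b p)" and id: "d \<cdot> i = pair C b p w a" by metis
  note [simp] = homD[OF i(2)] homD[OF d(2)] id
  have d': "pr1 C b p \<cdot> d \<in> Fib C" by (rule fib_comp) (use d p in auto)
  have "(pr1 C b p \<cdot> d) \<cdot> i = w" by simp
  then have "pr1 C b p \<cdot> d \<in> WE C"
    using we_cancel_right[of "pr1 C b p \<cdot> d" i] i w by simp
  moreover from this d' obtain \<sigma> where "\<sigma> \<in> hom C B D" "(pr1 C b p \<cdot> d) \<cdot> \<sigma> = Id C B"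
    using acyclic_section[of "pr1 C b p \<cdot> d"] by auto
  moreover have "p \<cdot> (pr2 C b p \<cdot> d) = b \<cdot> (pr1 C b p \<cdot> d)"
    using pb_ob_dom[OF cs, of d] by simp
  ultimately show ?thesis
    using that[of "pr1 C b p \<cdot> d" D "pr2 C b p \<cdot> d" i \<sigma>] d' i(2) by (simp add: hom_def)
qed

lemma lift_lower:
  assumes w: "w \<in> WE C" "w \<in> hom C A B" and p: "p \<in> Fib C" "p \<in> hom C Y X"
    and a: "a \<in> hom C A Y" and b: "b \<in> hom C B X" and e: "p \<cdot> a = b \<cdot> w"
  obtains l where "l \<in> hom C B Y" "p \<cdot> l = b"
proof -
  obtain D d h i \<sigma> where h: "d \<in> hom C D B" "h \<in> hom C D Y" "p \<cdot> h = b \<cdot> d"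
    "\<sigma> \<in> hom C B D" "d \<cdot> \<sigma> = Id C B"
    using lift_through_acyclic[OF assms] by metis
  note [simp] = homD[OF h(1)] homD[OF h(2)] homD[OF h(4)] homD[OF p(2)] homD[OF b]
  have "p \<cdot> (h \<cdot> \<sigma>) = b" using comp_eq_ext2[OF h(3), of \<sigma>] h(5) by simp
  then show ?thesis using that[of "h \<cdot> \<sigma>"] by (simp add: hom_def)
qed

text \<open>Lifting against \<open>(s,t)\<close>: a homotopy that is given on \<open>A\<close> between restrictions of maps on \<open>B\<close> gives one on \<open>B\<close>
  between the maps themselves.\<close>

lemma lift_path:
  assumes P: "is_path_object C p P" and w: "w \<in> WE C" "w \<in> hom C A B"
    and f: "f \<in> hom C B (Dom C p)" and g: "g \<in> hom C B (Dom C p)" and fg: "p \<cdot> f = p \<cdot> g"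
    and H: "H \<in> paths A P" and e: "psrc P \<cdot> H = f \<cdot> w" "ptgt P \<cdot> H = g \<cdot> w"
  obtains L where "L \<in> paths B P" "psrc P \<cdot> L = f" "ptgt P \<cdot> L = g"
proof -
  note [simp] = path_simps[OF P] homD[OF w(2)] homD[OF f] homD[OF g] homD[OF H]
  have co [simp]: "cone p p f g" using fg by (simp add: cone_def)
  have 1: "st C p P \<cdot> H = pair C p p f g \<cdot> w"
    using e by (simp add: st_def)
  have 2: "st C p P \<in> hom C (path_ob C P) (pb_ob C p p)" "pair C p p f g \<in> hom C B (pb_ob C p p)"
    by (simp_all add: hom_def)
  obtain L where L: "L \<in> paths B P" "st C p P \<cdot> L = pair C p p f g"
    using lift_lower[OF w _ 2(1) H 2(2) 1] by auto
  note [simp] = homD[OF L(1)]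
  have "psrc P \<cdot> L = f" "ptgt P \<cdot> L = g"
    using arg_cong[OF L(2), of "Comp C (pr1 C p p)"] arg_cong[OF L(2), of "Comp C (pr2 C p p)"]
    by simp_all
  then show ?thesis using that L by blast
qed

section \<open>Fiberwise homotopy\<close>

lemma fib_homotopicI:
  assumes "is_path_object C p P" "H \<in> paths T P" "psrc P \<cdot> H = f" "ptgt P \<cdot> H = g"
  shows "fib_homotopic C p f g"
proof -
  note [simp] = path_simps[OF assms(1)] homD[OF assms(2)]
  have "f \<in> Arr C" "g \<in> Arr C" "Dom C f = T" "Dom C g = T" "Cod C f = Dom C p" "Cod C g = Dom C p"
    "p \<cdot> f = p \<cdot> g"
    using assms(3,4) by auto
  then show ?thesis using assms unfolding fib_homotopic_def by auto
qed

lemma fib_homotopicD: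
  assumes "fib_homotopic C p f g"
  shows "p \<in> Fib C" "f \<in> hom C (Dom C f) (Dom C p)" "g \<in> hom C (Dom C f) (Dom C p)"
    "p \<cdot> f = p \<cdot> g"
  using assms path_objectD(1) unfolding fib_homotopic_def hom_def by auto

text \<open>Homotopy is independent of the path object because any two are related by a map over the fibered
  square; this is what lets an existential definition be used with a prescribed path object.\<close>

lemma path_object_compare:
  assumes P: "is_path_object C p P" and Q: "is_path_object C p Q"
  obtains k where "k \<in> paths (path_ob C P) Q" "psrc Q \<cdot> k = psrc P" "ptgt Q \<cdot> k = ptgt P"
proof -
  note [simp] = path_simps[OF P] path_simps[OF Q]
  show ?thesis
    by (rule lift_path[OF Q, of "prefl P" "Dom C p" "path_ob C P" "psrc P" "ptgt P" "prefl Q"])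
      (use that in \<open>auto simp: hom_def\<close>)
qed

lemma fib_homotopicE:
  assumes "fib_homotopic C p f g" "is_path_object C p P"
  obtains H where "H \<in> paths (Dom C f) P" "psrc P \<cdot> H = f" "ptgt P \<cdot> H = g"
proof -
  obtain Q H where Q: "is_path_object C p Q" and
    H: "H \<in> paths (Dom C f) Q" "psrc Q \<cdot> H = f" "ptgt Q \<cdot> H = g"
    using assms(1) unfolding fib_homotopic_def by auto
  obtain k where k: "k \<in> paths (path_ob C Q) P" "psrc P \<cdot> k = psrc Q"
    "ptgt P \<cdot> k = ptgt Q"
    using path_object_compare[OF Q assms(2)] by auto
  note [simp] = path_simps[OF Q] path_simps[OF assms(2)] homD[OF k(1)] homD[OF H(1)]
  show ?thesis
    by (rule that[of "k \<cdot> H"])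
      (use comp_eq_ext[OF k(2), of H] comp_eq_ext[OF k(3), of H] H in \<open>auto simp: hom_def\<close>)
qed

lemma fib_homotopic_refl:
  assumes "p \<in> Fib C" "f \<in> hom C T (Dom C p)"
  shows "fib_homotopic C p f f"
proof -
  note P = the_path[OF assms(1)]
  note [simp] = path_simps[OF P] homD[OF assms(2)]
  show ?thesis
    by (rule fib_homotopicI[OF P, of "prefl (the_path C p) \<cdot> f" T]) (auto simp: hom_def)
qed

lemma fib_homotopic_sym:
  assumes "fib_homotopic C p f g"
  shows "fib_homotopic C p g f"
proof -
  note P = the_path[OF fib_homotopicD(1)[OF assms]]
  let ?P = "the_path C p"
  obtain H where H: "H \<in> paths (Dom C f) ?P" "psrc ?P \<cdot> H = f" "ptgt ?P \<cdot> H = g"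
    using fib_homotopicE[OF assms P] by auto
  note [simp] = path_simps[OF P] homD[OF H(1)]
  obtain k where k: "k \<in> paths (path_ob C ?P) ?P" "psrc ?P \<cdot> k = ptgt ?P"
    "ptgt ?P \<cdot> k = psrc ?P"
    by (rule lift_path[OF P, of "prefl ?P" "Dom C p" "path_ob C ?P" "ptgt ?P" "psrc ?P" "prefl ?P"])
      (auto simp: hom_def)
  note [simp] = homD[OF k(1)] k(2,3)
  show ?thesis
    by (rule fib_homotopicI[OF P, of "k \<cdot> H" "Dom C f"])
      (use comp_eq_ext[OF k(2), of H] comp_eq_ext[OF k(3), of H] H in \<open>auto simp: hom_def\<close>)
qed

lemma fib_homotopic_comp:
  assumes "fib_homotopic C p f g" "x \<in> hom C S (Dom C f)"
  shows "fib_homotopic C p (f \<cdot> x) (g \<cdot> x)"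
proof -
  note P = the_path[OF fib_homotopicD(1)[OF assms(1)]]
  let ?P = "the_path C p"
  obtain H where H: "H \<in> paths (Dom C f) ?P" "psrc ?P \<cdot> H = f" "ptgt ?P \<cdot> H = g"
    using fib_homotopicE[OF assms(1) P] by auto
  note [simp] = path_simps[OF P] homD[OF H(1)] homD[OF assms(2)]
  show ?thesis
    by (rule fib_homotopicI[OF P, of "H \<cdot> x" S])
      (use comp_eq_ext[OF H(2), of x] comp_eq_ext[OF H(3), of x] in \<open>auto simp: hom_def\<close>)
qed

text \<open>The condition on \<open>q h\<close> makes \<open>h\<close> send points joined by a path in a fiber of \<open>p\<close> into one fiber of
  \<open>q\<close>. Phrased through the path object, no map between the bases has to be exhibited.\<close>

lemma fib_homotopic_push:
  assumes H: "fib_homotopic C p f g" and P: "is_path_object C p P"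
    and q: "q \<in> Fib C" and h: "h \<in> hom C (Dom C p) (Dom C q)"
    and e: "q \<cdot> (h \<cdot> psrc P) = q \<cdot> (h \<cdot> ptgt P)"
  shows "fib_homotopic C q (h \<cdot> f) (h \<cdot> g)"
proof -
  note Q = the_path[OF q]
  let ?Q = "the_path C q"
  obtain H where H: "H \<in> paths (Dom C f) P" "psrc P \<cdot> H = f" "ptgt P \<cdot> H = g"
    using fib_homotopicE[OF assms(1) P] by auto
  note [simp] = path_simps[OF P] path_simps[OF Q] homD[OF H(1)] homD[OF h]
  obtain k where k: "k \<in> paths (path_ob C P) ?Q" "psrc ?Q \<cdot> k = h \<cdot> psrc P"
    "ptgt ?Q \<cdot> k = h \<cdot> ptgt P"
    by (rule lift_path[OF Q, of "prefl P" "Dom C p" "path_ob C P" "h \<cdot> psrc P" "h \<cdot> ptgt P"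
          "prefl ?Q \<cdot> h"])
      (use e in \<open>auto simp: hom_def\<close>)
  note [simp] = homD[OF k(1)] k(2,3)
  show ?thesis
    by (rule fib_homotopicI[OF Q, of "k \<cdot> H" "Dom C f"])
      (use comp_eq_ext2[OF k(2), of H] comp_eq_ext2[OF k(3), of H] H in \<open>auto simp: hom_def\<close>)
qed

text \<open>The fiberwise diagonal of an acyclic fibration is a section of an acyclic fibration, hence a weak
  equivalence. So \<open>(s,t)\<close> is acyclic, and a section of it supplies the homotopies.\<close>

lemma homotopic_of_acyclic:
  assumes d: "d \<in> Fib C" "d \<in> WE C" and x: "x \<in> hom C T (Dom C d)" and y: "y \<in> hom C T (Dom C d)"
    and e: "d \<cdot> x = d \<cdot> y"
  shows "fib_homotopic C d x y"
proof -
  note P = the_path[OF d(1)]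
  let ?P = "the_path C d"
  note [simp] = path_simps[OF P] homD[OF x] homD[OF y]
  have "st C d ?P \<in> WE C"
    by (rule we_cancel_left[of "pr1 C d d"])
      (use path_src_acyclic[OF P] pr_we(1)[of d d] d in auto)
  then obtain \<sigma> where \<sigma>: "\<sigma> \<in> paths (pb_ob C d d) ?P"
    "st C d ?P \<cdot> \<sigma> = Id C (pb_ob C d d)"
    using acyclic_section[of "st C d ?P"] by auto
  note [simp] = homD[OF \<sigma>(1)]
  have co [simp]: "cone d d x y" using e by (simp add: cone_def)
  have 1: "st C d ?P \<cdot> (\<sigma> \<cdot> pair C d d x y) = pair C d d x y"
    using comp_eq_ext[OF \<sigma>(2), of "pair C d d x y"] by simp
  show ?thesis
  proof (rule fib_homotopicI[OF P, of "\<sigma> \<cdot> pair C d d x y" T])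
    show "\<sigma> \<cdot> pair C d d x y \<in> paths T ?P" by (simp add: hom_def)
    show "psrc ?P \<cdot> (\<sigma> \<cdot> pair C d d x y) = x"
      using arg_cong[OF 1, of "Comp C (pr1 C d d)"] by simp
    show "ptgt ?P \<cdot> (\<sigma> \<cdot> pair C d d x y) = y"
      using arg_cong[OF 1, of "Comp C (pr2 C d d)"] by simp
  qed
qed

text \<open>The section \<open>\<sigma>\<close> used for the lift satisfies \<open>\<sigma> w \<simeq> i\<close> over \<open>B\<close>, both being maps into an acyclic
  fibration with the same image.\<close>

lemma lift:
  assumes w: "w \<in> WE C" "w \<in> hom C A B" and p: "p \<in> Fib C" "p \<in> hom C Y X"
    and a: "a \<in> hom C A Y" and b: "b \<in> hom C B X" and e: "p \<cdot> a = b \<cdot> w"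
  obtains l where "l \<in> hom C B Y" "p \<cdot> l = b" "fib_homotopic C p (l \<cdot> w) a"
proof -
  obtain D d h i \<sigma> where d: "d \<in> Fib C" "d \<in> WE C" "d \<in> hom C D B" and h: "h \<in> hom C D Y" "p \<cdot> h = b \<cdot> d"
    and i: "i \<in> hom C A D" "d \<cdot> i = w" "h \<cdot> i = a" and \<sigma>: "\<sigma> \<in> hom C B D" "d \<cdot> \<sigma> = Id C B"
    using lift_through_acyclic[OF assms] by metis
  note [simp] = homD[OF d(3)] homD[OF h(1)] homD[OF i(1)] homD[OF \<sigma>(1)] homD[OF p(2)] homD[OF b]
    homD[OF w(2)]
  have 1: "p \<cdot> (h \<cdot> \<sigma>) = b" using comp_eq_ext2[OF h(2), of \<sigma>] \<sigma>(2) by simp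
  have "fib_homotopic C d (\<sigma> \<cdot> w) i"
    by (rule homotopic_of_acyclic[of _ _ A])
      (use d i comp_eq_ext[OF \<sigma>(2), of w] in \<open>auto simp: hom_def\<close>)
  moreover note P = the_path[OF d(1)]
  note [simp] = path_simps[OF P]
  have "p \<cdot> (h \<cdot> psrc (the_path C d)) = p \<cdot> (h \<cdot> ptgt (the_path C d))"
    using comp_eq_ext2[OF h(2), of "psrc (the_path C d)"]
      comp_eq_ext2[OF h(2), of "ptgt (the_path C d)"] by simp
  ultimately have "fib_homotopic C p (h \<cdot> (\<sigma> \<cdot> w)) (h \<cdot> i)"
    using p h(1) by (intro fib_homotopic_push[OF _ P]) (auto simp: hom_def)
  then show ?thesis using that[of "h \<cdot> \<sigma>"] 1 i by (simp add: hom_def)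
qed

lemma lift_unique:
  assumes w: "w \<in> WE C" "w \<in> hom C A B" and l: "l \<in> hom C B (Dom C p)" "l' \<in> hom C B (Dom C p)"
    and e: "p \<cdot> l = p \<cdot> l'" and H: "fib_homotopic C p (l \<cdot> w) (l' \<cdot> w)"
  shows "fib_homotopic C p l l'"
proof -
  note P = the_path[OF fib_homotopicD(1)[OF H]]
  let ?P = "the_path C p"
  obtain H where H: "H \<in> paths A ?P" "psrc ?P \<cdot> H = l \<cdot> w" "ptgt ?P \<cdot> H = l' \<cdot> w"
    using fib_homotopicE[OF H P] homD[OF w(2)] homD[OF l(1)] by auto
  from lift_path[OF P w l e H] show ?thesis using fib_homotopicI[OF P] by metis
qed

section \<open>Path induction\<close>

lemma cospan_src [simp]: "is_path_object C z P \<Longrightarrow> f \<in> Arr C \<Longrightarrow> Cod C f = Dom C z \<Longrightarrow> cospan f (psrc P)"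
  using path_src_acyclic path_objectD unfolding cospan_def by metis

text \<open>Adjoining to \<open>T\<close> a free path that starts at \<open>f\<close> does not change the homotopy type: the projection back
  to \<open>T\<close> is a pullback of the acyclic fibration \<open>s\<close>, and the constant path is a section of it.\<close>

lemma extension_we:
  assumes P: "is_path_object C z P" and f: "f \<in> hom C T (Dom C z)"
  shows "cone f (psrc P) (Id C T) (prefl P \<cdot> f)" "pair C f (psrc P) (Id C T) (prefl P \<cdot> f) \<in> WE C"
proof -
  note [simp] = path_simps[OF P] homD[OF f]
  have [simp]: "cospan f (psrc P)" using P by simp
  show co: "cone f (psrc P) (Id C T) (prefl P \<cdot> f)" by (simp add: cone_def)
  show "pair C f (psrc P) (Id C T) (prefl P \<cdot> f) \<in> WE C"
    by (rule section_we[of "pr1 C f (psrc P)"])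
      (use pr_we(1)[of f "psrc P"] path_src_acyclic[OF P] co in auto)
qed

text \<open>The based J-rule for maps of generalised elements: two constructions that depend
  naturally on a path \<open>N\<close> starting at a given point are homotopic for every path as soon as they
  are homotopic for the constant one. Naturality turns them into maps out of the
  generic extension, where homotopies descend along the weak equivalence above.\<close>

lemma path_induction:
  assumes P: "is_path_object C z P" and f: "f \<in> hom C T (Dom C z)"
    and M: "M \<in> paths T P" "psrc P \<cdot> M = f"
    and \<Phi>: "\<And>E x N. \<lbrakk>x \<in> hom C E T; N \<in> paths E P; psrc P \<cdot> N = f \<cdot> x\<rbrakk>
           \<Longrightarrow> \<Phi> x N \<in> hom C E (Dom C b) \<and> \<Phi>' x N \<in> hom C E (Dom C b) \<and> b \<cdot> \<Phi> x N = b \<cdot> \<Phi>' x N"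
    and nat: "\<And>E E' x N y. \<lbrakk>x \<in> hom C E T; N \<in> paths E P; psrc P \<cdot> N = f \<cdot> x; y \<in> hom C E' E\<rbrakk>
           \<Longrightarrow> \<Phi> x N \<cdot> y = \<Phi> (x \<cdot> y) (N \<cdot> y) \<and> \<Phi>' x N \<cdot> y = \<Phi>' (x \<cdot> y) (N \<cdot> y)"
    and base: "fib_homotopic C b (\<Phi> (Id C T) (prefl P \<cdot> f)) (\<Phi>' (Id C T) (prefl P \<cdot> f))"
  shows "fib_homotopic C b (\<Phi> (Id C T) M) (\<Phi>' (Id C T) M)"
proof -
  let ?s = "psrc P" and ?E = "pb_ob C f (psrc P)"
  let ?x = "pr1 C f ?s" and ?N = "pr2 C f ?s" and ?i = "pair C f ?s (Id C T) (prefl P \<cdot> f)"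
  note [simp] = path_simps[OF P] homD[OF f] homD[OF M(1)]
  have cs [simp]: "cospan f ?s" using P by simp
  note i = extension_we[OF P f]
  have m: "cone f ?s (Id C T) M" using M by (simp add: cone_def)
  have gen: "?x \<in> hom C ?E T" "?N \<in> paths ?E P" "?s \<cdot> ?N = f \<cdot> ?x"
    using pr_eq[OF cs] by (simp_all add: hom_def)
  have ih: "?i \<in> hom C T ?E" and mh: "pair C f ?s (Id C T) M \<in> hom C T ?E"
    using i m by (simp_all add: hom_def)
  note g = \<Phi>[OF gen] and ni = nat[OF gen ih] and nm = nat[OF gen mh]
  have "fib_homotopic C b (\<Phi> ?x ?N \<cdot> ?i) (\<Phi>' ?x ?N \<cdot> ?i)"
    using ni i(1) base by simp
  then have "fib_homotopic C b (\<Phi> ?x ?N) (\<Phi>' ?x ?N)"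
    using lift_unique[OF i(2) ih] g by blast
  then have "fib_homotopic C b (\<Phi> ?x ?N \<cdot> pair C f ?s (Id C T) M) (\<Phi>' ?x ?N \<cdot> pair C f ?s (Id C T) M)"
    using g mh by (intro fib_homotopic_comp) (auto simp: hom_def)
  then show ?thesis using nm m by simp
qed

text \<open>Path induction on the homotopy itself. The condition on \<open>b\<close> makes the two ends of the resulting
  homotopy lie in the same fiber.\<close>

lemma homotopy_cong:
  assumes H: "fib_homotopic C p f f'" and T: "Dom C f = T" and b: "b \<in> Fib C"
    and \<Phi>: "\<And>E x A. \<lbrakk>x \<in> hom C E T; A \<in> hom C E (Dom C p); p \<cdot> A = p \<cdot> (f \<cdot> x)\<rbrakk>
           \<Longrightarrow> \<Phi> x A \<in> hom C E (Dom C b) \<and> b \<cdot> \<Phi> x A = b \<cdot> \<Phi> x (f \<cdot> x)"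
    and nat: "\<And>E E' x A y. \<lbrakk>x \<in> hom C E T; A \<in> hom C E (Dom C p); p \<cdot> A = p \<cdot> (f \<cdot> x); y \<in> hom C E' E\<rbrakk>
           \<Longrightarrow> \<Phi> x A \<cdot> y = \<Phi> (x \<cdot> y) (A \<cdot> y)"
  shows "fib_homotopic C b (\<Phi> (Id C T) f) (\<Phi> (Id C T) f')"
proof -
  note P = the_path[OF fib_homotopicD(1)[OF H]]
  let ?P = "the_path C p"
  have f: "f \<in> hom C T (Dom C p)" using fib_homotopicD(2)[OF H] T by simp
  obtain G where G: "G \<in> paths T ?P" "psrc ?P \<cdot> G = f" "ptgt ?P \<cdot> G = f'"
    using fib_homotopicE[OF H P] T by auto
  note [simp] = path_simps[OF P] homD[OF f] homD[OF G(1)]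
  have "fib_homotopic C b (\<Phi> (Id C T) (psrc ?P \<cdot> G)) (\<Phi> (Id C T) (ptgt ?P \<cdot> G))"
  proof (rule path_induction[OF P f G(1,2), where \<Phi> = "\<lambda>x N. \<Phi> x (psrc ?P \<cdot> N)"
        and \<Phi>' = "\<lambda>x N. \<Phi> x (ptgt ?P \<cdot> N)"])
    fix E x N
    assume x: "x \<in> hom C E T" and N: "N \<in> paths E ?P" and e: "psrc ?P \<cdot> N = f \<cdot> x"
    note [simp] = homD[OF x] homD[OF N]
    have h: "psrc ?P \<cdot> N \<in> hom C E (Dom C p)" "ptgt ?P \<cdot> N \<in> hom C E (Dom C p)"
      by (simp_all add: hom_def)
    have q: "p \<cdot> (psrc ?P \<cdot> N) = p \<cdot> (f \<cdot> x)" "p \<cdot> (ptgt ?P \<cdot> N) = p \<cdot> (f \<cdot> x)"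
      using e path_object_ext(3)[OF P, of N] by simp_all
    show "\<Phi> x (psrc ?P \<cdot> N) \<in> hom C E (Dom C b) \<and> \<Phi> x (ptgt ?P \<cdot> N) \<in> hom C E (Dom C b) \<and>
      b \<cdot> \<Phi> x (psrc ?P \<cdot> N) = b \<cdot> \<Phi> x (ptgt ?P \<cdot> N)"
      using \<Phi>[OF x h(1) q(1)] \<Phi>[OF x h(2) q(2)] by simp
    fix E' y
    assume y: "y \<in> hom C E' E"
    show "\<Phi> x (psrc ?P \<cdot> N) \<cdot> y = \<Phi> (x \<cdot> y) (psrc ?P \<cdot> (N \<cdot> y)) \<and>
      \<Phi> x (ptgt ?P \<cdot> N) \<cdot> y = \<Phi> (x \<cdot> y) (ptgt ?P \<cdot> (N \<cdot> y))"
      using nat[OF x h(1) q(1) y] nat[OF x h(2) q(2) y] homD[OF y] by simp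
  next
    have "T \<in> Ob C" by simp
    then have "\<Phi> (Id C T) f \<in> hom C T (Dom C b)"
      using \<Phi>[of "Id C T" T f] f by (simp add: hom_def)
    then show "fib_homotopic C b (\<Phi> (Id C T) (psrc ?P \<cdot> (prefl ?P \<cdot> f))) (\<Phi> (Id C T) (ptgt ?P \<cdot> (prefl ?P \<cdot> f)))"
      using fib_homotopic_refl[OF b] by simp
  qed
  then show ?thesis using G by simp
qed

section \<open>Concatenation and inversion of paths\<close>

text \<open>The relation that defines the arrows of the hom-groupoids: homotopy relative to end points.\<close>

abbreviation path_homotopic :: "'m \<Rightarrow> 'm path \<Rightarrow> 'm \<Rightarrow> 'm \<Rightarrow> bool" where
  "path_homotopic z P H K \<equiv> fib_homotopic C (st C z P) H K"

lemma path_homotopicD: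
  assumes "path_homotopic z P H K" "is_path_object C z P"
  shows "H \<in> paths (Dom C H) P" "K \<in> paths (Dom C H) P"
    "psrc P \<cdot> H = psrc P \<cdot> K" "ptgt P \<cdot> H = ptgt P \<cdot> K"
proof -
  note [simp] = path_simps[OF assms(2)]
  show h: "H \<in> paths (Dom C H) P" "K \<in> paths (Dom C H) P"
    using fib_homotopicD(2,3)[OF assms(1)] by simp_all
  show "psrc P \<cdot> H = psrc P \<cdot> K" "ptgt P \<cdot> H = ptgt P \<cdot> K"
    using st_eqD[OF assms(2) h fib_homotopicD(4)[OF assms(1)]] by auto
qed

lemma path_homotopic_refl:
  assumes "is_path_object C z P" "H \<in> paths T P"
  shows "path_homotopic z P H H"
  by (rule fib_homotopic_refl[of _ _ T]) (simp_all add: path_simps[OF assms(1)] assms)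

lemma path_homotopic_unique:
  assumes P: "is_path_object C z P" and w: "w \<in> WE C" "w \<in> hom C A B"
    and l: "l \<in> paths B P" "l' \<in> paths B P"
    and e: "psrc P \<cdot> l = psrc P \<cdot> l'" "ptgt P \<cdot> l = ptgt P \<cdot> l'"
    and H: "path_homotopic z P (l \<cdot> w) (l' \<cdot> w)"
  shows "path_homotopic z P l l'"
  by (rule lift_unique[OF w _ _ st_eqI[OF P l e] H]) (simp_all add: path_simps[OF P] l)

lemma lift_path_homotopic:
  assumes P: "is_path_object C p P" and w: "w \<in> WE C" "w \<in> hom C A B"
    and f: "f \<in> hom C B (Dom C p)" and g: "g \<in> hom C B (Dom C p)" and fg: "p \<cdot> f = p \<cdot> g"
    and H: "H \<in> paths A P" and e: "psrc P \<cdot> H = f \<cdot> w" "ptgt P \<cdot> H = g \<cdot> w"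
  obtains L where "L \<in> paths B P" "psrc P \<cdot> L = f" "ptgt P \<cdot> L = g"
    "path_homotopic p P (L \<cdot> w) H"
proof -
  note [simp] = path_simps[OF P] homD[OF w(2)] homD[OF f] homD[OF g] homD[OF H]
  have co [simp]: "cone p p f g" using fg by (simp add: cone_def)
  have 1: "st C p P \<cdot> H = pair C p p f g \<cdot> w"
    using e by (simp add: st_def)
  have 2: "st C p P \<in> hom C (path_ob C P) (pb_ob C p p)" "pair C p p f g \<in> hom C B (pb_ob C p p)"
    by (simp_all add: hom_def)
  obtain L where L: "L \<in> paths B P" "st C p P \<cdot> L = pair C p p f g"
    "path_homotopic p P (L \<cdot> w) H"
    using lift[OF w _ 2(1) H 2(2) 1] by auto
  note [simp] = homD[OF L(1)]
  have "psrc P \<cdot> L = f" "ptgt P \<cdot> L = g"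
    using arg_cong[OF L(2), of "Comp C (pr1 C p p)"] arg_cong[OF L(2), of "Comp C (pr2 C p p)"]
    by simp_all
  then show ?thesis using that L by blast
qed

abbreviation concat_path :: "'m path \<Rightarrow> 'm \<Rightarrow> 'm \<Rightarrow> 'm \<Rightarrow> 'm" where
  "concat_path P \<tau> H K \<equiv> \<tau> \<cdot> pair C (ptgt P) (psrc P) H K"

text \<open>Concatenation lifts \<open>r\<close> along \<open>(r,r)\<close>, which is a weak equivalence because it adjoins a path to \<open>r\<close>.\<close>

lemma concat_ex:
  assumes P: "is_path_object C z P"
  obtains \<tau> where "is_concat C z P \<tau>"
proof -
  let ?s = "psrc P" and ?t = "ptgt P" and ?r = "prefl P"
  note [simp] = path_simps[OF P]
  have cs [simp]: "cospan ?t ?s" using P by simp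
  have co [simp]: "cone ?t ?s ?r ?r" by (simp add: cone_def)
  have t: "?t \<in> hom C (path_ob C P) (Dom C z)" by (simp add: hom_def)
  note ext = extension_we[OF P t]
  have "pair C ?t ?s ?r ?r = pair C ?t ?s (Id C (path_ob C P)) (?r \<cdot> ?t) \<cdot> ?r"
    using ext by simp
  then have w: "pair C ?t ?s ?r ?r \<in> WE C"
    using we_comp[of ?r "pair C ?t ?s (Id C (path_ob C P)) (?r \<cdot> ?t)"] ext by simp
  have "z \<cdot> (?s \<cdot> pr1 C ?t ?s) = z \<cdot> (?t \<cdot> pr2 C ?t ?s)"
    using pr_eq[OF cs] path_object_ext(3)[OF P, of "pr1 C ?t ?s"]
      path_object_ext(3)[OF P, of "pr2 C ?t ?s"] by simp
  then obtain \<tau> where "\<tau> \<in> paths (pb_ob C ?t ?s) P"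
    "?s \<cdot> \<tau> = ?s \<cdot> pr1 C ?t ?s" "?t \<cdot> \<tau> = ?t \<cdot> pr2 C ?t ?s"
    "path_homotopic z P (concat_path P \<tau> ?r ?r) ?r"
    by (rule lift_path_homotopic[OF P w, of "Dom C z" "pb_ob C ?t ?s" "?s \<cdot> pr1 C ?t ?s"
          "?t \<cdot> pr2 C ?t ?s" ?r, rotated 3]) (auto simp: hom_def)
  then show ?thesis using that by (simp add: is_concat_def)
qed

lemma concat_arr:
  assumes "is_path_object C z P" "is_concat C z P \<tau>"
    "H \<in> paths T P" "K \<in> paths T P" "ptgt P \<cdot> H = psrc P \<cdot> K"
  shows "cone (ptgt P) (psrc P) H K" "concat_path P \<tau> H K \<in> paths T P"
    "psrc P \<cdot> (concat_path P \<tau> H K) = psrc P \<cdot> H"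
    "ptgt P \<cdot> (concat_path P \<tau> H K) = ptgt P \<cdot> K"
    "x \<in> hom C S T \<Longrightarrow> (concat_path P \<tau> H K) \<cdot> x =
       concat_path P \<tau> (H \<cdot> x) (K \<cdot> x)"
proof -
  let ?s = "psrc P" and ?t = "ptgt P"
  note [simp] = path_simps[OF assms(1)] homD[OF assms(3)] homD[OF assms(4)]
  have cs [simp]: "cospan ?t ?s" using assms(1) by simp
  show co: "cone ?t ?s H K" using assms(5) by (simp add: cone_def)
  note \<tau> = assms(2)[unfolded is_concat_def]
  have [simp]: "\<tau> \<in> Arr C" "Dom C \<tau> = pb_ob C ?t ?s" "Cod C \<tau> = path_ob C P"
    using \<tau> by (simp_all add: hom_def)
  have e: "?s \<cdot> \<tau> = ?s \<cdot> pr1 C ?t ?s" "?t \<cdot> \<tau> = ?t \<cdot> pr2 C ?t ?s" using \<tau> by simp_all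
  show "concat_path P \<tau> H K \<in> paths T P" using co by (simp add: hom_def)
  show "?s \<cdot> (concat_path P \<tau> H K) = ?s \<cdot> H"
    using comp_eq_ext2[OF e(1), of "pair C ?t ?s H K"] co by simp
  show "?t \<cdot> (concat_path P \<tau> H K) = ?t \<cdot> K"
    using comp_eq_ext2[OF e(2), of "pair C ?t ?s H K"] co by simp
  show "(concat_path P \<tau> H K) \<cdot> x = concat_path P \<tau> (H \<cdot> x) (K \<cdot> x)" if "x \<in> hom C S T"
    using co homD[OF that] by simp
qed

lemma fib_homotopic_trans [trans]:
  assumes "fib_homotopic C p f g" "fib_homotopic C p g h"
  shows "fib_homotopic C p f h"
proof -
  note P = the_path[OF fib_homotopicD(1)[OF assms(1)]]
  let ?P = "the_path C p"
  have dg: "Dom C g = Dom C f" using fib_homotopicD(3)[OF assms(1)] by (simp add: hom_def)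
  obtain H where H: "H \<in> paths (Dom C f) ?P" "psrc ?P \<cdot> H = f" "ptgt ?P \<cdot> H = g"
    using fib_homotopicE[OF assms(1) P] .
  obtain K where K: "K \<in> paths (Dom C g) ?P" "psrc ?P \<cdot> K = g" "ptgt ?P \<cdot> K = h"
    using fib_homotopicE[OF assms(2) P] .
  obtain \<tau> where \<tau>: "is_concat C p ?P \<tau>" using concat_ex[OF P] .
  note c = concat_arr[OF P \<tau> H(1) K(1)[unfolded dg]]
  show ?thesis by (rule fib_homotopicI[OF P c(2)]) (use c H K in auto)
qed

text \<open>One argument at a time, by path induction on the homotopy.\<close>

lemma concat_cong:
  assumes P: "is_path_object C z P" and \<tau>: "is_concat C z P \<tau>"
    and HH': "path_homotopic z P H H'" and KK': "path_homotopic z P K K'"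
    and T: "Dom C H = T" "Dom C K = T" and e: "ptgt P \<cdot> H = psrc P \<cdot> K"
  shows "path_homotopic z P (concat_path P \<tau> H K)
      (concat_path P \<tau> H' K')"
proof -
  let ?s = "psrc P" and ?t = "ptgt P"
  note h = path_homotopicD[OF HH' P, unfolded T] and k = path_homotopicD[OF KK' P, unfolded T]
  note [simp] = path_simps[OF P] homD[OF h(1)] homD[OF h(2)] homD[OF k(1)] homD[OF k(2)]
  have left: "path_homotopic z P (concat_path P \<tau> H (K \<cdot> Id C T)) (concat_path P \<tau> H' (K \<cdot> Id C T))"
  proof (rule homotopy_cong[OF HH' T(1), where \<Phi> = "\<lambda>x A. concat_path P \<tau> A (K \<cdot> x)"])
    show "st C z P \<in> Fib C" by simp
    fix E x A
    assume x: "x \<in> hom C E T" and A': "A \<in> hom C E (Dom C (st C z P))"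
      and A2: "st C z P \<cdot> A = st C z P \<cdot> (H \<cdot> x)"
    have A: "A \<in> paths E P" using A' by simp
    note [simp] = homD[OF x] homD[OF A]
    have Kx: "K \<cdot> x \<in> paths E P" and Hx: "H \<cdot> x \<in> paths E P"
      by (simp_all add: hom_def)
    note A3 = st_eqD[OF P A Hx A2]
    have tHx: "?t \<cdot> (H \<cdot> x) = ?s \<cdot> (K \<cdot> x)" using comp_eq_ext2[OF e, of x] by simp
    have tA: "?t \<cdot> A = ?s \<cdot> (K \<cdot> x)" using A3 tHx by simp
    note cA = concat_arr[OF P \<tau> A Kx tA] and cH = concat_arr[OF P \<tau> Hx Kx tHx]
    show "concat_path P \<tau> A (K \<cdot> x) \<in> hom C E (Dom C (st C z P)) \<and>
      st C z P \<cdot> (concat_path P \<tau> A (K \<cdot> x)) = st C z P \<cdot> (concat_path P \<tau> (H \<cdot> x) (K \<cdot> x))"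
      using st_eqI[OF P cA(2) cH(2)] cA(2-4) cH(3,4) A3 by simp
    fix E' y assume y: "y \<in> hom C E' E"
    show "(concat_path P \<tau> A (K \<cdot> x)) \<cdot> y = concat_path P \<tau> (A \<cdot> y) (K \<cdot> (x \<cdot> y))"
      using cA(5)[OF y] homD[OF y] by simp
  qed
  have right: "path_homotopic z P (concat_path P \<tau> (H' \<cdot> Id C T) K) (concat_path P \<tau> (H' \<cdot> Id C T) K')"
  proof (rule homotopy_cong[OF KK' T(2), where \<Phi> = "\<lambda>x A. concat_path P \<tau> (H' \<cdot> x) A"])
    show "st C z P \<in> Fib C" by simp
    fix E x A
    assume x: "x \<in> hom C E T" and A': "A \<in> hom C E (Dom C (st C z P))"
      and A2: "st C z P \<cdot> A = st C z P \<cdot> (K \<cdot> x)"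
    have A: "A \<in> paths E P" using A' by simp
    note [simp] = homD[OF x] homD[OF A]
    have Kx: "K \<cdot> x \<in> paths E P" and Hx: "H' \<cdot> x \<in> paths E P"
      by (simp_all add: hom_def)
    note A3 = st_eqD[OF P A Kx A2]
    have "?t \<cdot> H' = ?s \<cdot> K" using e h by simp
    then have tHx: "?t \<cdot> (H' \<cdot> x) = ?s \<cdot> (K \<cdot> x)" using comp_eq_ext2[of ?t H' ?s K x] by simp
    have tA: "?t \<cdot> (H' \<cdot> x) = ?s \<cdot> A" using A3 tHx by simp
    note cA = concat_arr[OF P \<tau> Hx A tA] and cH = concat_arr[OF P \<tau> Hx Kx tHx]
    show "concat_path P \<tau> (H' \<cdot> x) A \<in> hom C E (Dom C (st C z P)) \<and>
      st C z P \<cdot> (concat_path P \<tau> (H' \<cdot> x) A) = st C z P \<cdot> (concat_path P \<tau> (H' \<cdot> x) (K \<cdot> x))"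
      using st_eqI[OF P cA(2) cH(2)] cA(2-4) cH(3,4) A3 by simp
    fix E' y assume y: "y \<in> hom C E' E"
    show "(concat_path P \<tau> (H' \<cdot> x) A) \<cdot> y = concat_path P \<tau> (H' \<cdot> (x \<cdot> y)) (A \<cdot> y)"
      using cA(5)[OF y] homD[OF y] by simp
  qed
  show ?thesis by (rule fib_homotopic_trans) (use left right in simp_all)
qed

lemma concat_refl_right:
  assumes P: "is_path_object C z P" and \<tau>: "is_concat C z P \<tau>" and H: "H \<in> paths T P"
  shows "path_homotopic z P (concat_path P \<tau> H (prefl P \<cdot> (ptgt P \<cdot> H))) H"
proof -
  let ?s = "psrc P" and ?t = "ptgt P" and ?r = "prefl P" and ?I = "Id C (path_ob C P)"
  note [simp] = path_simps[OF P] homD[OF H]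
  have h: "?I \<in> paths (path_ob C P) P" "?r \<cdot> ?t \<in> paths (path_ob C P) P"
    "?t \<cdot> ?I = ?s \<cdot> (?r \<cdot> ?t)" "?r \<in> paths (Dom C z) P"
    by (simp_all add: hom_def)
  note c = concat_arr[OF P \<tau> h(1-3)]
  have "path_homotopic z P (concat_path P \<tau> ?I (?r \<cdot> ?t)) ?I"
  proof (rule path_homotopic_unique[OF P _ h(4) c(2) h(1)])
    show "path_homotopic z P ((concat_path P \<tau> ?I (?r \<cdot> ?t)) \<cdot> ?r) (?I \<cdot> ?r)"
      using c(5)[OF h(4)] \<tau> by (simp add: is_concat_def)
  qed (use c in simp_all)
  from fib_homotopic_comp[OF this, of H T] show ?thesis
    using c(2) H by (simp add: homD[OF c(2)] c(5)[OF H])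
qed

text \<open>Inversion is a lift of \<open>r\<close> against \<open>(t,s)\<close>. Both inverse laws hold on constant paths and
  hence, \<open>r\<close> being a weak equivalence, everywhere.\<close>

lemma inverse_path:
  assumes P: "is_path_object C z P" and H: "H \<in> paths T P"
  obtains K where "K \<in> paths T P" "psrc P \<cdot> K = ptgt P \<cdot> H" "ptgt P \<cdot> K = psrc P \<cdot> H"
    "\<And>\<tau>. is_concat C z P \<tau> \<Longrightarrow>
       path_homotopic z P (concat_path P \<tau> H K) (prefl P \<cdot> (psrc P \<cdot> H))"
    "\<And>\<tau>. is_concat C z P \<tau> \<Longrightarrow>
       path_homotopic z P (concat_path P \<tau> K H) (prefl P \<cdot> (ptgt P \<cdot> H))"
proof -
  let ?s = "psrc P" and ?t = "ptgt P" and ?r = "prefl P" and ?I = "Id C (path_ob C P)"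
  note [simp] = path_simps[OF P] homD[OF H]
  have r: "?r \<in> paths (Dom C z) P" by (simp add: hom_def)
  obtain \<sigma> where \<sigma>: "\<sigma> \<in> paths (path_ob C P) P" "?s \<cdot> \<sigma> = ?t" "?t \<cdot> \<sigma> = ?s"
    "path_homotopic z P (\<sigma> \<cdot> ?r) ?r"
    by (rule lift_path_homotopic[OF P, of ?r "Dom C z" "path_ob C P" ?t ?s ?r])
      (auto simp: hom_def)
  note [simp] = homD[OF \<sigma>(1)] \<sigma>(2,3)
  have \<sigma>x: "?s \<cdot> (\<sigma> \<cdot> x) = ?t \<cdot> x" "?t \<cdot> (\<sigma> \<cdot> x) = ?s \<cdot> x" if "x \<in> Arr C" "Cod C x = path_ob C P" for x
    using comp_eq_ext[OF \<sigma>(2), of x] comp_eq_ext[OF \<sigma>(3), of x] that by simp_all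
  have I: "?I \<in> paths (path_ob C P) P" by (simp add: hom_def)
  show ?thesis
  proof (rule that[of "\<sigma> \<cdot> H"])
    fix \<tau> assume \<tau>: "is_concat C z P \<tau>"
    have \<tau>r: "path_homotopic z P (concat_path P \<tau> ?r ?r) ?r" using \<tau> by (simp add: is_concat_def)
    have rr: "path_homotopic z P ?r ?r" by (rule path_homotopic_refl[OF P r])
    have 1: "?t \<cdot> ?I = ?s \<cdot> \<sigma>" and 2: "?t \<cdot> \<sigma> = ?s \<cdot> ?I" by simp_all
    note c1 = concat_arr[OF P \<tau> I \<sigma>(1) 1] and c2 = concat_arr[OF P \<tau> \<sigma>(1) I 2]
    have "path_homotopic z P (concat_path P \<tau> ?I \<sigma>) (?r \<cdot> ?s)"
    proof (rule path_homotopic_unique[OF P _ r c1(2)])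
      have "path_homotopic z P (concat_path P \<tau> ?r (\<sigma> \<cdot> ?r)) (concat_path P \<tau> ?r ?r)"
        by (rule concat_cong[OF P \<tau> rr \<sigma>(4), of "Dom C z"]) (simp_all add: \<sigma>x)
      also note \<tau>r
      finally show "path_homotopic z P ((concat_path P \<tau> ?I \<sigma>) \<cdot> ?r) ((?r \<cdot> ?s) \<cdot> ?r)"
        using c1(5)[OF r] by simp
    qed (use c1 in \<open>simp_all add: hom_def\<close>)
    from fib_homotopic_comp[OF this, of H T]
    show "path_homotopic z P (concat_path P \<tau> H (\<sigma> \<cdot> H)) (?r \<cdot> (?s \<cdot> H))"
      using H by (simp add: homD[OF c1(2)] c1(5)[OF H])
    have "path_homotopic z P (concat_path P \<tau> \<sigma> ?I) (?r \<cdot> ?t)"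
    proof (rule path_homotopic_unique[OF P _ r c2(2)])
      have "path_homotopic z P (concat_path P \<tau> (\<sigma> \<cdot> ?r) ?r) (concat_path P \<tau> ?r ?r)"
        by (rule concat_cong[OF P \<tau> \<sigma>(4) rr, of "Dom C z"]) (simp_all add: \<sigma>x)
      also note \<tau>r
      finally show "path_homotopic z P ((concat_path P \<tau> \<sigma> ?I) \<cdot> ?r) ((?r \<cdot> ?t) \<cdot> ?r)"
        using c2(5)[OF r] by simp
    qed (use c2 in \<open>simp_all add: hom_def\<close>)
    from fib_homotopic_comp[OF this, of H T]
    show "path_homotopic z P (concat_path P \<tau> (\<sigma> \<cdot> H) H) (?r \<cdot> (?t \<cdot> H))"
      using H by (simp add: homD[OF c2(2)] c2(5)[OF H])
  qed (simp_all add: \<sigma>x, simp add: hom_def)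
qed

lemma hclass_eq:
  assumes "path_homotopic z P H K"
  shows "hclass C z P H = hclass C z P K"
  using fib_homotopic_trans fib_homotopic_sym assms unfolding hclass_def by blast

lemma hclass_self:
  assumes "is_path_object C z P" "H \<in> paths T P"
  shows "H \<in> hclass C z P H"
  using path_homotopic_refl[OF assms] by (simp add: hclass_def)

text \<open>The composite is defined as a union over representatives and concatenation maps. All its members are equal,
  and it is not empty, so any representatives compute it.\<close>

lemma GComp_hclass:
  assumes P: "is_path_object C z P" and H: "H \<in> paths T P"
    and K: "K \<in> paths T P" and e: "ptgt P \<cdot> H = psrc P \<cdot> K"
    and L: "\<And>\<tau>. is_concat C z P \<tau> \<Longrightarrow> path_homotopic z P (concat_path P \<tau> H K) L"
  shows "GComp (hom_gpd C y z P) (hclass C z P K) (hclass C z P H) = hclass C z P L"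
proof -
  obtain \<tau>0 where \<tau>0: "is_concat C z P \<tau>0" using concat_ex[OF P] .
  have "hclass C z P (concat_path P \<tau> H' K') = hclass C z P L"
    if h: "H' \<in> hclass C z P H" "K' \<in> hclass C z P K" and \<tau>: "is_concat C z P \<tau>" for \<tau> H' K'
  proof -
    have "path_homotopic z P (concat_path P \<tau> H K)
       (concat_path P \<tau> H' K')"
      using h homD[OF H] homD[OF K] e by (intro concat_cong[OF P \<tau>, of _ _ _ _ T]) (auto simp: hclass_def)
    from hclass_eq[OF this] hclass_eq[OF L[OF \<tau>]] show ?thesis by simp
  qed
  then show ?thesis
    using hclass_self[OF P H] hclass_self[OF P K] \<tau>0 unfolding hom_gpd_def by auto
qed

text \<open>Every path has an inverse, so being isomorphic in the hom-groupoid means being joined by a path.\<close>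

lemma isomorphic_in_hom_gpd:
  assumes P: "is_path_object C z P"
    and u: "u \<in> GOb (hom_gpd C y z P)" and v: "v \<in> GOb (hom_gpd C y z P)"
  shows "isomorphic_in (hom_gpd C y z P) u v \<longleftrightarrow> fib_homotopic C z u v"
proof
  assume "isomorphic_in (hom_gpd C y z P) u v"
  then obtain H where "H \<in> paths (Dom C y) P" "psrc P \<cdot> H = u" "ptgt P \<cdot> H = v"
    unfolding isomorphic_in_def hom_gpd_def by auto
  then show "fib_homotopic C z u v" by (rule fib_homotopicI[OF P])
next
  assume "fib_homotopic C z u v"
  moreover have "Dom C u = Dom C y" using u by (simp add: hom_gpd_def hom_def)
  ultimately obtain H where H: "H \<in> paths (Dom C y) P" "psrc P \<cdot> H = u" "ptgt P \<cdot> H = v"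
    using fib_homotopicE[OF _ P, of u v] by metis
  obtain K where K: "K \<in> paths (Dom C y) P" "psrc P \<cdot> K = ptgt P \<cdot> H"
    "ptgt P \<cdot> K = psrc P \<cdot> H"
    "\<And>\<tau>. is_concat C z P \<tau> \<Longrightarrow>
       path_homotopic z P (concat_path P \<tau> H K) (prefl P \<cdot> (psrc P \<cdot> H))"
    "\<And>\<tau>. is_concat C z P \<tau> \<Longrightarrow>
       path_homotopic z P (concat_path P \<tau> K H) (prefl P \<cdot> (ptgt P \<cdot> H))"
    using inverse_path[OF P H(1)] by blast
  let ?G = "hom_gpd C y z P"
  have "hclass C z P H \<in> GHom ?G u v" "hclass C z P K \<in> GHom ?G v u"
    using H K(1-3) by (auto simp: hom_gpd_def)
  moreover have "GComp ?G (hclass C z P K) (hclass C z P H) = GId ?G u"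
    using GComp_hclass[OF P H(1) K(1) K(2)[symmetric] K(4)] H by (simp add: hom_gpd_def)
  moreover have "GComp ?G (hclass C z P H) (hclass C z P K) = GId ?G v"
    using GComp_hclass[OF P K(1) H(1) K(3) K(5)] H by (simp add: hom_gpd_def)
  ultimately show "isomorphic_in ?G u v" unfolding isomorphic_in_def by blast
qed

section \<open>The action of a map on paths\<close>

lemma path_map_ex:
  assumes P: "is_path_object C a P" and Q: "is_path_object C b Q"
    and e: "e \<in> hom C (Dom C a) (Dom C b)" "b \<cdot> (e \<cdot> psrc P) = b \<cdot> (e \<cdot> ptgt P)"
  obtains k where "is_path_map C b P Q e k"
proof -
  note [simp] = path_simps[OF P] path_simps[OF Q] homD[OF e(1)]
  obtain k where "k \<in> paths (path_ob C P) Q" "psrc Q \<cdot> k = e \<cdot> psrc P"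
    "ptgt Q \<cdot> k = e \<cdot> ptgt P" "path_homotopic b Q (k \<cdot> prefl P) (prefl Q \<cdot> e)"
    by (rule lift_path_homotopic[OF Q, of "prefl P" "Dom C a" "path_ob C P" "e \<cdot> psrc P" "e \<cdot> ptgt P"
          "prefl Q \<cdot> e"]) (use e in \<open>auto simp: hom_def\<close>)
  then show ?thesis using that by (simp add: is_path_map_def)
qed

lemma path_mapD:
  assumes "is_path_map C b P Q e k" "is_path_object C a P" "is_path_object C b Q"
    "e \<in> hom C (Dom C a) (Dom C b)"
  shows "k \<in> paths (path_ob C P) Q"
    "k \<in> Arr C" "Dom C k = path_ob C P" "Cod C k = path_ob C Q"
    "psrc Q \<cdot> k = e \<cdot> psrc P" "ptgt Q \<cdot> k = e \<cdot> ptgt P"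
    "path_homotopic b Q (k \<cdot> prefl P) (prefl Q \<cdot> e)"
    "x \<in> Arr C \<Longrightarrow> Cod C x = path_ob C P \<Longrightarrow> psrc Q \<cdot> (k \<cdot> x) = e \<cdot> (psrc P \<cdot> x)"
    "x \<in> Arr C \<Longrightarrow> Cod C x = path_ob C P \<Longrightarrow> ptgt Q \<cdot> (k \<cdot> x) = e \<cdot> (ptgt P \<cdot> x)"
proof -
  note [simp] = path_simps[OF assms(2)] path_simps[OF assms(3)] homD[OF assms(4)]
  note k = assms(1)[unfolded is_path_map_def]
  show kh: "k \<in> paths (path_ob C P) Q" "psrc Q \<cdot> k = e \<cdot> psrc P"
    "ptgt Q \<cdot> k = e \<cdot> ptgt P" "path_homotopic b Q (k \<cdot> prefl P) (prefl Q \<cdot> e)"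
    using k by simp_all
  show "k \<in> Arr C" "Dom C k = path_ob C P" "Cod C k = path_ob C Q" using homD[OF kh(1)] by simp_all
  show "psrc Q \<cdot> (k \<cdot> x) = e \<cdot> (psrc P \<cdot> x)" if "x \<in> Arr C" "Cod C x = path_ob C P"
    using comp_eq_ext2[OF kh(2), of x] homD[OF kh(1)] that by simp
  show "ptgt Q \<cdot> (k \<cdot> x) = e \<cdot> (ptgt P \<cdot> x)" if "x \<in> Arr C" "Cod C x = path_ob C P"
    using comp_eq_ext2[OF kh(3), of x] homD[OF kh(1)] that by simp
qed

text \<open>The end points of \<open>k H\<close> are determined by those of \<open>H\<close>, so a homotopy relative to end points
  remains one.\<close>

lemma path_map_cong:
  assumes P: "is_path_object C a P" and Q: "is_path_object C b Q"
    and e: "e \<in> hom C (Dom C a) (Dom C b)" and k: "is_path_map C b P Q e k"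
    and H: "path_homotopic a P H H'"
  shows "path_homotopic b Q (k \<cdot> H) (k \<cdot> H')"
proof -
  note [simp] = path_simps[OF P] path_simps[OF Q] homD[OF e] path_mapD[OF k P Q e]
  have s: "st C a P \<in> Fib C" by simp
  note R = the_path[OF s]
  let ?R = "the_path C (st C a P)"
  note [simp] = path_simps[OF R]
  have h: "psrc ?R \<in> paths (path_ob C ?R) P" "ptgt ?R \<in> paths (path_ob C ?R) P"
    "st C a P \<cdot> psrc ?R = st C a P \<cdot> ptgt ?R"
    by (simp_all add: hom_def)
  note eq = st_eqD[OF P h]
  show ?thesis
  proof (rule fib_homotopic_push[OF H R])
    show "st C b Q \<cdot> (k \<cdot> psrc ?R) = st C b Q \<cdot> (k \<cdot> ptgt ?R)"
      by (rule st_eqI[OF Q, of _ "path_ob C ?R"]) (auto simp: eq hom_def)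
  qed (simp_all add: hom_def)
qed

lemma path_map_unique:
  assumes P: "is_path_object C a P" and Q: "is_path_object C b Q"
    and e: "e \<in> hom C (Dom C a) (Dom C b)"
    and k: "is_path_map C b P Q e k" and k': "is_path_map C b P Q e k'"
  shows "path_homotopic b Q k k'"
proof -
  note kD = path_mapD[OF k P Q e] and kD' = path_mapD[OF k' P Q e]
  note [simp] = path_simps[OF P]
  show ?thesis
    by (rule path_homotopic_unique[OF Q, of "prefl P" "Dom C a" "path_ob C P"])
      (use kD(1,5,6) kD'(1,5,6) fib_homotopic_trans[OF kD(7) fib_homotopic_sym[OF kD'(7)]]
        in \<open>auto simp: hom_def\<close>)
qed

lemma path_map_comp:
  assumes P: "is_path_object C a P" and Q: "is_path_object C b Q" and R: "is_path_object C c R"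
    and e: "e \<in> hom C (Dom C a) (Dom C b)" and e': "e' \<in> hom C (Dom C b) (Dom C c)"
    and k: "is_path_map C b P Q e k" and k': "is_path_map C c Q R e' k'"
  shows "is_path_map C c P R (e' \<cdot> e) (k' \<cdot> k)"
proof -
  note [simp] = path_simps[OF P] path_simps[OF Q] path_simps[OF R] homD[OF e] homD[OF e']
  note kD = path_mapD[OF k P Q e] and kD' = path_mapD[OF k' Q R e']
  note [simp] = kD(2-6,8-) kD'(2-6,8-)
  have "path_homotopic c R (k' \<cdot> (k \<cdot> prefl P)) (k' \<cdot> (prefl Q \<cdot> e))"
    by (rule path_map_cong[OF Q R e' k' kD(7)])
  also have "path_homotopic c R ((k' \<cdot> prefl Q) \<cdot> e) ((prefl R \<cdot> e') \<cdot> e)"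
    by (rule fib_homotopic_comp[OF kD'(7), of _ "Dom C a"]) (simp add: hom_def)
  then have "path_homotopic c R (k' \<cdot> (prefl Q \<cdot> e)) (prefl R \<cdot> (e' \<cdot> e))" by simp
  finally show ?thesis unfolding is_path_map_def by (simp add: hom_def)
qed

section \<open>Transport along a fibration\<close>

text \<open>A path in the domain of \<open>p\<close> together with everything that transport along \<open>p\<close> fixes: its source and the
  image of its target.\<close>

definition corner :: "'m \<Rightarrow> 'm \<Rightarrow> 'm path \<Rightarrow> 'm" where
  "corner z p P = pair C (z \<cdot> p) z (psrc P) (p \<cdot> ptgt P)"

context
  fixes p z :: 'm and Y Z :: 'o and P Q :: "'m path"
  assumes p: "p \<in> Fib C" "p \<in> hom C Y Z" and z: "z \<in> Fib C" "Dom C z = Z"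
    and P: "is_path_object C (z \<cdot> p) P" and Q: "is_path_object C z Q"
begin

lemma transport_base:
  "p \<in> Fib C" "p \<in> Arr C" "Dom C p = Y" "Cod C p = Z" "z \<in> Fib C" "z \<in> Arr C" "Dom C z = Z"
  "Y \<in> Ob C" "Z \<in> Ob C" "z \<cdot> p \<in> Fib C" "cospan (z \<cdot> p) z" "cospan (z \<cdot> p) (z \<cdot> p)"
  using p z homD[OF p(2)] by (auto simp: cospan_def)

lemma transport_assoc:
  "x \<in> Arr C \<Longrightarrow> Cod C x = path_ob C P \<Longrightarrow> z \<cdot> (p \<cdot> (psrc P \<cdot> x)) = z \<cdot> (p \<cdot> (ptgt P \<cdot> x))"
  "z \<cdot> (p \<cdot> psrc P) = z \<cdot> (p \<cdot> ptgt P)"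
  using path_simps[OF P] transport_base by simp_all

lemma corner_arr:
  "cone (z \<cdot> p) z (psrc P) (p \<cdot> ptgt P)" "corner z p P \<in> Arr C" "Dom C (corner z p P) = path_ob C P"
  "Cod C (corner z p P) = pb_ob C (z \<cdot> p) z"
proof -
  note [simp] = transport_base transport_assoc path_simps[OF P]
  show "cone (z \<cdot> p) z (psrc P) (p \<cdot> ptgt P)" by (simp add: cone_def)
  then show "corner z p P \<in> Arr C" "Dom C (corner z p P) = path_ob C P"
    "Cod C (corner z p P) = pb_ob C (z \<cdot> p) z" by (simp_all add: corner_def)
qed

text \<open>The map is \<open>(s,t)\<close> followed by \<open>1 \<times> p\<close>, and the latter is a pullback of \<open>p\<close>.\<close>

lemma corner_fib: "corner z p P \<in> Fib C"
proof -
  note [simp] = transport_base transport_assoc corner_arr path_simps[OF P]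
  let ?y = "z \<cdot> p"
  let ?YY = "pb_ob C ?y ?y" and ?YZ = "pb_ob C ?y z"
  define m where "m = pair C ?y z (pr1 C ?y ?y) (p \<cdot> pr2 C ?y ?y)"
  have co [simp]: "cone ?y z (pr1 C ?y ?y) (p \<cdot> pr2 C ?y ?y)"
    using pr_eq[of ?y ?y] by (simp add: cone_def)
  have m [simp]: "m \<in> Arr C" "Dom C m = ?YY" "Cod C m = ?YZ" by (simp_all add: m_def)
  have "is_pullback C (pr2 C ?y z) p m (pr2 C ?y ?y)"
  proof (rule is_pullbackI)
    show "pr2 C ?y z \<in> hom C ?YZ Z" "p \<in> hom C Y Z" "m \<in> hom C ?YY ?YZ"
      "pr2 C ?y ?y \<in> hom C ?YY Y"
      by (simp_all add: hom_def)
    show "pr2 C ?y z \<cdot> m = p \<cdot> pr2 C ?y ?y" by (simp add: m_def)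
  next
    fix w x y assume x: "x \<in> hom C w ?YZ" and y: "y \<in> hom C w Y" and e: "pr2 C ?y z \<cdot> x = p \<cdot> y"
    note [simp] = homD[OF x] homD[OF y]
    have co': "cone ?y ?y (pr1 C ?y z \<cdot> x) y"
      using pb_ob_dom[of ?y z x] e by (simp add: cone_def)
    have "m \<cdot> pair C ?y ?y (pr1 C ?y z \<cdot> x) y = x"
      using co' by (simp add: m_def e[symmetric])
    then show "\<exists>n. n \<in> hom C w ?YY \<and> m \<cdot> n = x \<and> pr2 C ?y ?y \<cdot> n = y"
      using co' by (intro exI[of _ "pair C ?y ?y (pr1 C ?y z \<cdot> x) y"]) (simp add: hom_def)
  next
    fix w n n' assume n: "n \<in> hom C w ?YY" and n': "n' \<in> hom C w ?YY" and e: "m \<cdot> n = m \<cdot> n'"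
      "pr2 C ?y ?y \<cdot> n = pr2 C ?y ?y \<cdot> n'"
    note [simp] = homD[OF n] homD[OF n']
    have "pr1 C ?y ?y \<cdot> n = pr1 C ?y ?y \<cdot> n'"
      using arg_cong[OF e(1), of "Comp C (pr1 C ?y z)"] by (simp add: m_def del: pair_comp)
    then show "n = n'" by (rule pb_ext[rotated -2]) (use e(2) in auto)
  qed
  then have "m \<in> Fib C" using pullback_fib[OF p(1)] by simp
  then have "m \<cdot> st C ?y P \<in> Fib C" by (rule fib_comp[rotated]) simp_all
  moreover have "m \<cdot> st C ?y P = corner z p P" by (simp add: m_def corner_def)
  ultimately show ?thesis by simp
qed

lemma cospan_transport: "cospan p (psrc Q)"
  using Q transport_base by simp

lemmas transport_simps = transport_base transport_assoc corner_arr corner_fib cospan_transport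
  path_simps[OF P] path_simps[OF Q]

lemma corner_eqI:
  assumes "H \<in> paths T P" "K \<in> paths T P"
    "psrc P \<cdot> H = psrc P \<cdot> K" "p \<cdot> (ptgt P \<cdot> H) = p \<cdot> (ptgt P \<cdot> K)"
  shows "corner z p P \<cdot> H = corner z p P \<cdot> K"
  by (simp add: transport_simps homD[OF assms(1)] homD[OF assms(2)] assms(3,4) corner_def)

lemma corner_eqD:
  assumes "H \<in> paths T P" "K \<in> paths T P"
    "corner z p P \<cdot> H = corner z p P \<cdot> K"
  shows "psrc P \<cdot> H = psrc P \<cdot> K" "p \<cdot> (ptgt P \<cdot> H) = p \<cdot> (ptgt P \<cdot> K)"
proof -
  note [simp] = transport_simps homD[OF assms(1)] homD[OF assms(2)]
  show "psrc P \<cdot> H = psrc P \<cdot> K"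
    using arg_cong[OF assms(3), of "Comp C (pr1 C (z \<cdot> p) z)"] by (simp add: corner_def del: pair_comp)
  show "p \<cdot> (ptgt P \<cdot> H) = p \<cdot> (ptgt P \<cdot> K)"
    using arg_cong[OF assms(3), of "Comp C (pr2 C (z \<cdot> p) z)"] by (simp add: corner_def del: pair_comp)
qed

text \<open>Sends a point of \<open>Y\<close> and a path of \<open>Z\<close> that starts below it to a path of \<open>Y\<close> that starts at the
  point; over constant paths it is constant up to homotopy. Lifting against the
  fibration above makes the target lie strictly over the end of the given path.\<close>

definition is_transport :: "'m \<Rightarrow> bool" where
  "is_transport \<Gamma> \<longleftrightarrow> \<Gamma> \<in> paths (pb_ob C p (psrc Q)) P \<and>
     psrc P \<cdot> \<Gamma> = pr1 C p (psrc Q) \<and>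
     p \<cdot> (ptgt P \<cdot> \<Gamma>) = ptgt Q \<cdot> pr2 C p (psrc Q) \<and>
     fib_homotopic C (corner z p P) (\<Gamma> \<cdot> pair C p (psrc Q) (Id C Y) (prefl Q \<cdot> p)) (prefl P)"

lemma transport_ex: obtains \<Gamma> where "is_transport \<Gamma>"
proof -
  note [simp] = transport_simps
  let ?i = "pair C p (psrc Q) (Id C Y) (prefl Q \<cdot> p)"
  let ?b = "pair C (z \<cdot> p) z (pr1 C p (psrc Q)) (ptgt Q \<cdot> pr2 C p (psrc Q))"
  have ph: "p \<in> hom C Y (Dom C z)" using p by simp
  note ext = extension_we[OF Q ph]
  have co: "cone (z \<cdot> p) z (pr1 C p (psrc Q)) (ptgt Q \<cdot> pr2 C p (psrc Q))"
    using pr_eq[OF cospan_transport] path_object_ext(3)[OF Q, of "pr2 C p (psrc Q)"]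
    by (simp add: cone_def)
  have "?i \<in> hom C Y (pb_ob C p (psrc Q))" using ext by (simp add: hom_def)
  moreover have "corner z p P \<in> hom C (path_ob C P) (pb_ob C (z \<cdot> p) z)" by (simp add: hom_def)
  moreover have "prefl P \<in> paths Y P" by (simp add: hom_def)
  moreover have "?b \<in> hom C (pb_ob C p (psrc Q)) (pb_ob C (z \<cdot> p) z)" using co by (simp add: hom_def)
  moreover have "corner z p P \<cdot> prefl P = ?b \<cdot> ?i" using ext co by (simp add: corner_def)
  ultimately obtain \<Gamma> where \<Gamma>: "\<Gamma> \<in> paths (pb_ob C p (psrc Q)) P"
    "corner z p P \<cdot> \<Gamma> = ?b" "fib_homotopic C (corner z p P) (\<Gamma> \<cdot> ?i) (prefl P)"
    using lift[OF ext(2) _ corner_fib] by metis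
  note [simp] = homD[OF \<Gamma>(1)]
  have "psrc P \<cdot> \<Gamma> = pr1 C p (psrc Q)" "p \<cdot> (ptgt P \<cdot> \<Gamma>) = ptgt Q \<cdot> pr2 C p (psrc Q)"
    using arg_cong[OF \<Gamma>(2), of "Comp C (pr1 C (z \<cdot> p) z)"]
      arg_cong[OF \<Gamma>(2), of "Comp C (pr2 C (z \<cdot> p) z)"] co by (simp_all add: corner_def del: pair_comp)
  then show ?thesis using that \<Gamma> by (simp add: is_transport_def)
qed

abbreviation transport :: "'m \<Rightarrow> 'm \<Rightarrow> 'm \<Rightarrow> 'm" where
  "transport \<Gamma> u \<alpha> \<equiv> \<Gamma> \<cdot> pair C p (psrc Q) u \<alpha>"

lemma transport_arr:
  assumes "is_transport \<Gamma>" "u \<in> hom C T Y" "\<alpha> \<in> paths T Q" "psrc Q \<cdot> \<alpha> = p \<cdot> u"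
  shows "transport \<Gamma> u \<alpha> \<in> paths T P"
    "psrc P \<cdot> (transport \<Gamma> u \<alpha>) = u"
    "p \<cdot> (ptgt P \<cdot> (transport \<Gamma> u \<alpha>)) = ptgt Q \<cdot> \<alpha>"
    "x \<in> hom C S T \<Longrightarrow>
      (transport \<Gamma> u \<alpha>) \<cdot> x = transport \<Gamma> (u \<cdot> x) (\<alpha> \<cdot> x)"
    "cone p (psrc Q) u \<alpha>"
proof -
  note [simp] = transport_simps homD[OF assms(2)] homD[OF assms(3)]
  have \<Gamma>: "\<Gamma> \<in> paths (pb_ob C p (psrc Q)) P" "psrc P \<cdot> \<Gamma> = pr1 C p (psrc Q)"
    "p \<cdot> (ptgt P \<cdot> \<Gamma>) = ptgt Q \<cdot> pr2 C p (psrc Q)"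
    using assms(1) by (simp_all add: is_transport_def)
  note [simp] = homD[OF \<Gamma>(1)]
  show co: "cone p (psrc Q) u \<alpha>" using assms(4) by (simp add: cone_def)
  show "transport \<Gamma> u \<alpha> \<in> paths T P" using co by (simp add: hom_def)
  show "psrc P \<cdot> (transport \<Gamma> u \<alpha>) = u"
    using comp_eq_ext[OF \<Gamma>(2), of "pair C p (psrc Q) u \<alpha>"] co by simp
  show "p \<cdot> (ptgt P \<cdot> (transport \<Gamma> u \<alpha>)) = ptgt Q \<cdot> \<alpha>"
    using arg_cong[OF \<Gamma>(3), of "\<lambda>m. m \<cdot> pair C p (psrc Q) u \<alpha>"] co by simp
  show "(transport \<Gamma> u \<alpha>) \<cdot> x = transport \<Gamma> (u \<cdot> x) (\<alpha> \<cdot> x)"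
    if "x \<in> hom C S T"
    using co homD[OF that] by simp
qed

context
  fixes k assumes k: "is_path_map C z P Q p k"
begin

lemma path_map_typed:
  "k \<in> paths (path_ob C P) Q"
  "k \<in> Arr C" "Dom C k = path_ob C P" "Cod C k = path_ob C Q"
  "psrc Q \<cdot> k = p \<cdot> psrc P" "ptgt Q \<cdot> k = p \<cdot> ptgt P"
  "path_homotopic z Q (k \<cdot> prefl P) (prefl Q \<cdot> p)"
  "x \<in> Arr C \<Longrightarrow> Cod C x = path_ob C P \<Longrightarrow> psrc Q \<cdot> (k \<cdot> x) = p \<cdot> (psrc P \<cdot> x)"
  "x \<in> Arr C \<Longrightarrow> Cod C x = path_ob C P \<Longrightarrow> ptgt Q \<cdot> (k \<cdot> x) = p \<cdot> (ptgt P \<cdot> x)"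
proof -
  have "p \<in> hom C (Dom C (z \<cdot> p)) (Dom C z)" by (simp add: transport_simps hom_def)
  from path_mapD[OF k P Q this]
  show "k \<in> paths (path_ob C P) Q"
    "k \<in> Arr C" "Dom C k = path_ob C P" "Cod C k = path_ob C Q"
    "psrc Q \<cdot> k = p \<cdot> psrc P" "ptgt Q \<cdot> k = p \<cdot> ptgt P"
    "path_homotopic z Q (k \<cdot> prefl P) (prefl Q \<cdot> p)"
    "x \<in> Arr C \<Longrightarrow> Cod C x = path_ob C P \<Longrightarrow> psrc Q \<cdot> (k \<cdot> x) = p \<cdot> (psrc P \<cdot> x)"
    "x \<in> Arr C \<Longrightarrow> Cod C x = path_ob C P \<Longrightarrow> ptgt Q \<cdot> (k \<cdot> x) = p \<cdot> (ptgt P \<cdot> x)"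
    by auto
qed

text \<open>A homotopy that moves the target of a path only inside the fibers of \<open>p\<close> fixes both end points of
  the image path.\<close>

lemma corner_push:
  assumes "fib_homotopic C (corner z p P) H H'"
  shows "path_homotopic z Q (k \<cdot> H) (k \<cdot> H')"
proof -
  note [simp] = transport_simps path_map_typed
  note R = the_path[OF corner_fib]
  let ?R = "the_path C (corner z p P)"
  note [simp] = path_simps[OF R]
  have h: "psrc ?R \<in> paths (path_ob C ?R) P" "ptgt ?R \<in> paths (path_ob C ?R) P"
    "corner z p P \<cdot> psrc ?R = corner z p P \<cdot> ptgt ?R"
    by (simp_all add: hom_def)
  note eq = corner_eqD[OF h]
  show ?thesis
  proof (rule fib_homotopic_push[OF assms R])
    show "st C z Q \<cdot> (k \<cdot> psrc ?R) = st C z Q \<cdot> (k \<cdot> ptgt ?R)"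
      by (rule st_eqI[OF Q, of _ "path_ob C ?R"]) (auto simp: eq hom_def)
  qed (simp_all add: hom_def)
qed

lemma transport_image:
  assumes \<Gamma>: "is_transport \<Gamma>" and "u \<in> hom C T Y" "\<alpha> \<in> paths T Q" "psrc Q \<cdot> \<alpha> = p \<cdot> u"
  shows "path_homotopic z Q (k \<cdot> (transport \<Gamma> u \<alpha>)) \<alpha>"
proof -
  note [simp] = transport_simps path_map_typed homD[OF assms(2)] homD[OF assms(3)]
  note tr = transport_arr[OF assms]
  have \<Gamma>h: "\<Gamma> \<in> paths (pb_ob C p (psrc Q)) P" "psrc P \<cdot> \<Gamma> = pr1 C p (psrc Q)"
    "p \<cdot> (ptgt P \<cdot> \<Gamma>) = ptgt Q \<cdot> pr2 C p (psrc Q)"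
    and \<Gamma>r: "fib_homotopic C (corner z p P) (transport \<Gamma> (Id C Y) (prefl Q \<cdot> p)) (prefl P)"
    using \<Gamma> by (simp_all add: is_transport_def)
  note [simp] = homD[OF \<Gamma>h(1)]
  have ph: "p \<in> hom C Y (Dom C z)" using p by simp
  note ext = extension_we[OF Q ph]
  have "path_homotopic z Q (k \<cdot> \<Gamma>) (pr2 C p (psrc Q))"
  proof (rule path_homotopic_unique[OF Q ext(2)])
    show "pair C p (psrc Q) (Id C Y) (prefl Q \<cdot> p) \<in> hom C Y (pb_ob C p (psrc Q))"
      using ext by (simp add: hom_def)
    show "k \<cdot> \<Gamma> \<in> paths (pb_ob C p (psrc Q)) Q"
      "pr2 C p (psrc Q) \<in> paths (pb_ob C p (psrc Q)) Q" by (simp_all add: hom_def)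
    show "psrc Q \<cdot> (k \<cdot> \<Gamma>) = psrc Q \<cdot> pr2 C p (psrc Q)" "ptgt Q \<cdot> (k \<cdot> \<Gamma>) = ptgt Q \<cdot> pr2 C p (psrc Q)"
      using \<Gamma>h pr_eq[OF cospan_transport] by simp_all
    show "path_homotopic z Q ((k \<cdot> \<Gamma>) \<cdot> pair C p (psrc Q) (Id C Y) (prefl Q \<cdot> p))
     (pr2 C p (psrc Q) \<cdot> pair C p (psrc Q) (Id C Y) (prefl Q \<cdot> p))"
      using fib_homotopic_trans[OF corner_push[OF \<Gamma>r] path_map_typed(7)] ext by simp
  qed
  from fib_homotopic_comp[OF this, of "pair C p (psrc Q) u \<alpha>" T] show ?thesis
    using tr(5) by (simp add: hom_def)
qed

text \<open>Homotopy lifting keeps only the end of the lifted path. Fullness also needs that the lift has the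
  given image up to homotopy.\<close>

lemma path_lift:
  assumes "u \<in> hom C T Y" "\<alpha> \<in> paths T Q" "psrc Q \<cdot> \<alpha> = p \<cdot> u"
  obtains K where "K \<in> paths T P" "psrc P \<cdot> K = u" "p \<cdot> (ptgt P \<cdot> K) = ptgt Q \<cdot> \<alpha>"
    "path_homotopic z Q (k \<cdot> K) \<alpha>"
proof -
  obtain \<Gamma> where \<Gamma>: "is_transport \<Gamma>" using transport_ex .
  show ?thesis
    using that transport_arr(1-3)[OF \<Gamma> assms] transport_image[OF \<Gamma> assms] by blast
qed

lemma transport_cong:
  assumes \<Gamma>: "is_transport \<Gamma>" and u: "u \<in> hom C T Y" and e: "psrc Q \<cdot> \<alpha> = p \<cdot> u" "Dom C \<alpha> = T"
    and a: "path_homotopic z Q \<alpha> \<alpha>'"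
  shows "fib_homotopic C (corner z p P) (transport \<Gamma> u \<alpha>) (transport \<Gamma> u \<alpha>')"
proof -
  note ah = path_homotopicD[OF a Q, unfolded e(2)]
  note [simp] = transport_simps homD[OF u] homD[OF ah(1)] homD[OF ah(2)]
  have "fib_homotopic C (corner z p P) (transport \<Gamma> (u \<cdot> Id C T) \<alpha>)
     (transport \<Gamma> (u \<cdot> Id C T) \<alpha>')"
  proof (rule homotopy_cong[OF a e(2), where \<Phi> = "\<lambda>x A. transport \<Gamma> (u \<cdot> x) A"])
    show "corner z p P \<in> Fib C" by simp
    fix E x A
    assume x: "x \<in> hom C E T" and A': "A \<in> hom C E (Dom C (st C z Q))"
      and A2: "st C z Q \<cdot> A = st C z Q \<cdot> (\<alpha> \<cdot> x)"
    have A: "A \<in> paths E Q" using A' by simp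
    note [simp] = homD[OF x] homD[OF A]
    have ux: "u \<cdot> x \<in> hom C E Y" and ax: "\<alpha> \<cdot> x \<in> paths E Q" by (simp_all add: hom_def)
    note A3 = st_eqD[OF Q A ax A2]
    have sax: "psrc Q \<cdot> (\<alpha> \<cdot> x) = p \<cdot> (u \<cdot> x)" using comp_eq_ext2[OF e(1), of x] by simp
    have sA: "psrc Q \<cdot> A = p \<cdot> (u \<cdot> x)" using A3 sax by simp
    note c1 = transport_arr[OF \<Gamma> ux A sA] and c2 = transport_arr[OF \<Gamma> ux ax sax]
    show "transport \<Gamma> (u \<cdot> x) A \<in> hom C E (Dom C (corner z p P)) \<and>
      corner z p P \<cdot> (transport \<Gamma> (u \<cdot> x) A) =
      corner z p P \<cdot> (transport \<Gamma> (u \<cdot> x) (\<alpha> \<cdot> x))"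
      using corner_eqI[OF c1(1) c2(1)] c1(1-3) c2(2,3) A3 by simp
    fix E' y assume y: "y \<in> hom C E' E"
    show "(transport \<Gamma> (u \<cdot> x) A) \<cdot> y = transport \<Gamma> (u \<cdot> (x \<cdot> y)) (A \<cdot> y)"
      using c1(4)[OF y] homD[OF y] by simp
  qed
  then show ?thesis by simp
qed

text \<open>Transporting the source of a path along its own image recovers the path: true for
  constant paths, hence for all.\<close>

lemma transport_own_image:
  assumes \<Gamma>: "is_transport \<Gamma>" and N: "N \<in> paths T P"
  shows "fib_homotopic C (corner z p P) (transport \<Gamma> (psrc P \<cdot> N) (k \<cdot> N)) N"
proof -
  note [simp] = transport_simps path_map_typed homD[OF N]
  let ?I = "Id C (path_ob C P)"
  have h: "psrc P \<in> hom C (path_ob C P) Y" "k \<in> paths (path_ob C P) Q"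
    "psrc Q \<cdot> k = p \<cdot> psrc P" by (simp_all add: hom_def)
  have r: "prefl P \<in> paths Y P" by (simp add: hom_def)
  note tr = transport_arr[OF \<Gamma> h]
  have I: "Id C Y \<in> hom C Y Y" by (simp add: hom_def)
  have "fib_homotopic C (corner z p P) (transport \<Gamma> (psrc P) k) ?I"
  proof (rule lift_unique[of "prefl P" Y "path_ob C P"])
    have "fib_homotopic C (corner z p P) (transport \<Gamma> (Id C Y) (k \<cdot> prefl P))
       (transport \<Gamma> (Id C Y) (prefl Q \<cdot> p))"
      by (rule transport_cong[OF \<Gamma> I _ _ path_map_typed(7)]) simp_all
    also have "fib_homotopic C (corner z p P) \<dots> (prefl P)"
      using \<Gamma> by (simp add: is_transport_def)
    finally show "fib_homotopic C (corner z p P) ((transport \<Gamma> (psrc P) k) \<cdot> prefl P) (?I \<cdot> prefl P)"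
      using tr(4)[OF r] by simp
    show "corner z p P \<cdot> (transport \<Gamma> (psrc P) k) = corner z p P \<cdot> ?I"
      by (rule corner_eqI) (use tr(1-3) in \<open>auto simp: hom_def\<close>)
  qed (use tr(1) in \<open>auto simp: hom_def\<close>)
  from fib_homotopic_comp[OF this, of N T] show ?thesis
    using tr(4)[OF N] N by (simp add: homD[OF tr(1)])
qed

text \<open>Up to homotopy over its corner a path is the transport of its source along its image. Two paths with the same
  source and homotopic images are therefore homotopic over their corners, but in general
  not relative to their targets, which may differ inside a fiber of \<open>p\<close>.\<close>

lemma corner_homotopicI:
  assumes N: "N \<in> paths T P" and N': "N' \<in> paths T P"
    and e: "psrc P \<cdot> N = psrc P \<cdot> N'" and H: "path_homotopic z Q (k \<cdot> N) (k \<cdot> N')"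
  shows "fib_homotopic C (corner z p P) N N'"
proof -
  note [simp] = transport_simps path_map_typed homD[OF N] homD[OF N']
  obtain \<Gamma> where \<Gamma>: "is_transport \<Gamma>" using transport_ex .
  have sN: "psrc P \<cdot> N \<in> hom C T Y" by (simp add: hom_def)
  have "fib_homotopic C (corner z p P) N (transport \<Gamma> (psrc P \<cdot> N) (k \<cdot> N))"
    by (rule fib_homotopic_sym[OF transport_own_image[OF \<Gamma> N]])
  also have "fib_homotopic C (corner z p P) \<dots> (transport \<Gamma> (psrc P \<cdot> N) (k \<cdot> N'))"
    by (rule transport_cong[OF \<Gamma> sN _ _ H]) simp_all
  also have "fib_homotopic C (corner z p P) \<dots> N'"
    using transport_own_image[OF \<Gamma> N'] e by simp
  finally show ?thesis .
qed

end

text \<open>A homotopy between two paths that keeps the source and the image of the target traces out,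
  at the target, a path inside the fibers of \<open>p\<close>, and the second path is the first
  one continued along it. The universal case is the path object of the corner map, where both
  sides agree on reflexivities.\<close>

lemma corner_homotopic_concat:
  assumes R: "is_path_object C p R" and j: "is_path_map C (z \<cdot> p) R P (Id C Y) j"
    and \<tau>: "is_concat C (z \<cdot> p) P \<tau>" and H: "fib_homotopic C (corner z p P) N N'" and T: "Dom C N = T"
  obtains \<beta> where "\<beta> \<in> paths T R" "psrc R \<cdot> \<beta> = ptgt P \<cdot> N" "ptgt R \<cdot> \<beta> = ptgt P \<cdot> N'"
    "path_homotopic (z \<cdot> p) P (concat_path P \<tau> N (j \<cdot> \<beta>)) N'"
proof -
  note S = the_path[OF corner_fib]
  let ?S = "the_path C (corner z p P)"
  have Ih: "Id C Y \<in> hom C (Dom C p) (Dom C (z \<cdot> p))" by (simp add: transport_simps hom_def)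
  note jD = path_mapD[OF j R P Ih]
  note [simp] = transport_simps path_simps[OF R] path_simps[OF S] jD(2-6,8-)
  obtain G where G: "G \<in> paths T ?S" "psrc ?S \<cdot> G = N" "ptgt ?S \<cdot> G = N'"
    using fib_homotopicE[OF H S] T by auto
  note [simp] = homD[OF G(1)]
  have sh: "psrc ?S \<in> paths (path_ob C ?S) P" and th: "ptgt ?S \<in> paths (path_ob C ?S) P"
    and e: "corner z p P \<cdot> psrc ?S = corner z p P \<cdot> ptgt ?S"
    by (simp_all add: hom_def)
  note eq = corner_eqD[OF sh th e]
  have rS: "prefl ?S \<in> paths (path_ob C P) ?S" by (simp add: hom_def)
  have Ip: "Id C (path_ob C P) \<in> paths (path_ob C P) P"
    "j \<cdot> (prefl R \<cdot> ptgt P) \<in> paths (path_ob C P) P" by (simp_all add: hom_def)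
  obtain \<beta> where \<beta>: "\<beta> \<in> paths (path_ob C ?S) R" "psrc R \<cdot> \<beta> = ptgt P \<cdot> psrc ?S"
    "ptgt R \<cdot> \<beta> = ptgt P \<cdot> ptgt ?S" "path_homotopic p R (\<beta> \<cdot> prefl ?S) (prefl R \<cdot> ptgt P)"
    by (rule lift_path_homotopic[OF R, of "prefl ?S" "path_ob C P" "path_ob C ?S" "ptgt P \<cdot> psrc ?S"
          "ptgt P \<cdot> ptgt ?S" "prefl R \<cdot> ptgt P"]) (use eq in \<open>auto simp: hom_def\<close>)
  note [simp] = homD[OF \<beta>(1)] \<beta>(2,3)
  have jb: "j \<cdot> \<beta> \<in> paths (path_ob C ?S) P" by (simp add: hom_def)
  have tj: "ptgt P \<cdot> psrc ?S = psrc P \<cdot> (j \<cdot> \<beta>)" by simp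
  note c = concat_arr[OF P \<tau> sh jb tj]
  have "path_homotopic (z \<cdot> p) P (concat_path P \<tau> (psrc ?S) (j \<cdot> \<beta>)) (ptgt ?S)"
  proof (rule path_homotopic_unique[OF P _ rS c(2) th])
    have II: "path_homotopic (z \<cdot> p) P (Id C (path_ob C P)) (Id C (path_ob C P))"
      by (rule path_homotopic_refl[OF P Ip(1)])
    have "path_homotopic (z \<cdot> p) P (j \<cdot> (\<beta> \<cdot> prefl ?S)) (j \<cdot> (prefl R \<cdot> ptgt P))"
      by (rule path_map_cong[OF R P Ih j \<beta>(4)])
    also have "path_homotopic (z \<cdot> p) P ((j \<cdot> prefl R) \<cdot> ptgt P) ((prefl P \<cdot> Id C Y) \<cdot> ptgt P)"
      by (rule fib_homotopic_comp[OF jD(7), of _ "path_ob C P"]) (simp add: hom_def)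
    then have "path_homotopic (z \<cdot> p) P (j \<cdot> (prefl R \<cdot> ptgt P)) (prefl P \<cdot> ptgt P)" by simp
    finally have b: "path_homotopic (z \<cdot> p) P (j \<cdot> (\<beta> \<cdot> prefl ?S)) (prefl P \<cdot> ptgt P)" .
    have "psrc R \<cdot> (\<beta> \<cdot> prefl ?S) = ptgt P"
      using comp_eq_ext2[OF \<beta>(2), of "prefl ?S"] by simp
    then have "path_homotopic (z \<cdot> p) P
       (concat_path P \<tau> (Id C (path_ob C P)) (j \<cdot> (\<beta> \<cdot> prefl ?S)))
       (concat_path P \<tau> (Id C (path_ob C P)) (prefl P \<cdot> ptgt P))"
      by (intro concat_cong[OF P \<tau> II b, of "path_ob C P"]) simp_all
    also have "path_homotopic (z \<cdot> p) P \<dots> (Id C (path_ob C P))"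
      using concat_refl_right[OF P \<tau> Ip(1)] by simp
    finally show "path_homotopic (z \<cdot> p) P
      ((concat_path P \<tau> (psrc ?S) (j \<cdot> \<beta>)) \<cdot> prefl ?S) (ptgt ?S \<cdot> prefl ?S)"
      using c(5)[OF rS] by simp
    show "psrc P \<cdot> (concat_path P \<tau> (psrc ?S) (j \<cdot> \<beta>)) = psrc P \<cdot> ptgt ?S"
      using c(3) eq(1) by simp
    show "ptgt P \<cdot> (concat_path P \<tau> (psrc ?S) (j \<cdot> \<beta>)) = ptgt P \<cdot> ptgt ?S"
      using c(4) by simp
  qed simp
  from fib_homotopic_comp[OF this, of G T]
  have "path_homotopic (z \<cdot> p) P (concat_path P \<tau> N (j \<cdot> (\<beta> \<cdot> G))) N'"
    using c(5)[OF G(1)] G by (simp add: homD[OF c(2)])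
  moreover have "psrc R \<cdot> (\<beta> \<cdot> G) = ptgt P \<cdot> N" "ptgt R \<cdot> (\<beta> \<cdot> G) = ptgt P \<cdot> N'"
    using comp_eq_ext2[OF \<beta>(2), of G] comp_eq_ext2[OF \<beta>(3), of G] G by simp_all
  ultimately show ?thesis using that[of "\<beta> \<cdot> G"] by (simp add: hom_def)
qed

end

section \<open>Path objects of products and base changes\<close>

lemma coneI:
  assumes "cospan f g" "a \<in> Arr C" "b \<in> Arr C" "Dom C a = Dom C b"
    "Cod C a = Dom C f" "Cod C b = Dom C g" "f \<cdot> a = g \<cdot> b"
  shows "cone f g a b"
  using assms by (simp only: cone_def)

lemma base_change_arr:
  assumes a: "a \<in> Fib C" and g: "g \<in> Arr C" "Cod C a = Cod C g" and u: "u \<in> hom C T (Dom C a)"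
  shows "cospan (a \<cdot> u) g \<Longrightarrow> cone a g (u \<cdot> pr1 C (a \<cdot> u) g) (pr2 C (a \<cdot> u) g)"
    "cospan (a \<cdot> u) g \<Longrightarrow> base_change C g a u \<in> hom C (pb_ob C (a \<cdot> u) g) (pb_ob C a g)"
proof -
  assume cs: "cospan (a \<cdot> u) g"
  note [simp] = homD[OF u] cs a
  have "cospan a g" using a g by (simp add: cospan_def)
  then show co: "cone a g (u \<cdot> pr1 C (a \<cdot> u) g) (pr2 C (a \<cdot> u) g)"
    using pr_eq[OF cs] a g by (simp add: cone_def)
  then show "base_change C g a u \<in> hom C (pb_ob C (a \<cdot> u) g) (pb_ob C a g)"
    by (simp add: hom_def base_change_def)
qed

lemma base_change_pullback:
  assumes a: "a \<in> Fib C" and g: "g \<in> Arr C" "Cod C a = Cod C g" and u: "u \<in> hom C T (Dom C a)"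
    and cs: "cospan (a \<cdot> u) g"
  shows "is_pullback C (pr1 C a g) u (base_change C g a u) (pr1 C (a \<cdot> u) g)"
proof -
  note [simp] = homD[OF u] a g cs
  have cs' [simp]: "cospan a g" by (simp add: cospan_def)
  note bc = base_change_arr[OF a g u cs]
  note [simp] = homD[OF bc(2)] bc(1)
  show ?thesis
  proof (rule is_pullbackI)
    show "pr1 C a g \<in> hom C (pb_ob C a g) (Dom C a)" "u \<in> hom C T (Dom C a)"
      "base_change C g a u \<in> hom C (pb_ob C (a \<cdot> u) g) (pb_ob C a g)"
      "pr1 C (a \<cdot> u) g \<in> hom C (pb_ob C (a \<cdot> u) g) T"
      by (simp_all add: hom_def)
    show "pr1 C a g \<cdot> base_change C g a u = u \<cdot> pr1 C (a \<cdot> u) g" by (simp add: base_change_def)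
  next
    fix w x y assume x: "x \<in> hom C w (pb_ob C a g)" and y: "y \<in> hom C w T"
      and e: "pr1 C a g \<cdot> x = u \<cdot> y"
    note [simp] = homD[OF x] homD[OF y]
    let ?m = "pair C (a \<cdot> u) g y (pr2 C a g \<cdot> x)"
    have m: "cone (a \<cdot> u) g y (pr2 C a g \<cdot> x)"
      using pb_ob_dom[OF cs', of x] e by (simp add: cone_def)
    have "base_change C g a u \<cdot> ?m = x" using m by (simp add: base_change_def e[symmetric])
    then show "\<exists>m. m \<in> hom C w (pb_ob C (a \<cdot> u) g) \<and> base_change C g a u \<cdot> m = x \<and>
      pr1 C (a \<cdot> u) g \<cdot> m = y"
      using m by (intro exI[of _ ?m]) (simp add: hom_def)
  next
    fix w m n assume m: "m \<in> hom C w (pb_ob C (a \<cdot> u) g)" and n: "n \<in> hom C w (pb_ob C (a \<cdot> u) g)"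
      and e: "base_change C g a u \<cdot> m = base_change C g a u \<cdot> n"
        "pr1 C (a \<cdot> u) g \<cdot> m = pr1 C (a \<cdot> u) g \<cdot> n"
    note [simp] = homD[OF m] homD[OF n]
    have "pr2 C (a \<cdot> u) g \<cdot> m = pr2 C (a \<cdot> u) g \<cdot> n"
      using arg_cong[OF e(1), of "Comp C (pr2 C a g)"] by (simp add: base_change_def del: pair_comp)
    then show "m = n" by (rule pb_ext[OF cs, rotated -1]) (use e(2) in auto)
  qed
qed

lemma prod_map_left_pullback:
  assumes u: "u \<in> hom C A' A" and X: "X \<in> Ob C"
  shows "is_pullback C (prod_pr1 A X) u (prod_map C u (Id C X))
    (prod_pr1 A' X)"
proof -
  note [simp] = homD[OF u] X
  have "base_change C (bang C X) (bang C A) u = prod_map C u (Id C X)"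
    by (simp add: base_change_def prod_map_def)
  then show ?thesis
    using base_change_pullback[of "bang C A" "bang C X" u A'] u by simp
qed

lemma swap_iso:
  assumes "A \<in> Ob C" "X \<in> Ob C"
  shows "is_iso C (prod_pair X A (prod_pr2 A X) (prod_pr1 A X))"
  by (rule is_isoI[of _ "prod_ob C A X" "prod_ob C X A"
        "prod_pair A X (prod_pr2 X A) (prod_pr1 X A)"])
    (use assms in \<open>simp_all add: hom_def prod_ob_def\<close>)

lemma prod_map_right_swap:
  assumes u: "u \<in> hom C A' A" and X: "X \<in> Ob C"
  shows "prod_map C (Id C X) u =
    prod_pair X A (prod_pr2 A X) (prod_pr1 A X) \<cdot>
    (prod_map C u (Id C X) \<cdot>
     prod_pair A' X (prod_pr2 X A') (prod_pr1 X A'))"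
  using homD[OF u] X by (simp add: prod_map_def)

lemma prod_map_Id:
  assumes u: "u \<in> Fib C" and X: "X \<in> Ob C"
  shows "prod_map C u (Id C X) \<in> Fib C" "prod_map C (Id C X) u \<in> Fib C"
    "u \<in> WE C \<Longrightarrow> prod_map C u (Id C X) \<in> WE C" "u \<in> WE C \<Longrightarrow> prod_map C (Id C X) u \<in> WE C"
proof -
  have uh: "u \<in> hom C (Dom C u) (Cod C u)" using u by (simp add: hom_def)
  note [simp] = u X homD(4,5)[OF uh]
  note pb = prod_map_left_pullback[OF uh X] and sw = prod_map_right_swap[OF uh X]
  show l: "prod_map C u (Id C X) \<in> Fib C" "u \<in> WE C \<Longrightarrow> prod_map C u (Id C X) \<in> WE C"
    using pullback_fib[OF u pb] pullback_we[OF u _ pb] by auto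
  note s' = iso_acyclic[OF swap_iso[OF homD(5)[OF uh] X]] iso_acyclic[OF swap_iso[OF X homD(4)[OF uh]]]
  show "prod_map C (Id C X) u \<in> Fib C"
    unfolding sw by (rule fib_comp[OF fib_comp[OF _ l(1)]]) (use s' in \<open>simp_all add: prod_ob_def\<close>)
  show "prod_map C (Id C X) u \<in> WE C" if "u \<in> WE C"
    unfolding sw
    by (rule we_comp[OF we_comp[OF _ l(2)[OF that]]]) (use s' in \<open>simp_all add: prod_ob_def\<close>)
qed

lemma prod_map_eq:
  assumes "u \<in> Arr C" "v \<in> Arr C"
  shows "prod_map C u v = prod_map C u (Id C (Cod C v)) \<cdot> prod_map C (Id C (Dom C u)) v"
  using assms dom_ob[OF assms(1)] dom_ob[OF assms(2)] cod_ob[OF assms(1)] cod_ob[OF assms(2)]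
  by (simp add: prod_map_def)

lemma prod_map_fib:
  assumes u: "u \<in> Fib C" and v: "v \<in> Fib C"
  shows "prod_map C u v \<in> Fib C" "u \<in> WE C \<Longrightarrow> v \<in> WE C \<Longrightarrow> prod_map C u v \<in> WE C"
proof -
  note [simp] = u v dom_ob[OF fibD[OF u]] cod_ob[OF fibD[OF v]]
  note e = prod_map_eq[OF fibD[OF u] fibD[OF v]]
  note l = prod_map_Id[OF u, of "Cod C v"] and r = prod_map_Id[OF v, of "Dom C u"]
  show "prod_map C u v \<in> Fib C" unfolding e by (rule fib_comp) (use l r in simp_all)
  show "prod_map C u v \<in> WE C" if "u \<in> WE C" "v \<in> WE C"
    unfolding e by (rule we_comp) (use l r that in simp_all)
qed

text \<open>Up to the interchange of the two middle factors, \<open>(s,t)\<close> for the product is the product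
  of the two fibrations \<open>(s,t)\<close>.\<close>

lemma prod_path_object:
  assumes P: "is_path_object C (bang C A) P" and Q: "is_path_object C (bang C X) Q"
    and ob: "A \<in> Ob C" "X \<in> Ob C"
  shows "is_path_object C (bang C (prod_ob C A X)) (prod_path C P Q)"
    "path_ob C (prod_path C P Q) = prod_ob C (path_ob C P) (path_ob C Q)"
proof -
  note [simp] = path_simps[OF P] path_simps[OF Q] ob
  let ?a = "bang C A" and ?x = "bang C X"
  let ?AX = "prod_ob C A X"
  let ?ax = "bang C ?AX"
  let ?PP = "path_ob C P" and ?QQ = "path_ob C Q"
  let ?aa = "bang C (pb_ob C ?a ?a)" and ?xx = "bang C (pb_ob C ?x ?x)"
  show po [simp]: "path_ob C (prod_path C P Q) = prod_ob C ?PP ?QQ"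
    unfolding path_ob_def[of C "prod_path C P Q"] by (simp add: prod_path_def)
  have sr: "prod_map C (psrc P) (psrc Q) \<cdot> prod_map C (prefl P) (prefl Q) = Id C ?AX"
    "prod_map C (ptgt P) (ptgt Q) \<cdot> prod_map C (prefl P) (prefl Q) = Id C ?AX"
    by (simp_all add: prod_map_def prod_ob_def)
  have we: "prod_map C (prefl P) (prefl Q) \<in> WE C"
    by (rule section_we[OF sr(1) prod_map_fib(2)])
      (use path_src_acyclic[OF P] path_src_acyclic[OF Q] in simp_all)
  define sh where "sh = pair C ?ax ?ax
      (pair C ?a ?x (pr1 C ?a ?a \<cdot> pr1 C ?aa ?xx) (pr1 C ?x ?x \<cdot> pr2 C ?aa ?xx))
      (pair C ?a ?x (pr2 C ?a ?a \<cdot> pr1 C ?aa ?xx) (pr2 C ?x ?x \<cdot> pr2 C ?aa ?xx))"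
  define sh' where "sh' = pair C ?aa ?xx
      (pair C ?a ?a (pr1 C ?a ?x \<cdot> pr1 C ?ax ?ax) (pr1 C ?a ?x \<cdot> pr2 C ?ax ?ax))
      (pair C ?x ?x (pr2 C ?a ?x \<cdot> pr1 C ?ax ?ax) (pr2 C ?a ?x \<cdot> pr2 C ?ax ?ax))"
  have AX: "pb_ob C ?a ?x = ?AX" by (simp add: prod_ob_def)
  note [simp] = AX
  have sh: "sh \<in> hom C (pb_ob C ?aa ?xx) (pb_ob C ?ax ?ax)"
    "sh' \<in> hom C (pb_ob C ?ax ?ax) (pb_ob C ?aa ?xx)"
    by (simp_all add: hom_def sh_def sh'_def)
  note [simp] = homD[OF sh(1)] homD[OF sh(2)]
  have "sh' \<cdot> sh = Id C (pb_ob C ?aa ?xx)" "sh \<cdot> sh' = Id C (pb_ob C ?ax ?ax)"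
    by (simp_all add: sh_def sh'_def)
  then have shf: "sh \<in> Fib C" using is_isoI[OF sh] iso_acyclic by blast
  have "sh \<cdot> prod_map C (st C ?a P) (st C ?x Q) = st C ?ax (prod_path C P Q)"
    by (simp add: sh_def st_def prod_path_def prod_map_def prod_ob_def[of C "?PP"])
  moreover have "sh \<cdot> prod_map C (st C ?a P) (st C ?x Q) \<in> Fib C"
    by (rule fib_comp) (use shf prod_map_fib[of "st C ?a P" "st C ?x Q"] in \<open>auto simp: prod_ob_def\<close>)
  ultimately have st: "st C ?ax (prod_path C P Q) \<in> Fib C" by simp
  show "is_path_object C ?ax (prod_path C P Q)"
    unfolding is_path_object_def po using sr we st
    by (simp add: hom_def) (simp add: prod_path_def)
qed

lemma bc_path_object:
  assumes P: "is_path_object C a P" and g: "g \<in> Arr C" "Cod C a = Cod C g"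
  shows "is_path_object C (pr2 C a g) (bc_path C g a P)"
    "path_ob C (bc_path C g a P) = pb_ob C (a \<cdot> psrc P) g"
proof -
  let ?s = "psrc P" and ?t = "ptgt P" and ?r = "prefl P"
  note [simp] = path_simps[OF P] g path_src_acyclic[OF P] path_tgt_acyclic[OF P]
  let ?c = "a \<cdot> ?t"
  have cs [simp]: "cospan a g" "cospan ?c g" by (simp_all add: cospan_def)
  have [simp]: "cospan (pr2 C a g) (pr2 C a g)" by (simp add: cospan_def)
  have pe: "a \<cdot> (?t \<cdot> pr1 C ?c g) = g \<cdot> pr2 C ?c g" using pr_eq[OF cs(2)] by simp
  have co [simp]: "cone a g (?s \<cdot> pr1 C ?c g) (pr2 C ?c g)" "cone a g (?t \<cdot> pr1 C ?c g) (pr2 C ?c g)"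
    "cone ?c g (?r \<cdot> pr1 C a g) (pr2 C a g)"
    using pe pr_eq[OF cs(1)] by (simp_all add: cone_def)
  have s': "psrc (bc_path C g a P) = pair C a g (?s \<cdot> pr1 C ?c g) (pr2 C ?c g)"
    and t': "ptgt (bc_path C g a P) = pair C a g (?t \<cdot> pr1 C ?c g) (pr2 C ?c g)"
    and r': "prefl (bc_path C g a P) = pair C ?c g (?r \<cdot> pr1 C a g) (pr2 C a g)"
    by (simp_all add: bc_path_def base_change_def)
  show po: "path_ob C (bc_path C g a P) = pb_ob C (a \<cdot> ?s) g"
    by (simp add: path_ob_def[of C "bc_path C g a P"] r')
  let ?q = "pr2 C a g" and ?st = "st C (pr2 C a g) (bc_path C g a P)"
  define h where "h = pair C a a (pr1 C a g \<cdot> pr1 C ?q ?q) (pr1 C a g \<cdot> pr2 C ?q ?q)"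
  have "a \<cdot> (pr1 C a g \<cdot> pr1 C ?q ?q) = a \<cdot> (pr1 C a g \<cdot> pr2 C ?q ?q)"
    using pb_ob_dom[OF cs(1), of "pr1 C ?q ?q"] pb_ob_dom[OF cs(1), of "pr2 C ?q ?q"]
      pr_eq[of ?q ?q] by simp
  then have hc [simp]: "cone a a (pr1 C a g \<cdot> pr1 C ?q ?q) (pr1 C a g \<cdot> pr2 C ?q ?q)"
    by (simp add: cone_def)
  have h [simp]: "h \<in> Arr C" "Dom C h = pb_ob C ?q ?q" "Cod C h = pb_ob C a a" by (simp_all add: h_def)
  have stc [simp]: "cone ?q ?q (psrc (bc_path C g a P)) (ptgt (bc_path C g a P))"
    by (rule coneI) (simp_all add: s' t')
  have st [simp]: "?st \<in> Arr C" "Dom C ?st = pb_ob C ?c g" "Cod C ?st = pb_ob C ?q ?q"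
    unfolding st_def using stc by (simp_all add: s' t' del: stc)
  have "is_pullback C h (st C a P) ?st (pr1 C ?c g)"
  proof (rule is_pullbackI)
    show "h \<in> hom C (pb_ob C ?q ?q) (pb_ob C a a)" "st C a P \<in> hom C (path_ob C P) (pb_ob C a a)"
      "?st \<in> hom C (pb_ob C ?c g) (pb_ob C ?q ?q)" "pr1 C ?c g \<in> paths (pb_ob C ?c g) P"
      by (simp_all add: hom_def)
    have "h \<cdot> ?st = pair C a a (pr1 C a g \<cdot> psrc (bc_path C g a P)) (pr1 C a g \<cdot> ptgt (bc_path C g a P))"
      using stc by (simp add: h_def) (simp add: st_def)
    then show "h \<cdot> ?st = st C a P \<cdot> pr1 C ?c g"
      by (simp add: s' t') (simp add: st_def)
  next
    fix w x y assume x: "x \<in> hom C w (pb_ob C ?q ?q)" and y: "y \<in> paths w P"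
      and e: "h \<cdot> x = st C a P \<cdot> y"
    note [simp] = homD[OF x] homD[OF y]
    have qx: "?q \<cdot> (pr1 C ?q ?q \<cdot> x) = ?q \<cdot> (pr2 C ?q ?q \<cdot> x)" by (rule pb_ob_dom) simp_all
    have e1: "pr1 C a g \<cdot> (pr1 C ?q ?q \<cdot> x) = ?s \<cdot> y" and e2: "pr1 C a g \<cdot> (pr2 C ?q ?q \<cdot> x) = ?t \<cdot> y"
      using arg_cong[OF e, of "Comp C (pr1 C a a)"] arg_cong[OF e, of "Comp C (pr2 C a a)"]
      by (simp_all add: h_def del: pair_comp)
    have mc: "cone ?c g y (?q \<cdot> (pr1 C ?q ?q \<cdot> x))"
      using pb_ob_dom[OF cs(1), of "pr2 C ?q ?q \<cdot> x"] e2 qx by (simp add: cone_def)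
    let ?m = "pair C ?c g y (?q \<cdot> (pr1 C ?q ?q \<cdot> x))"
    have mh [simp]: "?m \<in> Arr C" "Dom C ?m = w" "Cod C ?m = pb_ob C ?c g" using mc by simp_all
    have "?st \<cdot> ?m = x"
    proof (rule pb_ext[of ?q ?q])
      have "pr1 C ?q ?q \<cdot> (?st \<cdot> ?m) = psrc (bc_path C g a P) \<cdot> ?m"
        using pair_pr_comp(1)[OF stc, of ?m] by (simp add: st_def s' del: pair_comp)
      also have "\<dots> = pair C a g (?s \<cdot> y) (?q \<cdot> (pr1 C ?q ?q \<cdot> x))" using mc by (simp add: s')
      also have "\<dots> = pr1 C ?q ?q \<cdot> x" unfolding e1[symmetric] by simp
      finally show "pr1 C ?q ?q \<cdot> (?st \<cdot> ?m) = pr1 C ?q ?q \<cdot> x" .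
      have "pr2 C ?q ?q \<cdot> (?st \<cdot> ?m) = ptgt (bc_path C g a P) \<cdot> ?m"
        using pair_pr_comp(2)[OF stc, of ?m] by (simp add: st_def s' del: pair_comp)
      also have "\<dots> = pair C a g (?t \<cdot> y) (?q \<cdot> (pr2 C ?q ?q \<cdot> x))" using mc by (simp add: t' qx)
      also have "\<dots> = pr2 C ?q ?q \<cdot> x" unfolding e2[symmetric] by simp
      finally show "pr2 C ?q ?q \<cdot> (?st \<cdot> ?m) = pr2 C ?q ?q \<cdot> x" .
    qed simp_all
    then show "\<exists>m. m \<in> hom C w (pb_ob C ?c g) \<and> ?st \<cdot> m = x \<and> pr1 C ?c g \<cdot> m = y"
      using mc by (intro exI[of _ ?m]) (simp add: hom_def)
  next
    fix w m n assume m: "m \<in> hom C w (pb_ob C ?c g)" and n: "n \<in> hom C w (pb_ob C ?c g)"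
      and e: "?st \<cdot> m = ?st \<cdot> n" "pr1 C ?c g \<cdot> m = pr1 C ?c g \<cdot> n"
    note [simp] = homD[OF m] homD[OF n]
    have "?q \<cdot> (psrc (bc_path C g a P) \<cdot> m) = ?q \<cdot> (psrc (bc_path C g a P) \<cdot> n)"
      using arg_cong[OF e(1), of "\<lambda>m. ?q \<cdot> (pr1 C ?q ?q \<cdot> m)"]
        pair_pr_comp(1)[OF stc, of m] pair_pr_comp(1)[OF stc, of n]
      by (simp add: st_def s' del: pair_comp)
    then have "pr2 C ?c g \<cdot> m = pr2 C ?c g \<cdot> n" by (simp add: s' del: pair_comp)
    then show "m = n" by (rule pb_ext[OF cs(2), rotated -1]) (use e(2) in auto)
  qed
  then have stf: "?st \<in> Fib C" using pullback_fib[of "st C a P"] by simp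
  have qf: "?q \<in> Fib C" by simp
  have sh: "?s \<in> hom C (path_ob C P) (Dom C a)" by (simp add: hom_def)
  have "is_pullback C (pr1 C a g) ?s (psrc (bc_path C g a P)) (pr1 C ?c g)"
    using base_change_pullback[OF _ g sh] by (simp add: bc_path_def)
  then have sw: "psrc (bc_path C g a P) \<in> WE C" by (rule pullback_we[rotated 2]) simp_all
  have sr: "psrc (bc_path C g a P) \<cdot> prefl (bc_path C g a P) = Id C (pb_ob C a g)"
    by (simp add: s' r')
  have "prefl (bc_path C g a P) \<in> WE C"
    by (rule section_we[OF sr sw]) (simp_all add: r' s')
  then show "is_path_object C ?q (bc_path C g a P)"
    unfolding is_path_object_def po using stf qf sr
    by (simp add: hom_def) (simp add: r' s' t')
qed

section \<open>Evaluating the functors\<close>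

text \<open>The functors are defined by unions over representatives and over admissible maps between path objects. The
  lemmas below evaluate them at a single representative, which turns essential
  surjectivity and fullness into statements about homotopies.\<close>

lemma ess_surj_hom_gpd:
  assumes P: "is_path_object C z P" and F: "\<And>u. u \<in> GOb G \<Longrightarrow> fob F u \<in> GOb (hom_gpd C y z P)"
  shows "ess_surj G (hom_gpd C y z P) F \<longleftrightarrow>
    (\<forall>v \<in> GOb (hom_gpd C y z P). \<exists>u \<in> GOb G. fib_homotopic C z (fob F u) v)"
  using isomorphic_in_hom_gpd[OF P F] unfolding ess_surj_def by blast

lemma full_hom_gpd:
  assumes R: "is_path_object C b R"
    and F: "\<And>K. \<lbrakk>K \<in> paths (Dom C y) P; z \<cdot> (psrc P \<cdot> K) = y\<rbrakk> \<Longrightarrow>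
      farr F (hclass C z P K) = hclass C b R (\<phi> K) \<and> \<phi> K \<in> paths (Dom C y') R"
  shows "full (hom_gpd C y z P) (hom_gpd C y' b R) F \<longleftrightarrow>
    (\<forall>u \<in> hom C (Dom C y) (Dom C z). \<forall>u' \<in> hom C (Dom C y) (Dom C z).
      \<forall>H \<in> paths (Dom C y') R.
      z \<cdot> u = y \<longrightarrow> z \<cdot> u' = y \<longrightarrow> psrc R \<cdot> H = fob F u \<longrightarrow> ptgt R \<cdot> H = fob F u' \<longrightarrow>
      (\<exists>K \<in> paths (Dom C y) P. psrc P \<cdot> K = u \<and> ptgt P \<cdot> K = u' \<and>
         path_homotopic b R (\<phi> K) H))" (is "_ \<longleftrightarrow> ?R")
proof
  assume full: "full (hom_gpd C y z P) (hom_gpd C y' b R) F"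
  show ?R
  proof (intro ballI impI)
    fix u u' H
    assume h: "u \<in> hom C (Dom C y) (Dom C z)" "u' \<in> hom C (Dom C y) (Dom C z)"
      "H \<in> paths (Dom C y') R" "z \<cdot> u = y" "z \<cdot> u' = y" "psrc R \<cdot> H = fob F u"
      "ptgt R \<cdot> H = fob F u'"
    then have "hclass C b R H \<in> GHom (hom_gpd C y' b R) (fob F u) (fob F u')"
      "u \<in> GOb (hom_gpd C y z P)" "u' \<in> GOb (hom_gpd C y z P)"
      by (auto simp: hom_gpd_def)
    then obtain m where m: "m \<in> GHom (hom_gpd C y z P) u u'" "farr F m = hclass C b R H"
      using full unfolding full_def by blast
    then obtain K where K: "K \<in> paths (Dom C y) P" "psrc P \<cdot> K = u" "ptgt P \<cdot> K = u'"
      and mK: "m = hclass C z P K" by (auto simp: hom_gpd_def)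
    have zy: "z \<cdot> (psrc P \<cdot> K) = y" using K(2) h(4) by simp
    have "hclass C b R (\<phi> K) = hclass C b R H"
      using F[OF K(1) zy] m(2) mK by metis
    then have "path_homotopic b R (\<phi> K) H"
      using hclass_self[OF R h(3)] unfolding hclass_def by blast
    then show "\<exists>K \<in> paths (Dom C y) P. psrc P \<cdot> K = u \<and> ptgt P \<cdot> K = u' \<and>
         path_homotopic b R (\<phi> K) H" using K by blast
  qed
next
  assume R': ?R
  show "full (hom_gpd C y z P) (hom_gpd C y' b R) F"
    unfolding full_def
  proof (intro ballI)
    fix u u' m
    assume u: "u \<in> GOb (hom_gpd C y z P)" "u' \<in> GOb (hom_gpd C y z P)"
      and m: "m \<in> GHom (hom_gpd C y' b R) (fob F u) (fob F u')"
    obtain H where "H \<in> paths (Dom C y') R" "psrc R \<cdot> H = fob F u"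
      "ptgt R \<cdot> H = fob F u'" and mH: "m = hclass C b R H"
      using m by (auto simp: hom_gpd_def)
    then obtain K where K: "K \<in> paths (Dom C y) P" "psrc P \<cdot> K = u" "ptgt P \<cdot> K = u'"
         "path_homotopic b R (\<phi> K) H"
      using R' u[unfolded hom_gpd_def, simplified] by metis
    have zy: "z \<cdot> (psrc P \<cdot> K) = y" using K(2) u(1) by (simp add: hom_gpd_def)
    have "farr F (hclass C z P K) = m"
      using F[OF K(1) zy] hclass_eq[OF K(4)] mH by metis
    then show "\<exists>k \<in> GHom (hom_gpd C y z P) u u'. farr F k = m"
      using K by (intro bexI[of _ "hclass C z P K"]) (auto simp: hom_gpd_def)
  qed
qed

lemma post_ftor_hclass:
  assumes P: "is_path_object C a P" and Q: "is_path_object C b Q"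
    and e: "e \<in> hom C (Dom C a) (Dom C b)" and k: "is_path_map C b P Q e k"
    and H: "H \<in> paths T P"
  shows "farr (post_ftor C b P Q e) (hclass C a P H) = hclass C b Q (k \<cdot> H)"
proof -
  note [simp] = path_mapD[OF k P Q e] path_simps[OF P] path_simps[OF Q] homD[OF H]
  have eq: "hclass C b Q (k' \<cdot> H') = hclass C b Q (k \<cdot> H)"
    if h: "H' \<in> hclass C a P H" and k': "is_path_map C b P Q e k'" for H' k'
  proof -
    have HH': "path_homotopic a P H H'" using h by (simp add: hclass_def)
    have "path_homotopic b Q (k \<cdot> H) (k \<cdot> H')" by (rule path_map_cong[OF P Q e k HH'])
    also have "path_homotopic b Q (k \<cdot> H') (k' \<cdot> H')"
      by (rule fib_homotopic_comp[OF path_map_unique[OF P Q e k k'], of _ T])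
        (use path_homotopicD[OF HH' P] in \<open>simp add: hom_def\<close>)
    finally show ?thesis by (rule hclass_eq[symmetric])
  qed
  have "(\<Union>H' \<in> hclass C a P H. \<Union>k' \<in> {k. is_path_map C b P Q e k}. hclass C b Q (k' \<cdot> H')) =
    (\<Union>H' \<in> hclass C a P H. \<Union>k' \<in> {k. is_path_map C b P Q e k}. hclass C b Q (k \<cdot> H))"
    by (intro SUP_cong refl eq) auto
  also have "\<dots> = hclass C b Q (k \<cdot> H)" using k hclass_self[OF P H] by blast
  finally show ?thesis by (simp only: post_ftor_def ftor.simps)
qed

lemma prod_map_as_pair:
  assumes "K \<in> hom C T S" "q \<in> hom C X Q"
  shows "prod_map C K q = prod_pair S Q (K \<cdot> prod_pr1 T X)
    (q \<cdot> prod_pr2 T X)"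
  using homD[OF assms(1)] homD[OF assms(2)] by (simp add: prod_map_def)

lemma times_cong:
  assumes P: "is_path_object C (bang C A) P" and Q: "is_path_object C (bang C X) Q"
    and ob: "A \<in> Ob C" "X \<in> Ob C" and H: "path_homotopic (bang C A) P K K'"
    and T: "Dom C K = T" and x: "x \<in> hom C T X"
  shows "path_homotopic (bang C (prod_ob C A X)) (prod_path C P Q)
     (prod_pair (path_ob C P) (path_ob C Q) K (prefl Q \<cdot> x))
     (prod_pair (path_ob C P) (path_ob C Q) K' (prefl Q \<cdot> x))"
proof -
  let ?b = "bang C (prod_ob C A X)" and ?R = "prod_path C P Q"
  let ?p = "prod_pair (path_ob C P) (path_ob C Q)"
  note R = prod_path_object[OF P Q ob]
  note Kh = path_homotopicD[OF H P, unfolded T]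
  note [simp] = path_simps[OF P] path_simps[OF Q] path_simps[OF R(1)] ob homD[OF x]
    homD[OF Kh(1)] homD[OF Kh(2)]
  have R2: "path_ob C ?R = pb_ob C (bang C (path_ob C P)) (bang C (path_ob C Q))"
    using R(2) by (simp add: prod_ob_def)
  have "path_homotopic ?b ?R (?p K (prefl Q \<cdot> (x \<cdot> Id C T))) (?p K' (prefl Q \<cdot> (x \<cdot> Id C T)))"
  proof (rule homotopy_cong[OF H T, where \<Phi> = "\<lambda>y A. ?p A (prefl Q \<cdot> (x \<cdot> y))"])
    show "st C ?b ?R \<in> Fib C" by simp
    fix E y B
    assume y: "y \<in> hom C E T" and B': "B \<in> hom C E (Dom C (st C (bang C A) P))"
      and B2: "st C (bang C A) P \<cdot> B = st C (bang C A) P \<cdot> (K \<cdot> y)"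
    have B: "B \<in> paths E P" using B' by simp
    note [simp] = homD[OF y] homD[OF B]
    have Ky: "K \<cdot> y \<in> paths E P" by (simp add: hom_def)
    note B3 = st_eqD[OF P B Ky B2]
    have h: "?p B (prefl Q \<cdot> (x \<cdot> y)) \<in> paths E ?R"
      "?p (K \<cdot> y) (prefl Q \<cdot> (x \<cdot> y)) \<in> paths E ?R"
      by (simp_all add: hom_def R2)
    have "st C ?b ?R \<cdot> ?p B (prefl Q \<cdot> (x \<cdot> y)) = st C ?b ?R \<cdot> ?p (K \<cdot> y) (prefl Q \<cdot> (x \<cdot> y))"
      by (rule st_eqI[OF R(1) h]) (simp_all add: prod_path_def B3)
    then show "?p B (prefl Q \<cdot> (x \<cdot> y)) \<in> hom C E (Dom C (st C ?b ?R)) \<and>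
      st C ?b ?R \<cdot> ?p B (prefl Q \<cdot> (x \<cdot> y)) = st C ?b ?R \<cdot> ?p (K \<cdot> y) (prefl Q \<cdot> (x \<cdot> y))"
      using h by simp
    fix E' w assume w: "w \<in> hom C E' E"
    show "?p B (prefl Q \<cdot> (x \<cdot> y)) \<cdot> w = ?p (B \<cdot> w) (prefl Q \<cdot> (x \<cdot> (y \<cdot> w)))"
      using homD[OF w] by simp
  qed
  then show ?thesis by simp
qed

lemma times_ftor_hclass:
  assumes P: "is_path_object C (bang C A) P" and Q: "is_path_object C (bang C X) Q"
    and ob: "A \<in> Ob C" "X \<in> Ob C" and K: "K \<in> paths T P"
  shows "farr (times_ftor C A X P Q) (hclass C (bang C A) P K) =
    hclass C (bang C (prod_ob C A X)) (prod_path C P Q) (prod_map C K (prefl Q))"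
proof -
  note [simp] = path_simps[OF P] path_simps[OF Q] ob homD[OF K]
  have rQ: "prefl Q \<in> paths X Q" by (simp add: hom_def)
  have eq: "hclass C (bang C (prod_ob C A X)) (prod_path C P Q) (prod_map C K' (prefl Q)) =
    hclass C (bang C (prod_ob C A X)) (prod_path C P Q) (prod_map C K (prefl Q))"
    if h: "K' \<in> hclass C (bang C A) P K" for K'
  proof -
    let ?p1 = "prod_pr1 T X" and ?p2 = "prod_pr2 T X"
    have KK': "path_homotopic (bang C A) P K K'" using h by (simp add: hclass_def)
    note K' = path_homotopicD(2)[OF KK' P, simplified]
    note [simp] = homD[OF K']
    have "path_homotopic (bang C A) P (K \<cdot> ?p1) (K' \<cdot> ?p1)"
      by (rule fib_homotopic_comp[OF KK', of _ "pb_ob C (bang C T) (bang C X)"]) (simp add: hom_def)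
    from times_cong[OF P Q ob this, of _ "?p2"]
    have "path_homotopic (bang C (prod_ob C A X)) (prod_path C P Q) (prod_map C K (prefl Q))
       (prod_map C K' (prefl Q))"
      by (simp add: hom_def prod_map_as_pair[OF K rQ] prod_map_as_pair[OF K' rQ])
    then show ?thesis by (rule hclass_eq[symmetric])
  qed
  let ?c = "hclass C (bang C (prod_ob C A X)) (prod_path C P Q)"
  have "(\<Union>K' \<in> hclass C (bang C A) P K. ?c (prod_map C K' (prefl Q))) =
      (\<Union>K' \<in> hclass C (bang C A) P K. ?c (prod_map C K (prefl Q)))"
    by (rule SUP_cong[OF refl eq])
  also have "\<dots> = ?c (prod_map C K (prefl Q))" using hclass_self[OF P K] by blast
  finally show ?thesis by (simp only: times_ftor_def ftor.simps)
qed

lemma bc_ftor_hclass: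
  assumes P: "is_path_object C a P" and g: "g \<in> Arr C" "Cod C a = Cod C g"
    and K: "K \<in> paths T P" and y: "a \<cdot> (psrc P \<cdot> K) = y" "cospan y g"
  shows "farr (bc_ftor C g a P) (hclass C a P K) =
      hclass C (pr2 C a g) (bc_path C g a P) (base_change C g (a \<cdot> psrc P) K)"
    "base_change C g (a \<cdot> psrc P) K \<in> paths (pb_ob C y g) (bc_path C g a P)"
    "base_change C g (a \<cdot> psrc P) K = pair C (a \<cdot> psrc P) g (K \<cdot> pr1 C y g) (pr2 C y g)"
proof -
  note R = bc_path_object[OF P g]
  let ?R = "bc_path C g a P" and ?b = "pr2 C a g"
  note [simp] = path_simps[OF P] g homD[OF K] path_src_acyclic[OF P] path_tgt_acyclic[OF P]
    path_simps[OF R(1)] y(2)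
  let ?c = "a \<cdot> ptgt P"
  have cs [simp]: "cospan a g" "cospan ?c g" by (simp_all add: cospan_def)
  have R2: "path_ob C ?R = pb_ob C ?c g" using R(2) by simp
  have yt: "a \<cdot> (ptgt P \<cdot> K) = y" using y(1) by simp
  then have [simp]: "y \<in> Arr C" "Dom C y = T" by auto
  show bc: "base_change C g (a \<cdot> psrc P) K = pair C (a \<cdot> psrc P) g (K \<cdot> pr1 C y g) (pr2 C y g)"
    by (simp add: base_change_def yt)
  have co: "cone ?c g (K \<cdot> pr1 C y g) (pr2 C y g)"
    using arg_cong[OF yt, of "\<lambda>m. m \<cdot> pr1 C y g"] pr_eq[OF y(2)] by (simp add: cone_def)
  show bh: "base_change C g (a \<cdot> psrc P) K \<in> paths (pb_ob C y g) ?R"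
    unfolding bc using co by (simp add: R2 hom_def)
  have eq: "hclass C ?b ?R (base_change C g (a \<cdot> psrc P) K') = hclass C ?b ?R (base_change C g (a \<cdot> psrc P) K)"
    if h: "K' \<in> hclass C a P K" for K'
  proof -
    have KK': "path_homotopic a P K K'" using h by (simp add: hclass_def)
    note K' = path_homotopicD(2-4)[OF KK' P, simplified]
    note [simp] = homD[OF K'(1)]
    have yt': "a \<cdot> (ptgt P \<cdot> K') = y" using yt K'(3) by simp
    have bc': "base_change C g (a \<cdot> psrc P) K' = pair C ?c g (K' \<cdot> pr1 C y g) (pr2 C y g)"
      by (simp add: base_change_def yt')
    let ?T = "pb_ob C y g"
    have H: "path_homotopic a P (K \<cdot> pr1 C y g) (K' \<cdot> pr1 C y g)"
      by (rule fib_homotopic_comp[OF KK', of _ ?T]) (simp add: hom_def)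
    have "path_homotopic ?b ?R (pair C ?c g (K \<cdot> pr1 C y g) (pr2 C y g \<cdot> Id C ?T))
       (pair C ?c g (K' \<cdot> pr1 C y g) (pr2 C y g \<cdot> Id C ?T))"
    proof (rule homotopy_cong[OF H, where \<Phi> = "\<lambda>x A. pair C ?c g A (pr2 C y g \<cdot> x)"])
      show "Dom C (K \<cdot> pr1 C y g) = ?T" "st C ?b ?R \<in> Fib C" by simp_all
      fix E x A
      assume x: "x \<in> hom C E ?T" and A': "A \<in> hom C E (Dom C (st C a P))"
        and A2: "st C a P \<cdot> A = st C a P \<cdot> ((K \<cdot> pr1 C y g) \<cdot> x)"
      have A: "A \<in> paths E P" using A' by simp
      note [simp] = homD[OF x] homD[OF A]
      have Kx: "(K \<cdot> pr1 C y g) \<cdot> x \<in> paths E P" by (simp add: hom_def)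
      note A3 = st_eqD[OF P A Kx A2]
      have ct: "cone ?c g ((K \<cdot> pr1 C y g) \<cdot> x) (pr2 C y g \<cdot> x)" by (rule cone_comp[OF co]) simp_all
      then have cA: "cone ?c g A (pr2 C y g \<cdot> x)" using A3(2) by (simp add: cone_def)
      have h: "pair C ?c g A (pr2 C y g \<cdot> x) \<in> paths E ?R"
        "pair C ?c g ((K \<cdot> pr1 C y g) \<cdot> x) (pr2 C y g \<cdot> x) \<in> paths E ?R"
        using cA ct by (simp_all add: hom_def R2)
      have cst: "cone a g (psrc P \<cdot> pr1 C ?c g) (pr2 C ?c g)" "cone a g (ptgt P \<cdot> pr1 C ?c g) (pr2 C ?c g)"
        using pr_eq[OF cs(2)] by (simp_all add: cone_def)
      have "st C ?b ?R \<cdot> pair C ?c g A (pr2 C y g \<cdot> x) =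
          st C ?b ?R \<cdot> pair C ?c g ((K \<cdot> pr1 C y g) \<cdot> x) (pr2 C y g \<cdot> x)"
        by (rule st_eqI[OF R(1) h])
          (use cA ct A3 cst in \<open>simp_all add: bc_path_def base_change_def\<close>)
      then show "pair C ?c g A (pr2 C y g \<cdot> x) \<in> hom C E (Dom C (st C ?b ?R)) \<and>
        st C ?b ?R \<cdot> pair C ?c g A (pr2 C y g \<cdot> x) =
        st C ?b ?R \<cdot> pair C ?c g ((K \<cdot> pr1 C y g) \<cdot> x) (pr2 C y g \<cdot> x)"
        using h by simp
      fix E' w assume w: "w \<in> hom C E' E"
      show "pair C ?c g A (pr2 C y g \<cdot> x) \<cdot> w = pair C ?c g (A \<cdot> w) (pr2 C y g \<cdot> (x \<cdot> w))"
        using homD[OF w] cA by simp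
    qed
    then have "path_homotopic ?b ?R (base_change C g (a \<cdot> psrc P) K) (base_change C g (a \<cdot> psrc P) K')"
      unfolding bc bc' by simp
    then show ?thesis by (rule hclass_eq[symmetric])
  qed
  have "(\<Union>K' \<in> hclass C a P K. hclass C ?b ?R (base_change C g (a \<cdot> psrc P) K')) =
      (\<Union>K' \<in> hclass C a P K. hclass C ?b ?R (base_change C g (a \<cdot> psrc P) K))"
    by (rule SUP_cong[OF refl eq])
  also have "\<dots> = hclass C ?b ?R (base_change C g (a \<cdot> psrc P) K)"
    using hclass_self[OF P K] by blast
  finally show "farr (bc_ftor C g a P) (hclass C a P K) =
      hclass C (pr2 C a g) (bc_path C g a P) (base_change C g (a \<cdot> psrc P) K)"
    by (simp only: bc_ftor_def ftor.simps)
qed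

section \<open>Acting on paths in one variable\<close>

text \<open>The action of a two-variable map on a path in the first variable and a point \<open>x\<close>, taken as a
  constant path, in the second.\<close>

definition act :: "'m path \<Rightarrow> 'm path \<Rightarrow> 'm \<Rightarrow> 'm \<Rightarrow> 'm \<Rightarrow> 'm" where
  "act P Q k H x = k \<cdot> prod_pair (path_ob C P) (path_ob C Q) H (prefl Q \<cdot> x)"

context
  fixes A X Y P Q R k \<epsilon>
  assumes P: "is_path_object C (bang C A) P" and Q: "is_path_object C (bang C X) Q"
    and R: "is_path_object C (bang C Y) R"
    and ob: "A \<in> Ob C" "X \<in> Ob C" "Y \<in> Ob C"
    and \<epsilon>: "\<epsilon> \<in> hom C (prod_ob C A X) Y"
    and k: "is_path_map C (bang C Y) (prod_path C P Q) R \<epsilon> k"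
begin

lemma act_base:
  "\<epsilon> \<in> hom C (Dom C (bang C (prod_ob C A X))) (Dom C (bang C Y))"
  "k \<in> paths (prod_ob C (path_ob C P) (path_ob C Q)) R"
  "\<And>x. x \<in> Arr C \<Longrightarrow> Cod C x = prod_ob C (path_ob C P) (path_ob C Q) \<Longrightarrow>
     psrc R \<cdot> (k \<cdot> x) = \<epsilon> \<cdot> (prod_map C (psrc P) (psrc Q) \<cdot> x)"
  "\<And>x. x \<in> Arr C \<Longrightarrow> Cod C x = prod_ob C (path_ob C P) (path_ob C Q) \<Longrightarrow>
     ptgt R \<cdot> (k \<cdot> x) = \<epsilon> \<cdot> (prod_map C (ptgt P) (ptgt Q) \<cdot> x)"
  "path_homotopic (bang C Y) R (k \<cdot> prod_map C (prefl P) (prefl Q)) (prefl R \<cdot> \<epsilon>)"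
proof -
  note PQ = prod_path_object[OF P Q ob(1,2)]
  show e: "\<epsilon> \<in> hom C (Dom C (bang C (prod_ob C A X))) (Dom C (bang C Y))"
    using \<epsilon> ob by simp
  note kD = path_mapD[OF k PQ(1) R e, unfolded PQ(2)]
  show "k \<in> paths (prod_ob C (path_ob C P) (path_ob C Q)) R" by (rule kD(1))
  show "psrc R \<cdot> (k \<cdot> x) = \<epsilon> \<cdot> (prod_map C (psrc P) (psrc Q) \<cdot> x)"
    "ptgt R \<cdot> (k \<cdot> x) = \<epsilon> \<cdot> (prod_map C (ptgt P) (ptgt Q) \<cdot> x)"
    if "x \<in> Arr C" "Cod C x = prod_ob C (path_ob C P) (path_ob C Q)" for x
    using kD(8,9)[of x] that by (simp_all add: prod_path_def)
  show "path_homotopic (bang C Y) R (k \<cdot> prod_map C (prefl P) (prefl Q)) (prefl R \<cdot> \<epsilon>)"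
    using kD(7) by (simp add: prod_path_def)
qed

lemma act_arr:
  assumes H: "H \<in> paths S P" and x: "x \<in> hom C S X"
  shows "act P Q k H x \<in> paths S R"
    "psrc R \<cdot> act P Q k H x = \<epsilon> \<cdot> prod_pair A X (psrc P \<cdot> H) x"
    "ptgt R \<cdot> act P Q k H x = \<epsilon> \<cdot> prod_pair A X (ptgt P \<cdot> H) x"
    "y \<in> hom C S' S \<Longrightarrow> act P Q k H x \<cdot> y = act P Q k (H \<cdot> y) (x \<cdot> y)"
proof -
  note [simp] = path_simps[OF P] path_simps[OF Q] path_simps[OF R] ob homD[OF H] homD[OF x]
    homD[OF act_base(2)]
  have c: "pb_ob C (bang C (path_ob C P)) (bang C (path_ob C Q)) = prod_ob C (path_ob C P) (path_ob C Q)"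
    by (simp add: prod_ob_def)
  show "act P Q k H x \<in> paths S R" by (simp add: act_def hom_def c)
  show "psrc R \<cdot> act P Q k H x = \<epsilon> \<cdot> prod_pair A X (psrc P \<cdot> H) x"
    "ptgt R \<cdot> act P Q k H x = \<epsilon> \<cdot> prod_pair A X (ptgt P \<cdot> H) x"
    by (simp_all add: act_def c act_base(3,4))
  show "act P Q k H x \<cdot> y = act P Q k (H \<cdot> y) (x \<cdot> y)" if "y \<in> hom C S' S"
    using homD[OF that] by (simp add: act_def c)
qed

lemma act_cong:
  assumes H: "path_homotopic (bang C A) P H H'" and S: "Dom C H = S" and x: "x \<in> hom C S X"
  shows "path_homotopic (bang C Y) R (act P Q k H x) (act P Q k H' x)"
  unfolding act_def
  by (rule path_map_cong[OF prod_path_object(1)[OF P Q ob(1,2)] R act_base(1) k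
        times_cong[OF P Q ob(1,2) H S x]])

lemma act_prefl:
  assumes a: "a \<in> hom C S A" and x: "x \<in> hom C S X"
  shows "path_homotopic (bang C Y) R (act P Q k (prefl P \<cdot> a) x)
    (prefl R \<cdot> (\<epsilon> \<cdot> prod_pair A X a x))"
proof -
  note [simp] = path_simps[OF P] path_simps[OF Q] path_simps[OF R] ob homD[OF a] homD[OF x]
    homD[OF act_base(2)] homD[OF \<epsilon>]
  have c: "pb_ob C (bang C A) (bang C X) = prod_ob C A X" by (simp add: prod_ob_def)
  have "path_homotopic (bang C Y) R ((k \<cdot> prod_map C (prefl P) (prefl Q)) \<cdot> prod_pair A X a x)
     ((prefl R \<cdot> \<epsilon>) \<cdot> prod_pair A X a x)"
    by (rule fib_homotopic_comp[OF act_base(5), of _ S]) (simp add: hom_def c)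
  then show ?thesis by (simp add: act_def c)
qed

text \<open>By path induction on \<open>K\<close> it suffices to concatenate with a constant path.\<close>

lemma act_concat:
  assumes \<tau>: "is_concat C (bang C A) P \<tau>" and \<tau>': "is_concat C (bang C Y) R \<tau>'"
    and H: "H \<in> paths S P" and K: "K \<in> paths S P"
    and e: "ptgt P \<cdot> H = psrc P \<cdot> K" and x: "x \<in> hom C S X"
  shows "path_homotopic (bang C Y) R (act P Q k (concat_path P \<tau> H K) x)
    (concat_path R \<tau>' (act P Q k H x) (act P Q k K x))"
proof -
  note [simp] = path_simps[OF P] path_simps[OF Q] path_simps[OF R] ob homD[OF H] homD[OF x]
  let ?f = "ptgt P \<cdot> H"
  have f: "?f \<in> hom C S (Dom C (bang C A))" by (simp add: hom_def)
  let ?\<Phi> = "\<lambda>y N. act P Q k (concat_path P \<tau> (H \<cdot> y) N) (x \<cdot> y)"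
  let ?\<Phi>' = "\<lambda>y N. concat_path R \<tau>' (act P Q k (H \<cdot> y) (x \<cdot> y)) (act P Q k N (x \<cdot> y))"
  have "path_homotopic (bang C Y) R (?\<Phi> (Id C S) K) (?\<Phi>' (Id C S) K)"
  proof (rule path_induction[OF P f K e[symmetric], where \<Phi> = ?\<Phi> and \<Phi>' = ?\<Phi>'])
    fix E y N
    assume y: "y \<in> hom C E S" and N: "N \<in> paths E P" and sN: "psrc P \<cdot> N = ?f \<cdot> y"
    note [simp] = homD[OF y] homD[OF N]
    have Hy: "H \<cdot> y \<in> paths E P" and xy: "x \<cdot> y \<in> hom C E X" by (simp_all add: hom_def)
    have tH: "ptgt P \<cdot> (H \<cdot> y) = psrc P \<cdot> N" using sN by simp
    note c = concat_arr[OF P \<tau> Hy N tH]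
    note aH = act_arr[OF Hy xy] and aN = act_arr[OF N xy] and ac = act_arr[OF c(2) xy]
    have ta: "ptgt R \<cdot> act P Q k (H \<cdot> y) (x \<cdot> y) = psrc R \<cdot> act P Q k N (x \<cdot> y)"
      using aH(3) aN(2) tH by simp
    note c' = concat_arr[OF R \<tau>' aH(1) aN(1) ta]
    have "st C (bang C Y) R \<cdot> ?\<Phi> y N = st C (bang C Y) R \<cdot> ?\<Phi>' y N"
      by (rule st_eqI[OF R ac(1) c'(2)]) (simp_all only: ac(2,3) c(3,4) c'(3,4) aH(2) aN(3))
    then show "?\<Phi> y N \<in> hom C E (Dom C (st C (bang C Y) R)) \<and>
      ?\<Phi>' y N \<in> hom C E (Dom C (st C (bang C Y) R)) \<and>
      st C (bang C Y) R \<cdot> ?\<Phi> y N = st C (bang C Y) R \<cdot> ?\<Phi>' y N"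
      using ac(1) c'(2) by simp
    fix E' w assume w: "w \<in> hom C E' E"
    show "?\<Phi> y N \<cdot> w = ?\<Phi> (y \<cdot> w) (N \<cdot> w) \<and> ?\<Phi>' y N \<cdot> w = ?\<Phi>' (y \<cdot> w) (N \<cdot> w)"
      using ac(4)[OF w] c(5)[OF w] c'(5)[OF w] aH(4)[OF w] aN(4)[OF w] homD[OF w] by simp
  next
    have rf: "prefl P \<cdot> ?f \<in> paths S P" by (simp add: hom_def)
    note aH = act_arr[OF H x]
    have ah: "path_homotopic (bang C Y) R (act P Q k H x) (act P Q k H x)"
      by (rule path_homotopic_refl[OF R aH(1)])
    have tf: "ptgt P \<cdot> H \<in> hom C S A" by (simp add: hom_def)
    have D: "Dom C (concat_path P \<tau> H (prefl P \<cdot> ?f)) = S"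
      using concat_arr(2)[OF P \<tau> H rf] by (simp add: hom_def)
    have "path_homotopic (bang C Y) R (act P Q k (concat_path P \<tau> H (prefl P \<cdot> ?f)) x)
      (act P Q k H x)"
      by (rule act_cong[OF concat_refl_right[OF P \<tau> H] D x])
    also have "path_homotopic (bang C Y) R (act P Q k H x)
       (concat_path R \<tau>' (act P Q k H x) (prefl R \<cdot> (ptgt R \<cdot> act P Q k H x)))"
      by (rule fib_homotopic_sym[OF concat_refl_right[OF R \<tau>' aH(1)]])
    also have "path_homotopic (bang C Y) R \<dots>
       (concat_path R \<tau>' (act P Q k H x) (act P Q k (prefl P \<cdot> ?f) x))"
    proof (rule concat_cong[OF R \<tau>' ah])
      show "path_homotopic (bang C Y) R (prefl R \<cdot> (ptgt R \<cdot> act P Q k H x)) (act P Q k (prefl P \<cdot> ?f) x)"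
        using fib_homotopic_sym[OF act_prefl[OF tf x]] aH(3) by simp
    qed (use homD[OF aH(1)] in simp_all)
    finally show "path_homotopic (bang C Y) R (?\<Phi> (Id C S) (prefl P \<cdot> ?f)) (?\<Phi>' (Id C S) (prefl P \<cdot> ?f))"
      by simp
  qed
  then show ?thesis by simp
qed

end

section \<open>Exponentials and Pi-types in terms of homotopies\<close>

lemma GOb_hom_gpd1: "T \<in> Ob C \<Longrightarrow> A \<in> Ob C \<Longrightarrow> GOb (hom_gpd1 C T A) = hom C T A"
  by (auto simp: hom_gpd1_def hom_gpd_def hom_def)

lemma exp_ess_surj:
  assumes ob: "X \<in> Ob C" "Y \<in> Ob C" "A \<in> Ob C" "T \<in> Ob C" and e: "e \<in> hom C (prod_ob C A X) Y"
  shows "ess_surj (hom_gpd1 C T A) (hom_gpd1 C (prod_ob C T X) Y) (exp_ftor C X Y A e) \<longleftrightarrow>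
    (\<forall>v \<in> hom C (prod_ob C T X) Y. \<exists>u \<in> hom C T A.
       fib_homotopic C (bang C Y) (e \<cdot> prod_map C u (Id C X)) v)"
proof -
  note [simp] = ob homD[OF e]
  have fo: "fob (exp_ftor C X Y A e) u = e \<cdot> prod_map C u (Id C X)" for u
    by (simp add: exp_ftor_def ftor_comp_def post_ftor_def times_ftor_def Let_def)
  have P: "is_path_object C (bang C Y) (the_path C (bang C Y))" by (rule the_path) simp
  have F: "fob (exp_ftor C X Y A e) u \<in> GOb (hom_gpd1 C (prod_ob C T X) Y)"
    if "u \<in> GOb (hom_gpd1 C T A)" for u
    using that by (simp add: GOb_hom_gpd1 fo) (auto simp: hom_def)
  show ?thesis
    unfolding hom_gpd1_def[of C "prod_ob C T X"]
    using ess_surj_hom_gpd[OF P, where G = "hom_gpd1 C T A" and F = "exp_ftor C X Y A e",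
        OF F[unfolded hom_gpd1_def[of C "prod_ob C T X"]]]
    by (simp only: fo GOb_hom_gpd1[OF ob(4) ob(3)]
        GOb_hom_gpd1[OF prod_ob_ob[OF ob(4) ob(1)] ob(2), unfolded hom_gpd1_def])
qed

lemma exp_full:
  defines "P \<equiv> \<lambda>A. the_path C (bang C A)"
  assumes ob: "X \<in> Ob C" "Y \<in> Ob C" "A \<in> Ob C" "T \<in> Ob C" and e: "e \<in> hom C (prod_ob C A X) Y"
    and k: "is_path_map C (bang C Y) (prod_path C (P A) (P X)) (P Y) e k"
  shows "full (hom_gpd1 C T A) (hom_gpd1 C (prod_ob C T X) Y) (exp_ftor C X Y A e) \<longleftrightarrow>
    (\<forall>u \<in> hom C T A. \<forall>u' \<in> hom C T A. \<forall>H \<in> paths (prod_ob C T X) (P Y).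
       psrc (P Y) \<cdot> H = e \<cdot> prod_map C u (Id C X) \<longrightarrow> ptgt (P Y) \<cdot> H = e \<cdot> prod_map C u' (Id C X) \<longrightarrow>
       (\<exists>K \<in> paths T (P A). psrc (P A) \<cdot> K = u \<and> ptgt (P A) \<cdot> K = u' \<and>
         path_homotopic (bang C Y) (P Y)
           (act (P A) (P X) k (K \<cdot> prod_pr1 T X) (prod_pr2 T X)) H))"
proof -
  note [simp] = ob homD[OF e]
  have P: "is_path_object C (bang C B) (P B)" if "B \<in> Ob C" for B
    unfolding P_def using that by (intro the_path) simp
  note PA = P[OF ob(3)] and PX = P[OF ob(1)] and PY = P[OF ob(2)]
  note [simp] = path_simps[OF PA] path_simps[OF PX] path_simps[OF PY]
  note ak = PA PX PY ob(3) ob(1) ob(2) e k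
  let ?F = "exp_ftor C X Y A e"
  let ?p1 = "prod_pr1 T X" and ?p2 = "prod_pr2 T X"
  let ?\<phi> = "\<lambda>K. act (P A) (P X) k (K \<cdot> ?p1) ?p2"
  have fo: "fob ?F u = e \<cdot> prod_map C u (Id C X)" for u
    by (simp add: exp_ftor_def ftor_comp_def post_ftor_def times_ftor_def Let_def)
  have F: "farr ?F (hclass C (bang C A) (P A) K) = hclass C (bang C Y) (P Y) (?\<phi> K) \<and>
      ?\<phi> K \<in> paths (prod_ob C T X) (P Y)"
    if K: "K \<in> paths T (P A)" for K
  proof -
    note [simp] = homD[OF K]
    have rX: "prefl (P X) \<in> paths X (P X)" by (simp add: hom_def)
    note pm = prod_map_as_pair[OF K rX]
    note PQ = prod_path_object[OF PA PX ob(3,1)]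
    have "prod_map C K (prefl (P X)) \<in> paths (prod_ob C T X) (prod_path C (P A) (P X))"
      by (simp add: hom_def PQ(2))
    then have "farr ?F (hclass C (bang C A) (P A) K) =
        hclass C (bang C Y) (P Y) (k \<cdot> prod_map C K (prefl (P X)))"
      using post_ftor_hclass[OF PQ(1) PY _ k] e times_ftor_hclass[OF PA PX ob(3,1) K]
      by (simp add: exp_ftor_def ftor_comp_def Let_def P_def)
    moreover have "?\<phi> K \<in> paths (pb_ob C (bang C T) (bang C X)) (P Y)"
      by (rule act_arr(1)[OF ak]) (simp_all add: hom_def)
    ultimately show ?thesis by (simp add: act_def pm prod_ob_def)
  qed
  have y: "bang C A \<cdot> u = bang C T" if "u \<in> hom C T A" for u
    using homD[OF that] by simp
  show ?thesis
    using full_hom_gpd[OF PY, of "bang C T" "P A" "bang C A" ?F ?\<phi> "bang C (prod_ob C T X)"] F y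
    by (simp add: fo hom_gpd1_def P_def)
qed

lemma pi_ess_surj:
  assumes f: "f \<in> Fib C" and g: "g \<in> Fib C" and \<pi>: "\<pi> \<in> Fib C" "Cod C \<pi> = Cod C g"
    and e: "e \<in> hom C (pb_ob C \<pi> g) (Dom C f)" "f \<cdot> e = pr2 C \<pi> g"
    and y: "y \<in> hom C T (Cod C g)"
    and es: "ess_surj (hom_gpd C y \<pi> (the_path C \<pi>)) (hom_gpd C (pr2 C y g) f (the_path C f))
          (pi_ftor C f g \<pi> e)"
    and v: "v \<in> hom C (pb_ob C y g) (Dom C f)" "f \<cdot> v = pr2 C y g"
  obtains u where "u \<in> hom C T (Dom C \<pi>)" "\<pi> \<cdot> u = y" "fib_homotopic C f (e \<cdot> base_change C g \<pi> u) v"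
proof -
  note [simp] = homD[OF y] homD[OF e(1)] f g \<pi>
  have cs [simp]: "cospan y g" "cospan \<pi> g" by (simp_all add: cospan_def)
  have fo: "fob (pi_ftor C f g \<pi> e) u = e \<cdot> base_change C g \<pi> u" for u
    by (simp add: pi_ftor_def ftor_comp_def post_ftor_def bc_ftor_def Let_def)
  note P = the_path[OF f]
  have F: "fob (pi_ftor C f g \<pi> e) u \<in> GOb (hom_gpd C (pr2 C y g) f (the_path C f))"
    if "u \<in> GOb (hom_gpd C y \<pi> (the_path C \<pi>))" for u
  proof -
    have u: "u \<in> hom C T (Dom C \<pi>)" "\<pi> \<cdot> u = y" using that by (simp_all add: hom_gpd_def)
    have gA: "g \<in> Arr C" by simp
    have cu: "cospan (\<pi> \<cdot> u) g" using u(2) by simp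
    note b = base_change_arr[OF \<pi>(1) gA \<pi>(2) u(1) cu, unfolded u(2)]
    note [simp] = homD[OF u(1)] homD[OF b(2)]
    have "f \<cdot> (e \<cdot> base_change C g \<pi> u) = pr2 C y g"
      using comp_eq_ext[OF e(2), of "base_change C g \<pi> u"] b(1) by (simp add: base_change_def u(2))
    then show ?thesis by (simp add: fo hom_gpd_def hom_def)
  qed
  have "v \<in> GOb (hom_gpd C (pr2 C y g) f (the_path C f))" using v by (simp add: hom_gpd_def)
  then obtain u where u: "u \<in> GOb (hom_gpd C y \<pi> (the_path C \<pi>))"
    and H: "fib_homotopic C f (e \<cdot> base_change C g \<pi> u) v"
    using es ess_surj_hom_gpd[OF P F] fo by metis
  have "u \<in> hom C T (Dom C \<pi>)" "\<pi> \<cdot> u = y" using u by (simp_all add: hom_gpd_def)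
  then show ?thesis using H by (rule that)
qed

lemma pi_full:
  defines "P \<equiv> the_path C"
  assumes f: "f \<in> Fib C" and g: "g \<in> Fib C" and \<pi>: "\<pi> \<in> Fib C" "Cod C \<pi> = Cod C g"
    and e: "e \<in> hom C (pb_ob C \<pi> g) (Dom C f)" and y: "y \<in> hom C T (Cod C g)"
    and k: "is_path_map C f (bc_path C g \<pi> (P \<pi>)) (P f) e k"
    and full: "full (hom_gpd C y \<pi> (the_path C \<pi>)) (hom_gpd C (pr2 C y g) f (the_path C f))
          (pi_ftor C f g \<pi> e)"
    and u: "u \<in> hom C T (Dom C \<pi>)" "\<pi> \<cdot> u = y" and u': "u' \<in> hom C T (Dom C \<pi>)" "\<pi> \<cdot> u' = y"
    and H: "H \<in> paths (pb_ob C y g) (P f)" "psrc (P f) \<cdot> H = e \<cdot> base_change C g \<pi> u"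
      "ptgt (P f) \<cdot> H = e \<cdot> base_change C g \<pi> u'"
  obtains K where "K \<in> paths T (P \<pi>)" "psrc (P \<pi>) \<cdot> K = u" "ptgt (P \<pi>) \<cdot> K = u'"
    "path_homotopic f (P f)
       (k \<cdot> pair C (\<pi> \<cdot> psrc (P \<pi>)) g (K \<cdot> pr1 C y g) (pr2 C y g)) H"
proof -
  note [simp] = homD[OF y] homD[OF e(1)] f g \<pi>
  have cs [simp]: "cospan y g" "cospan \<pi> g" by (simp_all add: cospan_def)
  have gA: "g \<in> Arr C" by simp
  have PF: "is_path_object C f (P f)" and PP: "is_path_object C \<pi> (P \<pi>)"
    unfolding P_def using f \<pi> by (simp_all add: the_path)
  note B = bc_path_object[OF PP gA \<pi>(2)]
  let ?F = "pi_ftor C f g \<pi> e"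
  let ?\<phi> = "\<lambda>K. k \<cdot> pair C (\<pi> \<cdot> psrc (P \<pi>)) g (K \<cdot> pr1 C y g) (pr2 C y g)"
  have fo: "fob ?F u = e \<cdot> base_change C g \<pi> u" for u
    by (simp add: pi_ftor_def ftor_comp_def post_ftor_def bc_ftor_def Let_def)
  have eh: "e \<in> hom C (Dom C (pr2 C \<pi> g)) (Dom C f)" using e by simp
  have F: "farr ?F (hclass C \<pi> (P \<pi>) K) = hclass C f (P f) (?\<phi> K) \<and>
      ?\<phi> K \<in> paths (pb_ob C y g) (P f)"
    if K: "K \<in> paths T (P \<pi>)" and Ky: "\<pi> \<cdot> (psrc (P \<pi>) \<cdot> K) = y" for K
  proof -
    note bc = bc_ftor_hclass[OF PP gA \<pi>(2) K Ky cs(1)]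
    have "farr ?F (hclass C \<pi> (P \<pi>) K) = hclass C f (P f) (?\<phi> K)"
      using post_ftor_hclass[OF B(1) PF eh k bc(2)] bc(1,3)
      by (simp add: pi_ftor_def ftor_comp_def Let_def P_def)
    moreover have "?\<phi> K \<in> paths (pb_ob C y g) (P f)"
      using comp_hom[OF bc(2) path_mapD(1)[OF k B(1) PF eh]] bc(3) by simp
    ultimately show ?thesis by simp
  qed
  have F': "farr ?F (hclass C \<pi> (P \<pi>) K) = hclass C f (P f) (?\<phi> K) \<and>
      ?\<phi> K \<in> paths (Dom C (pr2 C y g)) (P f)"
    if "K \<in> paths (Dom C y) (P \<pi>)" "\<pi> \<cdot> (psrc (P \<pi>) \<cdot> K) = y" for K
    using F that by simp
  have "full (hom_gpd C y \<pi> (P \<pi>)) (hom_gpd C (pr2 C y g) f (P f)) ?F" using full by (simp add: P_def)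
  then have "\<exists>K \<in> paths (Dom C y) (P \<pi>). psrc (P \<pi>) \<cdot> K = u \<and> ptgt (P \<pi>) \<cdot> K = u' \<and>
      path_homotopic f (P f) (?\<phi> K) H"
    using full_hom_gpd[OF PF, where y = y and P = "P \<pi>" and z = \<pi> and F = ?F and \<phi> = ?\<phi>
        and y' = "pr2 C y g", OF F'] u u' H by (simp add: fo)
  then show ?thesis using that by auto
qed

text \<open>The new map lies over \<open>w\<close> exactly, not just up to homotopy, because lifting is strict below the
  diagonal.\<close>

lemma homotopy_lift:
  assumes p: "p \<in> Fib C" "p \<in> hom C Y Z" and z: "z \<in> Fib C" "Dom C z = Z" and v: "v \<in> hom C T Y"
    and H: "fib_homotopic C z (p \<cdot> v) w"
  obtains v' where "v' \<in> hom C T Y" "p \<cdot> v' = w" "fib_homotopic C (z \<cdot> p) v v'"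
proof -
  note [simp] = homD[OF p(2)] p(1) z homD[OF v]
  have zp: "z \<cdot> p \<in> Fib C" by simp
  note P = the_path[OF zp] and Q = the_path[OF z(1)]
  let ?P = "the_path C (z \<cdot> p)" and ?Q = "the_path C z"
  note [simp] = path_simps[OF P] path_simps[OF Q]
  have "p \<in> hom C (Dom C (z \<cdot> p)) (Dom C z)" by (simp add: hom_def)
  moreover have "z \<cdot> (p \<cdot> psrc ?P) = z \<cdot> (p \<cdot> ptgt ?P)" by (rule transport_assoc(2)[OF p z P Q])
  ultimately obtain k where k: "is_path_map C z ?P ?Q p k" using path_map_ex[OF P Q] by metis
  obtain \<alpha> where \<alpha>: "\<alpha> \<in> paths T ?Q" "psrc ?Q \<cdot> \<alpha> = p \<cdot> v" "ptgt ?Q \<cdot> \<alpha> = w"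
    using fib_homotopicE[OF H Q] by auto
  obtain K where K: "K \<in> paths T ?P" "psrc ?P \<cdot> K = v" "p \<cdot> (ptgt ?P \<cdot> K) = ptgt ?Q \<cdot> \<alpha>"
    using path_lift[OF p z P Q k v \<alpha>(1,2)] by metis
  note [simp] = homD[OF K(1)]
  show ?thesis
    by (rule that[of "ptgt ?P \<cdot> K"]) (use K \<alpha> fib_homotopicI[OF P K(1)] in \<open>auto simp: hom_def\<close>)
qed

end

section \<open>The exponential of a fibration\<close>

text \<open>Here \<open>B\<close> plays the role of \<open>Z\<^sup>X\<close> with evaluation \<open>d\<close>, and \<open>(\<pi>, e)\<close> is a section space: \<open>\<pi>\<close> lives over \<open>B\<close>,
  and \<open>e\<close> maps its base change along \<open>B \<times> X \<rightarrow> B\<close> over \<open>B \<times> X\<close> into the pullback of \<open>p\<close> along \<open>d\<close>.\<close>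

locale section_space = path_category C
  for C :: "('o, 'm) fwcat" (structure) +
  fixes X Y Z B :: 'o and p d \<pi> e :: 'm
  assumes obX: "X \<in> Ob C" and obB: "B \<in> Ob C"
    and p: "p \<in> Fib C" "p \<in> hom C Y Z"
    and d: "d \<in> hom C (prod_ob C B X) Z"
    and \<pi>: "\<pi> \<in> Fib C" "Cod C \<pi> = B"
    and e: "e \<in> hom C (pb_ob C \<pi> (prod_pr1 B X)) (pb_ob C p d)"
      "pr2 C p d \<cdot> e = pr2 C \<pi> (prod_pr1 B X)"
begin

abbreviation "E \<equiv> Dom C \<pi>"
abbreviation "g \<equiv> prod_pr1 B X"
abbreviation "q \<equiv> pr1 C p d"
abbreviation "f \<equiv> pr2 C p d"
abbreviation "proj1 S \<equiv> prod_pr1 S X"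
abbreviation "proj2 S \<equiv> prod_pr2 S X"
abbreviation "pairX A \<equiv> prod_pair A X"

lemma base [simp]:
  "X \<in> Ob C" "B \<in> Ob C" "Y \<in> Ob C" "Z \<in> Ob C" "E \<in> Ob C"
  "p \<in> Fib C" "p \<in> Arr C" "Dom C p = Y" "Cod C p = Z"
  "d \<in> Arr C" "Dom C d = prod_ob C B X" "Cod C d = Z"
  "\<pi> \<in> Fib C" "\<pi> \<in> Arr C" "Cod C \<pi> = B"
  "e \<in> Arr C" "Dom C e = pb_ob C \<pi> g" "Cod C e = pb_ob C p d"
  "cospan p d" "cospan \<pi> g" "f \<cdot> e = pr2 C \<pi> g"
  using obX obB homD[OF p(2)] p(1) homD[OF d] \<pi> homD[OF e(1)] e(2) dom_ob[of \<pi>]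
  by (auto simp: cospan_def)

lemma proj_simps [simp]:
  assumes "S \<in> Ob C"
  shows "proj1 S \<in> Arr C" "proj2 S \<in> Arr C" "Dom C (proj1 S) = prod_ob C S X" "Dom C (proj2 S) = prod_ob C S X"
    "Cod C (proj1 S) = S" "Cod C (proj2 S) = X" "pb_ob C (bang C S) (bang C X) = prod_ob C S X"
  using assms by (simp_all add: prod_ob_def)

text \<open>Products with \<open>X\<close> are base changes along \<open>g\<close>: a point of \<open>E\<close> over \<open>w\<close> and a point of \<open>X\<close> determine a point
  of the base change of \<open>E\<close>.\<close>

definition point :: "'m \<Rightarrow> 'm \<Rightarrow> 'm" where
  "point u x = pair C \<pi> g u (pairX B (\<pi> \<cdot> u) x)"

definition eval :: 'm where
  "eval = q \<cdot> (e \<cdot> point (proj1 E) (proj2 E))"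

lemma point_cone:
  assumes "u \<in> hom C S E" "x \<in> hom C S X"
  shows "cone \<pi> g u (pairX B (\<pi> \<cdot> u) x)"
  using homD[OF assms(1)] homD[OF assms(2)] by (simp add: cone_def)

lemma point_arr:
  assumes "u \<in> hom C S E" "x \<in> hom C S X"
  shows "point u x \<in> hom C S (pb_ob C \<pi> g)" "pr1 C \<pi> g \<cdot> point u x = u"
    "pr2 C \<pi> g \<cdot> point u x = pairX B (\<pi> \<cdot> u) x"
    "y \<in> hom C S' S \<Longrightarrow> point u x \<cdot> y = point (u \<cdot> y) (x \<cdot> y)"
proof -
  note [simp] = homD[OF assms(1)] homD[OF assms(2)] point_cone[OF assms]
  show "point u x \<in> hom C S (pb_ob C \<pi> g)" "pr1 C \<pi> g \<cdot> point u x = u"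
    "pr2 C \<pi> g \<cdot> point u x = pairX B (\<pi> \<cdot> u) x" by (simp_all add: point_def hom_def)
  show "point u x \<cdot> y = point (u \<cdot> y) (x \<cdot> y)" if "y \<in> hom C S' S"
    using homD[OF that] by (simp add: point_def)
qed

lemma eval_hom: "eval \<in> hom C (prod_ob C E X) Y"
proof -
  have "proj1 E \<in> hom C (prod_ob C E X) E" "proj2 E \<in> hom C (prod_ob C E X) X" by (simp_all add: hom_def)
  from point_arr(1)[OF this] show ?thesis by (simp add: eval_def hom_def)
qed

lemma eval_pair:
  assumes "u \<in> hom C S E" "x \<in> hom C S X"
  shows "eval \<cdot> pairX E u x = q \<cdot> (e \<cdot> point u x)"
proof -
  have h: "proj1 E \<in> hom C (prod_ob C E X) E" "proj2 E \<in> hom C (prod_ob C E X) X" by (simp_all add: hom_def)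
  note [simp] = homD[OF assms(1)] homD[OF assms(2)] homD[OF point_arr(1)[OF h]]
  have "pairX E u x \<in> hom C S (prod_ob C E X)" by (simp add: hom_def)
  from point_arr(4)[OF h this] show ?thesis by (simp add: eval_def)
qed

lemma section_image:
  assumes "u \<in> hom C S E" "x \<in> hom C S X"
  shows "q \<cdot> (e \<cdot> point u x) \<in> hom C S Y" "f \<cdot> (e \<cdot> point u x) = pairX B (\<pi> \<cdot> u) x"
    "p \<cdot> (q \<cdot> (e \<cdot> point u x)) = d \<cdot> pairX B (\<pi> \<cdot> u) x"
proof -
  note pt = point_arr[OF assms]
  note [simp] = homD[OF pt(1)]
  show "q \<cdot> (e \<cdot> point u x) \<in> hom C S Y" by (simp add: hom_def)
  show f: "f \<cdot> (e \<cdot> point u x) = pairX B (\<pi> \<cdot> u) x"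
    using comp_eq_ext[of f e "pr2 C \<pi> g" "point u x"] pt(3) by simp
  show "p \<cdot> (q \<cdot> (e \<cdot> point u x)) = d \<cdot> pairX B (\<pi> \<cdot> u) x"
    using pb_ob_dom[of p d "e \<cdot> point u x"] f by simp
qed

lemma eval_over: "p \<cdot> eval = d \<cdot> prod_map C \<pi> (Id C X)"
proof -
  have h: "proj1 E \<in> hom C (prod_ob C E X) E" "proj2 E \<in> hom C (prod_ob C E X) X" by (simp_all add: hom_def)
  show ?thesis using section_image(3)[OF h] by (simp add: eval_def prod_map_def)
qed

lemma eval_times:
  assumes u: "u \<in> hom C T E"
  shows "eval \<cdot> prod_map C u (Id C X) = q \<cdot> (e \<cdot> point (u \<cdot> proj1 T) (proj2 T))"
proof -
  note [simp] = homD[OF u]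
  have "prod_map C u (Id C X) = pairX E (u \<cdot> proj1 T) (proj2 T)" by (simp add: prod_map_def)
  then show ?thesis using eval_pair[of "u \<cdot> proj1 T" "prod_ob C T X" "proj2 T"] by (simp add: hom_def)
qed

text \<open>The two sides of the isomorphism between \<open>T \<times> X\<close> and the base change of \<open>w\<close> along \<open>g\<close>.\<close>

definition to_bc :: "'m \<Rightarrow> 'm" where
  "to_bc w = pair C w g (proj1 (Dom C w)) (pairX B (w \<cdot> proj1 (Dom C w)) (proj2 (Dom C w)))"

definition from_bc :: "'m \<Rightarrow> 'm" where
  "from_bc w = pairX (Dom C w) (pr1 C w g) (proj2 B \<cdot> pr2 C w g)"

lemma bc_iso:
  assumes w: "w \<in> hom C T B"
  shows "cospan w g" "to_bc w \<in> hom C (prod_ob C T X) (pb_ob C w g)"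
    "from_bc w \<in> hom C (pb_ob C w g) (prod_ob C T X)"
    "from_bc w \<cdot> to_bc w = Id C (prod_ob C T X)" "to_bc w \<cdot> from_bc w = Id C (pb_ob C w g)"
    "pr1 C w g \<cdot> to_bc w = proj1 T" "pr2 C w g \<cdot> to_bc w = pairX B (w \<cdot> proj1 T) (proj2 T)"
    "pairX B (w \<cdot> proj1 T) (proj2 T) \<cdot> from_bc w = pr2 C w g"
proof -
  note [simp] = homD[OF w]
  show cs [simp]: "cospan w g" by (simp add: cospan_def)
  have co [simp]: "cone w g (proj1 T) (pairX B (w \<cdot> proj1 T) (proj2 T))" by (rule coneI) simp_all
  show h: "to_bc w \<in> hom C (prod_ob C T X) (pb_ob C w g)"
    "from_bc w \<in> hom C (pb_ob C w g) (prod_ob C T X)"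
    by (simp_all add: to_bc_def from_bc_def hom_def)
  show "from_bc w \<cdot> to_bc w = Id C (prod_ob C T X)"
    using pair_eta_id[of "bang C T" "bang C X"] by (simp add: to_bc_def from_bc_def)
  show "pr1 C w g \<cdot> to_bc w = proj1 T" "pr2 C w g \<cdot> to_bc w = pairX B (w \<cdot> proj1 T) (proj2 T)"
    by (simp_all add: to_bc_def)
  have "pairX B (w \<cdot> proj1 T) (proj2 T) \<cdot> from_bc w = pairX B (w \<cdot> pr1 C w g) (proj2 B \<cdot> pr2 C w g)"
    by (simp add: from_bc_def)
  also have "\<dots> = pr2 C w g" by (simp add: pr_eq[OF cs])
  finally show e: "pairX B (w \<cdot> proj1 T) (proj2 T) \<cdot> from_bc w = pr2 C w g" .
  note [simp] = homD[OF h(1)] homD[OF h(2)]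
  have "to_bc w \<cdot> from_bc w = pair C w g (proj1 T \<cdot> from_bc w) (pairX B (w \<cdot> proj1 T) (proj2 T) \<cdot> from_bc w)"
    by (simp add: to_bc_def del: pair_comp add: pair_comp[OF co])
  also have "\<dots> = Id C (pb_ob C w g)" unfolding e by (simp add: from_bc_def)
  finally show "to_bc w \<cdot> from_bc w = Id C (pb_ob C w g)" .
qed

lemma base_change_to_bc:
  assumes u: "u \<in> hom C T E"
  shows "base_change C g \<pi> u \<in> hom C (pb_ob C (\<pi> \<cdot> u) g) (pb_ob C \<pi> g)"
    "base_change C g \<pi> u \<cdot> to_bc (\<pi> \<cdot> u) = point (u \<cdot> proj1 T) (proj2 T)"
    "point (u \<cdot> proj1 T) (proj2 T) \<cdot> from_bc (\<pi> \<cdot> u) = base_change C g \<pi> u"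
proof -
  note [simp] = homD[OF u]
  have w: "\<pi> \<cdot> u \<in> hom C T B" by (simp add: hom_def)
  note i = bc_iso[OF w]
  note [simp] = homD[OF i(2)] homD[OF i(3)] i(1)
  have gA: "g \<in> Arr C" "Cod C \<pi> = Cod C g" by simp_all
  note bc = base_change_arr[OF \<pi>(1) gA u i(1)]
  show "base_change C g \<pi> u \<in> hom C (pb_ob C (\<pi> \<cdot> u) g) (pb_ob C \<pi> g)" by (rule bc(2))
  note [simp] = homD[OF bc(2)] bc(1)
  show e: "base_change C g \<pi> u \<cdot> to_bc (\<pi> \<cdot> u) = point (u \<cdot> proj1 T) (proj2 T)"
    using i(6,7) by (simp add: base_change_def point_def)
  have "point (u \<cdot> proj1 T) (proj2 T) \<cdot> from_bc (\<pi> \<cdot> u) = base_change C g \<pi> u \<cdot> (to_bc (\<pi> \<cdot> u) \<cdot> from_bc (\<pi> \<cdot> u))"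
    unfolding e[symmetric] by simp
  then show "point (u \<cdot> proj1 T) (proj2 T) \<cdot> from_bc (\<pi> \<cdot> u) = base_change C g \<pi> u"
    unfolding i(5) by simp
qed

text \<open>A map \<open>v\<close> is first moved over a map of the form \<open>d (w \<times> 1)\<close>, by the property of \<open>B\<close> and homotopy lifting for
  \<open>p\<close>. It is then a partial section over \<open>w\<close>, which the property of \<open>E\<close> represents up to homotopy.\<close>

lemma eval_ess_surj:
  assumes T: "T \<in> Ob C"
    and dB: "\<And>v. v \<in> hom C (prod_ob C T X) Z \<Longrightarrow>
      \<exists>w \<in> hom C T B. fib_homotopic C (bang C Z) (d \<cdot> prod_map C w (Id C X)) v"
    and eE: "\<And>w v. \<lbrakk>w \<in> hom C T B; v \<in> hom C (pb_ob C w g) (pb_ob C p d); f \<cdot> v = pr2 C w g\<rbrakk> \<Longrightarrow>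
      \<exists>u. u \<in> hom C T E \<and> \<pi> \<cdot> u = w \<and> fib_homotopic C f (e \<cdot> base_change C g \<pi> u) v"
    and v: "v \<in> hom C (prod_ob C T X) Y"
  shows "\<exists>u \<in> hom C T E. fib_homotopic C (bang C Y) (eval \<cdot> prod_map C u (Id C X)) v"
proof -
  note [simp] = T homD[OF v]
  have "p \<cdot> v \<in> hom C (prod_ob C T X) Z" by (simp add: hom_def)
  from dB[OF this] obtain w where w: "w \<in> hom C T B"
    and wv: "fib_homotopic C (bang C Z) (p \<cdot> v) (d \<cdot> prod_map C w (Id C X))"
    using fib_homotopic_sym by blast
  note i = bc_iso[OF w]
  note [simp] = homD[OF w] homD[OF i(2)] homD[OF i(3)] i(1)
  have dw: "prod_map C w (Id C X) = pairX B (w \<cdot> proj1 T) (proj2 T)" by (simp add: prod_map_def)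
  obtain v' where v': "v' \<in> hom C (prod_ob C T X) Y" "p \<cdot> v' = d \<cdot> prod_map C w (Id C X)"
    "fib_homotopic C (bang C Y) v v'"
    using homotopy_lift[OF p _ _ v wv] by auto
  note [simp] = homD[OF v'(1)]
  have "p \<cdot> (v' \<cdot> from_bc w) = d \<cdot> pr2 C w g"
    using arg_cong[OF v'(2), of "\<lambda>m. m \<cdot> from_bc w"] i(8)
    by (simp add: dw del: pair_comp)
  then have co: "cone p d (v' \<cdot> from_bc w) (pr2 C w g)" by (simp add: cone_def)
  let ?v = "pair C p d (v' \<cdot> from_bc w) (pr2 C w g)"
  have "?v \<in> hom C (pb_ob C w g) (pb_ob C p d)" "f \<cdot> ?v = pr2 C w g" using co by (simp_all add: hom_def)
  then obtain u where u: "u \<in> hom C T E" "\<pi> \<cdot> u = w" and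
    H: "fib_homotopic C f (e \<cdot> base_change C g \<pi> u) ?v" using eE[OF w] by blast
  note bc = base_change_to_bc[OF u(1), unfolded u(2)]
  note [simp] = homD[OF u(1)] homD[OF bc(1)]
  have fF: "f \<in> Fib C" by simp
  note PW = the_path[OF fF]
  note [simp] = path_simps[OF PW]
  have "fib_homotopic C (bang C Y) (q \<cdot> (e \<cdot> base_change C g \<pi> u)) (q \<cdot> ?v)"
    by (rule fib_homotopic_push[OF H PW]) (simp_all add: hom_def)
  from fib_homotopic_comp[OF this, of "to_bc w" "prod_ob C T X"]
  have "fib_homotopic C (bang C Y) (q \<cdot> (e \<cdot> (base_change C g \<pi> u \<cdot> to_bc w)))
      (v' \<cdot> (from_bc w \<cdot> to_bc w))"
    using co by (simp add: hom_def)
  then have "fib_homotopic C (bang C Y) (eval \<cdot> prod_map C u (Id C X)) v'"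
    unfolding bc(2) i(4) eval_times[OF u(1)] by simp
  from fib_homotopic_trans[OF this fib_homotopic_sym[OF v'(3)]] show ?thesis using u by blast
qed

lemma is_path_map_Id_comp:
  assumes P: "is_path_object C a P" and Q: "is_path_object C b Q" and R: "is_path_object C c R"
    and h: "h \<in> hom C (Dom C a) (Dom C b)" and D: "Dom C c = Dom C b"
    and k: "is_path_map C b P Q h k" and k': "is_path_map C c Q R (Id C (Dom C b)) k'"
  shows "is_path_map C c P R h (k' \<cdot> k)"
proof -
  have "Id C (Dom C b) \<in> hom C (Dom C b) (Dom C c)"
    using D path_simps[OF Q] by (simp add: hom_def)
  from path_map_comp[OF P Q R h this k k'] show ?thesis using homD[OF h] by simp
qed

text \<open>The maps named \<open>k\<close> are actions on paths of the maps of the construction. Those named \<open>j\<close> act on paths by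
  an identity: they regard paths inside fibers as paths, or compare two path objects of
  the same fibration.\<close>

context
  fixes kp kd k k\<pi> ke jY jE jW kq :: 'm and PA :: "'o \<Rightarrow> 'm path"
  defines "PA \<equiv> \<lambda>A. the_path C (bang C A)"
  assumes kp: "is_path_map C (bang C Z) (PA Y) (PA Z) p kp"
    and kd: "is_path_map C (bang C Z) (prod_path C (PA B) (PA X)) (PA Z) d kd"
    and k: "is_path_map C (bang C Y) (prod_path C (PA E) (PA X)) (PA Y) eval k"
    and k\<pi>: "is_path_map C (bang C B) (PA E) (PA B) \<pi> k\<pi>"
    and ke: "is_path_map C f (bc_path C g \<pi> (the_path C \<pi>)) (the_path C f) e ke"
    and jY: "is_path_map C (bang C Y) (the_path C p) (PA Y) (Id C Y) jY"
    and jE: "is_path_map C (bang C E) (the_path C \<pi>) (PA E) (Id C E) jE"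
    and jW: "is_path_map C f (bc_path C d p (the_path C p)) (the_path C f) (Id C (pb_ob C p d)) jW"
    and kq: "is_path_map C p (the_path C f) (the_path C p) q kq"
begin

lemma PA: "A \<in> Ob C \<Longrightarrow> is_path_object C (bang C A) (PA A)"
  unfolding PA_def by (rule the_path) simp

lemma fib_f: "f \<in> Fib C" by simp

lemmas paths = PA[OF base(1)] PA[OF base(2)] PA[OF base(3)] PA[OF base(4)] PA[OF base(5)]
  the_path[OF p(1)] the_path[OF \<pi>(1)] the_path[OF fib_f]

lemmas paths_simps = path_simps[OF paths(1)] path_simps[OF paths(2)] path_simps[OF paths(3)]
  path_simps[OF paths(4)] path_simps[OF paths(5)] path_simps[OF paths(6)] path_simps[OF paths(7)]
  path_simps[OF paths(8)]

text \<open>Acting on paths by \<open>eval\<close> and then by \<open>p\<close> agrees with acting by \<open>\<pi>\<close> and then by \<open>d\<close>, since both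
  cover the same map.\<close>

lemma act_over:
  assumes K: "K \<in> paths S (PA E)" and x: "x \<in> hom C S X"
  shows "path_homotopic (bang C Z) (PA Z) (kp \<cdot> act (PA E) (PA X) k K x)
    (act (PA B) (PA X) kd (k\<pi> \<cdot> K) x)"
proof -
  note [simp] = paths_simps homD[OF K] homD[OF x]
  let ?PE = "prod_path C (PA E) (PA X)" and ?PB = "prod_path C (PA B) (PA X)"
  note PE = prod_path_object[OF paths(5,1) base(5,1)] and PB = prod_path_object[OF paths(2,1) base(2,1)]
  note [simp] = path_simps[OF PE(1)] path_simps[OF PB(1)]
  have ph: "p \<in> hom C (Dom C (bang C Y)) (Dom C (bang C Z))"
    and dh: "d \<in> hom C (Dom C (bang C (prod_ob C B X))) (Dom C (bang C Z))"
    and eh: "eval \<in> hom C (Dom C (bang C (prod_ob C E X))) (Dom C (bang C Y))"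
    and \<pi>h: "\<pi> \<in> hom C (Dom C (bang C E)) (Dom C (bang C B))"
    using p d eval_hom by (simp_all add: hom_def)
  have \<pi>X: "prod_map C \<pi> (Id C X) \<in> hom C (Dom C (bang C (prod_ob C E X))) (Dom C (bang C (prod_ob C B X)))"
    by (simp add: hom_def)
  note k\<pi>D = path_mapD[OF k\<pi> paths(5,2) \<pi>h]
  note [simp] = k\<pi>D(2-6,8-)
  have kX: "is_path_map C (bang C (prod_ob C B X)) ?PE ?PB (prod_map C \<pi> (Id C X))
      (prod_map C k\<pi> (Id C (path_ob C (PA X))))"
  proof -
    have "path_homotopic (bang C B) (PA B) ((k\<pi> \<cdot> prefl (PA E)) \<cdot> proj1 E) ((prefl (PA B) \<cdot> \<pi>) \<cdot> proj1 E)"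
      by (rule fib_homotopic_comp[OF k\<pi>D(7), of _ "prod_ob C E X"]) (simp add: hom_def)
    then have H: "path_homotopic (bang C B) (PA B) (k\<pi> \<cdot> (prefl (PA E) \<cdot> proj1 E)) (prefl (PA B) \<cdot> (\<pi> \<cdot> proj1 E))"
      by simp
    have D: "Dom C (k\<pi> \<cdot> (prefl (PA E) \<cdot> proj1 E)) = prod_ob C E X"
      and s: "proj2 E \<in> hom C (prod_ob C E X) X" by (simp_all add: hom_def)
    from times_cong[OF paths(2,1) base(2,1) H D s]
    have "path_homotopic (bang C (prod_ob C B X)) ?PB
        (prod_map C k\<pi> (Id C (path_ob C (PA X))) \<cdot> prod_map C (prefl (PA E)) (prefl (PA X)))
        (prod_map C (prefl (PA B)) (prefl (PA X)) \<cdot> prod_map C \<pi> (Id C X))"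
      by (simp add: prod_map_def)
    moreover have "prod_map C (psrc (PA B)) (psrc (PA X)) \<cdot> prod_map C k\<pi> (Id C (path_ob C (PA X)))
        = prod_map C \<pi> (Id C X) \<cdot> prod_map C (psrc (PA E)) (psrc (PA X))"
      "prod_map C (ptgt (PA B)) (ptgt (PA X)) \<cdot> prod_map C k\<pi> (Id C (path_ob C (PA X)))
        = prod_map C \<pi> (Id C X) \<cdot> prod_map C (ptgt (PA E)) (ptgt (PA X))"
      by (simp_all add: prod_map_def)
    moreover have "prod_map C k\<pi> (Id C (path_ob C (PA X))) \<in> paths (path_ob C ?PE) ?PB"
      unfolding PE(2) PB(2) by (simp add: hom_def)
    ultimately show ?thesis unfolding is_path_map_def by (simp add: prod_path_def)
  qed
  have m1: "is_path_map C (bang C Z) ?PE (PA Z) (p \<cdot> eval) (kp \<cdot> k)"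
    by (rule path_map_comp[OF PE(1) paths(3,4) eh ph k kp])
  have m2: "is_path_map C (bang C Z) ?PE (PA Z) (p \<cdot> eval) (kd \<cdot> prod_map C k\<pi> (Id C (path_ob C (PA X))))"
    unfolding eval_over by (rule path_map_comp[OF PE(1) PB(1) paths(4) \<pi>X dh kX kd])
  have peh: "p \<cdot> eval \<in> hom C (Dom C (bang C (prod_ob C E X))) (Dom C (bang C Z))"
    by (rule comp_hom[OF eh ph])
  note kpD = path_mapD[OF kp paths(3,4) ph] and kD = path_mapD[OF k PE(1) paths(3) eh]
    and kdD = path_mapD[OF kd PB(1) paths(4) dh]
  note [simp] = kpD(2-4) kD(2-4)[unfolded PE(2)] kdD(2-4)[unfolded PB(2)]
  let ?K = "pair C (bang C (path_ob C (PA E))) (bang C (path_ob C (PA X))) K (prefl (PA X) \<cdot> x)"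
  have c: "pb_ob C (bang C (path_ob C (PA A))) (bang C (path_ob C (PA X))) =
    prod_ob C (path_ob C (PA A)) (path_ob C (PA X))" for A by (simp add: prod_ob_def)
  have "path_homotopic (bang C Z) (PA Z) ((kp \<cdot> k) \<cdot> ?K) ((kd \<cdot> prod_map C k\<pi> (Id C (path_ob C (PA X)))) \<cdot> ?K)"
    by (rule fib_homotopic_comp[OF path_map_unique[OF PE(1) paths(4) peh m1 m2], of _ S])
      (simp add: hom_def c)
  then show ?thesis by (simp add: act_def c)
qed

text \<open>On paths inside the fibers of \<open>\<pi>\<close> the action of \<open>eval\<close> is the fiberwise action of \<open>e\<close>: by path induction, as both
  are constant on constant paths.\<close>

lemma act_fiberwise:
  assumes M: "M \<in> paths S (the_path C \<pi>)" and x: "x \<in> hom C S X"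
  shows "path_homotopic (bang C Y) (PA Y) (act (PA E) (PA X) k (jE \<cdot> M) x)
    (jY \<cdot> (kq \<cdot> (ke \<cdot> pair C (\<pi> \<cdot> psrc (the_path C \<pi>)) g M (pairX B (\<pi> \<cdot> (psrc (the_path C \<pi>) \<cdot> M)) x))))"
proof -
  let ?P = "the_path C \<pi>" and ?R = "the_path C p" and ?W = "the_path C f"
  let ?s = "psrc ?P" and ?t = "ptgt ?P" and ?r = "prefl ?P"
  note [simp] = paths_simps homD[OF M] homD[OF x]
  have gA: "g \<in> Arr C" "Cod C \<pi> = Cod C g" by simp_all
  note Bc = bc_path_object[OF paths(7) gA]
  let ?Bc = "bc_path C g \<pi> ?P"
  have eh: "e \<in> hom C (Dom C (pr2 C \<pi> g)) (Dom C f)" and qh: "q \<in> hom C (Dom C f) (Dom C p)"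
    and Yh: "Id C Y \<in> hom C (Dom C p) (Dom C (bang C Y))" and Eh: "Id C E \<in> hom C (Dom C \<pi>) (Dom C (bang C E))"
    by (simp_all add: hom_def)
  have qeh: "q \<cdot> e \<in> hom C (Dom C (pr2 C \<pi> g)) (Dom C p)" by (simp add: hom_def)
  have "is_path_map C p ?Bc ?R (q \<cdot> e) (kq \<cdot> ke)"
    by (rule path_map_comp[OF Bc(1) paths(8,6) eh qh ke kq])
  from is_path_map_Id_comp[OF Bc(1) paths(6,3) qeh _ this] jY
  have m: "is_path_map C (bang C Y) ?Bc (PA Y) (q \<cdot> e) (jY \<cdot> (kq \<cdot> ke))" by simp
  have qeh': "q \<cdot> e \<in> hom C (Dom C (pr2 C \<pi> g)) (Dom C (bang C Y))" by (simp add: hom_def)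
  note mD = path_mapD[OF m Bc(1) paths(3) qeh']
  note jED = path_mapD[OF jE paths(7,5) Eh] and keD = path_mapD[OF ke Bc(1) paths(8) eh]
    and kqD = path_mapD[OF kq paths(8,6) qh] and jYD = path_mapD[OF jY paths(6,3) Yh]
  have cs [simp]: "cospan (\<pi> \<cdot> ?t) g" using path_tgt_acyclic[OF paths(7)] by (simp add: cospan_def)
  have BcO: "path_ob C ?Bc = pb_ob C (\<pi> \<cdot> ?t) g" using Bc(2) by simp
  note [simp] = jED(2-6,8-) keD(2-4)[unfolded BcO] kqD(2-4) jYD(2-4)
  note ak = paths(5,1,3) base(5,1,3) eval_hom k
  define b where "b N x' = pair C (\<pi> \<cdot> ?s) g N (pairX B (\<pi> \<cdot> (?s \<cdot> N)) x')" for N x'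
  have bc: "cone (\<pi> \<cdot> ?t) g N (pairX B (\<pi> \<cdot> (?s \<cdot> N)) x')"
    if "N \<in> paths U ?P" "x' \<in> hom C U X" for N x' U
    using homD[OF that(1)] homD[OF that(2)] by (intro coneI) simp_all
  have bh: "b N x' \<in> paths U ?Bc"
    "psrc ?Bc \<cdot> b N x' = point (?s \<cdot> N) x'" "ptgt ?Bc \<cdot> b N x' = point (?t \<cdot> N) x'"
    "\<And>y U'. y \<in> hom C U' U \<Longrightarrow> b N x' \<cdot> y = b (N \<cdot> y) (x' \<cdot> y)"
    if N: "N \<in> paths U ?P" and x': "x' \<in> hom C U X" for N x' U
  proof -
    note [simp] = homD[OF N] homD[OF x']
    note co = bc[OF N x']
    have cst: "cone \<pi> g (?s \<cdot> pr1 C (\<pi> \<cdot> ?t) g) (pr2 C (\<pi> \<cdot> ?t) g)"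
      "cone \<pi> g (?t \<cdot> pr1 C (\<pi> \<cdot> ?t) g) (pr2 C (\<pi> \<cdot> ?t) g)"
      using pr_eq[OF cs] by (simp_all add: cone_def)
    show "b N x' \<in> paths U ?Bc" using co by (simp add: b_def BcO hom_def)
    show "psrc ?Bc \<cdot> b N x' = point (?s \<cdot> N) x'" "ptgt ?Bc \<cdot> b N x' = point (?t \<cdot> N) x'"
      using co cst by (simp_all add: b_def bc_path_def base_change_def point_def)
    show "b N x' \<cdot> y = b (N \<cdot> y) (x' \<cdot> y)" if "y \<in> hom C U' U" for y U'
      using co homD[OF that] by (simp add: b_def)
  qed
  let ?f = "?s \<cdot> M"
  have fh: "?f \<in> hom C S (Dom C \<pi>)" by (simp add: hom_def)
  let ?\<Phi> = "\<lambda>y N. act (PA E) (PA X) k (jE \<cdot> N) (x \<cdot> y)"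
  let ?\<Phi>' = "\<lambda>y N. (jY \<cdot> (kq \<cdot> ke)) \<cdot> b N (x \<cdot> y)"
  have "path_homotopic (bang C Y) (PA Y) (?\<Phi> (Id C S) M) (?\<Phi>' (Id C S) M)"
  proof (rule path_induction[OF paths(7) fh M refl, where \<Phi> = ?\<Phi> and \<Phi>' = ?\<Phi>'])
    fix U y N
    assume y: "y \<in> hom C U S" and N: "N \<in> paths U ?P" and sN: "?s \<cdot> N = ?f \<cdot> y"
    note [simp] = homD[OF y] homD[OF N]
    have jN: "jE \<cdot> N \<in> paths U (PA E)" and xy: "x \<cdot> y \<in> hom C U X"
      and sh: "?s \<cdot> N \<in> hom C U E" and th: "?t \<cdot> N \<in> hom C U E" by (simp_all add: hom_def)
    note a = act_arr[OF ak jN xy] and bb = bh[OF N xy]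
    note [simp] = homD[OF bb(1)]
    note ps = homD[OF point_arr(1)[OF sh xy]] and pt = homD[OF point_arr(1)[OF th xy]]
    have h: "(jY \<cdot> (kq \<cdot> ke)) \<cdot> b N (x \<cdot> y) \<in> paths U (PA Y)"
      by (rule comp_hom[OF bb(1) mD(1)])
    have "st C (bang C Y) (PA Y) \<cdot> ?\<Phi> y N = st C (bang C Y) (PA Y) \<cdot> ?\<Phi>' y N"
    proof (rule st_eqI[OF paths(3) a(1) h])
      show "psrc (PA Y) \<cdot> ?\<Phi> y N = psrc (PA Y) \<cdot> ?\<Phi>' y N"
        using mD(8)[of "b N (x \<cdot> y)"] a(2) eval_pair[OF sh xy] bb(2) ps by simp
      show "ptgt (PA Y) \<cdot> ?\<Phi> y N = ptgt (PA Y) \<cdot> ?\<Phi>' y N"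
        using mD(9)[of "b N (x \<cdot> y)"] a(3) eval_pair[OF th xy] bb(3) pt by simp
    qed
    then show "?\<Phi> y N \<in> hom C U (Dom C (st C (bang C Y) (PA Y))) \<and>
        ?\<Phi>' y N \<in> hom C U (Dom C (st C (bang C Y) (PA Y))) \<and>
        st C (bang C Y) (PA Y) \<cdot> ?\<Phi> y N = st C (bang C Y) (PA Y) \<cdot> ?\<Phi>' y N"
      using a(1) h by simp
    fix U' w assume w: "w \<in> hom C U' U"
    have "?\<Phi>' y N \<cdot> w = (jY \<cdot> (kq \<cdot> ke)) \<cdot> (b N (x \<cdot> y) \<cdot> w)"
      by (rule comp_assoc_arr) (use mD(2,3) homD[OF w] in simp_all)
    also have "\<dots> = ?\<Phi>' (y \<cdot> w) (N \<cdot> w)" using bb(4)[OF w] homD[OF w] by simp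
    finally show "?\<Phi> y N \<cdot> w = ?\<Phi> (y \<cdot> w) (N \<cdot> w) \<and> ?\<Phi>' y N \<cdot> w = ?\<Phi>' (y \<cdot> w) (N \<cdot> w)"
      using a(4)[OF w] homD[OF w] by simp
  next
    have rf: "?r \<cdot> ?f \<in> paths S ?P" and fE: "?f \<in> hom C S E" by (simp_all add: hom_def)
    note bb = bh[OF rf x] and pf = point_arr(1)[OF fE x]
    note [simp] = homD[OF bb(1)] homD[OF pf]
    have "path_homotopic (bang C E) (PA E) ((jE \<cdot> ?r) \<cdot> ?f) ((prefl (PA E) \<cdot> Id C E) \<cdot> ?f)"
      by (rule fib_homotopic_comp[OF jED(7), of _ S]) (simp add: hom_def)
    then have jr: "path_homotopic (bang C E) (PA E) (jE \<cdot> (?r \<cdot> ?f)) (prefl (PA E) \<cdot> ?f)" by simp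
    have "path_homotopic (bang C Y) (PA Y) (act (PA E) (PA X) k (jE \<cdot> (?r \<cdot> ?f)) x)
        (act (PA E) (PA X) k (prefl (PA E) \<cdot> ?f) x)"
      by (rule act_cong[OF ak jr _ x]) simp
    also have "path_homotopic (bang C Y) (PA Y) (act (PA E) (PA X) k (prefl (PA E) \<cdot> ?f) x)
        (prefl (PA Y) \<cdot> (eval \<cdot> pairX E ?f x))"
      by (rule act_prefl[OF ak fE x])
    also have "prefl (PA Y) \<cdot> (eval \<cdot> pairX E ?f x) = (prefl (PA Y) \<cdot> (q \<cdot> e)) \<cdot> point ?f x"
      unfolding eval_pair[OF fE x] by simp
    also have "path_homotopic (bang C Y) (PA Y) ((prefl (PA Y) \<cdot> (q \<cdot> e)) \<cdot> point ?f x)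
       (((jY \<cdot> (kq \<cdot> ke)) \<cdot> prefl ?Bc) \<cdot> point ?f x)"
    proof (rule fib_homotopic_comp[OF fib_homotopic_sym[OF mD(7)]])
      show "point ?f x \<in> hom C S (Dom C (prefl (PA Y) \<cdot> (q \<cdot> e)))" using pf by simp
    qed
    also have "((jY \<cdot> (kq \<cdot> ke)) \<cdot> prefl ?Bc) \<cdot> point ?f x = (jY \<cdot> (kq \<cdot> ke)) \<cdot> (prefl ?Bc \<cdot> point ?f x)"
      by (rule comp_assoc_arr) (use path_simps[OF Bc(1)] mD(2,3) in simp_all)
    also have "prefl ?Bc \<cdot> point ?f x = b (?r \<cdot> ?f) x"
    proof -
      have cr: "cone (\<pi> \<cdot> ?t) g (?r \<cdot> pr1 C \<pi> g) (pr2 C \<pi> g)"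
        using pr_eq[of \<pi> g] by (simp add: cone_def)
      show ?thesis
        using cr point_arr(2,3)[OF fE x] by (simp add: bc_path_def base_change_def b_def)
    qed
    finally show "path_homotopic (bang C Y) (PA Y) (?\<Phi> (Id C S) (?r \<cdot> ?f)) (?\<Phi>' (Id C S) (?r \<cdot> ?f))"
      by simp
  qed
  moreover note bM = bh(1)[OF M x]
  have "(jY \<cdot> (kq \<cdot> ke)) \<cdot> b M x = jY \<cdot> (kq \<cdot> (ke \<cdot> b M x))" using homD[OF bM] BcO by simp
  ultimately show ?thesis by (simp add: b_def)
qed

text \<open>The given path \<open>H\<close> is pushed to \<open>Z\<close>, represented there by a path \<open>K0\<close> of \<open>B\<close>, and \<open>K0\<close> is lifted to a path \<open>K1\<close> of \<open>E\<close>
  starting at \<open>u\<close>. Acting on \<open>K1\<close> gives a path that starts where \<open>H\<close> does and has a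
  homotopic image in \<open>Z\<close>, so it differs from \<open>H\<close> by a path \<open>L\<close> inside the fibers of \<open>p\<close>. That path is represented by a path
  \<open>M\<close> inside the fibers of \<open>\<pi>\<close>, and \<open>K1\<close> followed by \<open>M\<close> represents \<open>H\<close>.\<close>

lemma eval_full:
  assumes T: "T \<in> Ob C"
    and dB: "\<And>w w' H. \<lbrakk>w \<in> hom C T B; w' \<in> hom C T B; H \<in> paths (prod_ob C T X) (PA Z);
        psrc (PA Z) \<cdot> H = d \<cdot> prod_map C w (Id C X); ptgt (PA Z) \<cdot> H = d \<cdot> prod_map C w' (Id C X)\<rbrakk> \<Longrightarrow>
      \<exists>K \<in> paths T (PA B). psrc (PA B) \<cdot> K = w \<and> ptgt (PA B) \<cdot> K = w' \<and>
        path_homotopic (bang C Z) (PA Z) (act (PA B) (PA X) kd (K \<cdot> proj1 T) (proj2 T)) H"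
    and eE: "\<And>w u u' H. \<lbrakk>w \<in> hom C T B; u \<in> hom C T E; \<pi> \<cdot> u = w; u' \<in> hom C T E; \<pi> \<cdot> u' = w;
        H \<in> paths (pb_ob C w g) (the_path C f);
        psrc (the_path C f) \<cdot> H = e \<cdot> base_change C g \<pi> u;
        ptgt (the_path C f) \<cdot> H = e \<cdot> base_change C g \<pi> u'\<rbrakk> \<Longrightarrow>
      \<exists>K \<in> paths T (the_path C \<pi>). psrc (the_path C \<pi>) \<cdot> K = u \<and> ptgt (the_path C \<pi>) \<cdot> K = u' \<and>
        path_homotopic f (the_path C f)
          (ke \<cdot> pair C (\<pi> \<cdot> psrc (the_path C \<pi>)) g (K \<cdot> pr1 C w g) (pr2 C w g)) H"
    and u: "u \<in> hom C T E" and u': "u' \<in> hom C T E"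
    and H: "H \<in> paths (prod_ob C T X) (PA Y)"
      "psrc (PA Y) \<cdot> H = eval \<cdot> prod_map C u (Id C X)" "ptgt (PA Y) \<cdot> H = eval \<cdot> prod_map C u' (Id C X)"
  shows "\<exists>K \<in> paths T (PA E). psrc (PA E) \<cdot> K = u \<and> ptgt (PA E) \<cdot> K = u' \<and>
     path_homotopic (bang C Y) (PA Y) (act (PA E) (PA X) k (K \<cdot> proj1 T) (proj2 T)) H"
proof -
  let ?S = "prod_ob C T X"
  let ?P = "the_path C \<pi>" and ?R = "the_path C p" and ?W = "the_path C f"
  note [simp] = paths_simps T homD[OF u] homD[OF u'] homD[OF H(1)] homD[OF eval_hom]
  have ph: "p \<in> hom C (Dom C (bang C Y)) (Dom C (bang C Z))"
    and \<pi>h: "\<pi> \<in> hom C (Dom C (bang C E)) (Dom C (bang C B))"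
    and qh: "q \<in> hom C (Dom C f) (Dom C p)"
    and Yh: "Id C Y \<in> hom C (Dom C p) (Dom C (bang C Y))"
    and Eh: "Id C E \<in> hom C (Dom C \<pi>) (Dom C (bang C E))"
    by (simp_all add: hom_def)
  have gA: "g \<in> Arr C" "Cod C \<pi> = Cod C g" by simp_all
  have dA: "d \<in> Arr C" "Cod C p = Cod C d" by simp_all
  note D = bc_path_object[OF paths(6) dA] and Bc = bc_path_object[OF paths(7) gA]
  let ?D = "bc_path C d p ?R" and ?Bc = "bc_path C g \<pi> ?P"
  have eh: "e \<in> hom C (Dom C (pr2 C \<pi> g)) (Dom C f)" by (simp add: hom_def)
  have Wh: "Id C (pb_ob C p d) \<in> hom C (Dom C f) (Dom C f)" by (simp add: hom_def)
  note kpD = path_mapD[OF kp paths(3,4) ph] and k\<pi>D = path_mapD[OF k\<pi> paths(5,2) \<pi>h]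
    and keD = path_mapD[OF ke Bc(1) paths(8) eh] and jYD = path_mapD[OF jY paths(6,3) Yh]
    and jED = path_mapD[OF jE paths(7,5) Eh] and jWD = path_mapD[OF jW D(1) paths(8) Wh]
    and kqD = path_mapD[OF kq paths(8,6) qh]
  note [simp] = kpD(2-4,8,9) k\<pi>D(2-4,8,9) jYD(2-4,8,9) jED(2-4,8,9) kqD(2-4,8,9)
  note akE = paths(5,1,3) base(5,1,3) eval_hom k and akB = paths(2,1,4) base(2,1,4) d kd
  have proj1: "proj1 T \<in> hom C ?S T" and proj2: "proj2 T \<in> hom C ?S X" by (simp_all add: hom_def)
  have pZ: "p \<cdot> (eval \<cdot> prod_map C v (Id C X)) = d \<cdot> prod_map C (\<pi> \<cdot> v) (Id C X)" if "v \<in> hom C T E" for v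
  proof -
    note [simp] = homD[OF that]
    have "prod_map C v (Id C X) \<in> hom C ?S (prod_ob C E X)" by (simp add: hom_def)
    then show ?thesis
      using comp_eq_ext2[OF eval_over, of "prod_map C v (Id C X)"] by (simp add: prod_map_def homD)
  qed
  \<comment> \<open>The lift of \<open>K0\<close> moves \<open>u\<close> to a point that lies over the same map to \<open>B\<close> as \<open>u'\<close>.\<close>
  have kpH: "kp \<cdot> H \<in> paths ?S (PA Z)" by (simp add: hom_def)
  have "psrc (PA Z) \<cdot> (kp \<cdot> H) = d \<cdot> prod_map C (\<pi> \<cdot> u) (Id C X)"
    "ptgt (PA Z) \<cdot> (kp \<cdot> H) = d \<cdot> prod_map C (\<pi> \<cdot> u') (Id C X)"
    using H(2,3) pZ[OF u] pZ[OF u'] by simp_all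
  moreover have \<pi>u: "\<pi> \<cdot> u \<in> hom C T B" and w: "\<pi> \<cdot> u' \<in> hom C T B" by (simp_all add: hom_def)
  ultimately obtain K0 where K0: "K0 \<in> paths T (PA B)" "psrc (PA B) \<cdot> K0 = \<pi> \<cdot> u"
    "ptgt (PA B) \<cdot> K0 = \<pi> \<cdot> u'"
    and K0H: "path_homotopic (bang C Z) (PA Z) (act (PA B) (PA X) kd (K0 \<cdot> proj1 T) (proj2 T)) (kp \<cdot> H)"
    using dB[OF \<pi>u w kpH] by blast
  have b\<pi>: "bang C B \<cdot> \<pi> = bang C E" "bang C Z \<cdot> p = bang C Y" by simp_all
  have \<pi>EB: "\<pi> \<in> hom C E B" by (simp add: hom_def)
  have BF: "bang C B \<in> Fib C" "Dom C (bang C B) = B" and ZF: "bang C Z \<in> Fib C" "Dom C (bang C Z) = Z"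
    by simp_all
  have PE: "is_path_object C (bang C B \<cdot> \<pi>) (PA E)" and PY: "is_path_object C (bang C Z \<cdot> p) (PA Y)"
    unfolding b\<pi> using paths(5,3) by simp_all
  obtain K1 where K1: "K1 \<in> paths T (PA E)" "psrc (PA E) \<cdot> K1 = u"
    "\<pi> \<cdot> (ptgt (PA E) \<cdot> K1) = ptgt (PA B) \<cdot> K0" "path_homotopic (bang C B) (PA B) (k\<pi> \<cdot> K1) K0"
    using path_lift[OF \<pi>(1) \<pi>EB BF PE paths(2) k\<pi> u K0(1,2)] by metis
  note [simp] = homD[OF K0(1)] homD[OF K1(1)]
  let ?u = "ptgt (PA E) \<cdot> K1" and ?w = "\<pi> \<cdot> u'"
  have uh: "?u \<in> hom C T E" and \<pi>uw: "\<pi> \<cdot> ?u = ?w" using K1(3) K0(3) by (simp_all add: hom_def)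
  \<comment> \<open>\<open>N\<close> and \<open>H\<close> start together and have homotopic images in \<open>Z\<close>, so only a path over \<open>Z\<close> separates them.\<close>
  let ?K1 = "K1 \<cdot> proj1 T"
  have K1f: "?K1 \<in> paths ?S (PA E)" by (simp add: hom_def)
  let ?N = "act (PA E) (PA X) k ?K1 (proj2 T)"
  note N = act_arr[OF akE K1f proj2]
  have sN: "psrc (PA Y) \<cdot> ?N = psrc (PA Y) \<cdot> H"
    using N(2) H(2) comp_eq_ext[OF K1(2), of "proj1 T"] by (simp add: prod_map_def)
  have tN: "ptgt (PA Y) \<cdot> ?N = eval \<cdot> prod_map C ?u (Id C X)"
    using N(3) by (simp add: prod_map_def)
  have "path_homotopic (bang C Z) (PA Z) (kp \<cdot> ?N) (act (PA B) (PA X) kd (k\<pi> \<cdot> ?K1) (proj2 T))"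
    by (rule act_over[OF K1f proj2])
  also have "path_homotopic (bang C Z) (PA Z) (act (PA B) (PA X) kd (k\<pi> \<cdot> ?K1) (proj2 T))
     (act (PA B) (PA X) kd (K0 \<cdot> proj1 T) (proj2 T))"
  proof (rule act_cong[OF akB _ _ proj2])
    show "path_homotopic (bang C B) (PA B) (k\<pi> \<cdot> ?K1) (K0 \<cdot> proj1 T)"
      using fib_homotopic_comp[OF K1(4), of "proj1 T" ?S] by (simp add: hom_def)
  qed simp
  also note K0H
  finally have kN: "path_homotopic (bang C Z) (PA Z) (kp \<cdot> ?N) (kp \<cdot> H)" .
  obtain \<tau> where \<tau>: "is_concat C (bang C Y) (PA Y) \<tau>" using concat_ex[OF paths(3)] .
  have cN: "fib_homotopic C (corner (bang C Z) p (PA Y)) ?N H"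
    by (rule corner_homotopicI[OF p ZF PY paths(4) kp N(1) H(1) sN kN])
  have DN: "Dom C ?N = ?S" using N(1) by (simp add: hom_def)
  obtain L where L: "L \<in> paths ?S ?R" "psrc ?R \<cdot> L = ptgt (PA Y) \<cdot> ?N"
    "ptgt ?R \<cdot> L = ptgt (PA Y) \<cdot> H"
    and NL: "path_homotopic (bang C Y) (PA Y) (concat_path (PA Y) \<tau> ?N (jY \<cdot> L)) H"
    using corner_homotopic_concat[OF p ZF PY paths(4,6), of jY \<tau> ?N H ?S] jY \<tau> cN DN
    unfolding b\<pi> by metis
  note [simp] = homD[OF L(1)]
  \<comment> \<open>\<open>L\<close> stays over \<open>d x\<close>, so pairing it with the constant \<open>x\<close> gives a path in the pullback of \<open>p\<close> along \<open>d\<close>.\<close>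
  let ?x = "prod_map C ?w (Id C X)"
  have xw: "?x = pairX B (?w \<cdot> proj1 T) (proj2 T)" by (simp add: prod_map_def)
  have cs [simp]: "cospan (p \<cdot> ptgt ?R) d"
    using path_tgt_acyclic[OF paths(6)] by (simp add: cospan_def)
  have DO: "path_ob C ?D = pb_ob C (p \<cdot> ptgt ?R) d" using D(2) by simp
  have ptL: "p \<cdot> (ptgt ?R \<cdot> L) = d \<cdot> ?x" using L(3) H(3) pZ[OF u'] by simp
  have psL: "p \<cdot> (psrc ?R \<cdot> L) = d \<cdot> ?x" using ptL by simp
  have co: "cone (p \<cdot> ptgt ?R) d L ?x" by (rule coneI) (use ptL in simp_all)
  let ?L = "pair C (p \<cdot> ptgt ?R) d L ?x"
  have LD: "?L \<in> paths ?S ?D" unfolding DO using co by (simp add: hom_def)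
  have cst: "cone p d (psrc ?R \<cdot> pr1 C (p \<cdot> ptgt ?R) d) (pr2 C (p \<cdot> ptgt ?R) d)"
    "cone p d (ptgt ?R \<cdot> pr1 C (p \<cdot> ptgt ?R) d) (pr2 C (p \<cdot> ptgt ?R) d)"
    "cone (p \<cdot> ptgt ?R) d (prefl ?R \<cdot> pr1 C p d) (pr2 C p d)"
    using pr_eq[OF cs] pr_eq[OF base(19)] by (simp_all add: cone_def)
  have endp: "pair C p d (eval \<cdot> prod_map C v (Id C X)) ?x = e \<cdot> point (v \<cdot> proj1 T) (proj2 T)"
    if v: "v \<in> hom C T E" "\<pi> \<cdot> v = ?w" for v
  proof -
    note [simp] = homD[OF v(1)]
    have vf: "v \<cdot> proj1 T \<in> hom C ?S E" by (simp add: hom_def)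
    note si = section_image[OF vf proj2] and pt = point_arr[OF vf proj2]
    have x': "?x = f \<cdot> (e \<cdot> point (v \<cdot> proj1 T) (proj2 T))"
      using si(2) comp_eq_ext2[OF v(2), of "proj1 T"] by (simp add: xw)
    show ?thesis unfolding x' eval_times[OF v(1)] using homD[OF pt(1)] by simp
  qed
  have "psrc ?D \<cdot> ?L = pair C p d (psrc ?R \<cdot> L) ?x" "ptgt ?D \<cdot> ?L = pair C p d (ptgt ?R \<cdot> L) ?x"
    using co cst by (simp_all add: bc_path_def base_change_def)
  then have stL: "psrc ?D \<cdot> ?L = e \<cdot> point (?u \<cdot> proj1 T) (proj2 T)" "ptgt ?D \<cdot> ?L = e \<cdot> point (u' \<cdot> proj1 T) (proj2 T)"
    using L(2,3) tN H(3) endp[OF uh \<pi>uw] endp[OF u' refl] by simp_all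
  let ?H = "jW \<cdot> ?L"
  note [simp] = homD[OF LD] jWD(2-4)
  have Hh: "?H \<in> paths ?S ?W" by (simp add: hom_def)
  have pu: "point (?u \<cdot> proj1 T) (proj2 T) \<in> hom C ?S (pb_ob C \<pi> g)" "point (u' \<cdot> proj1 T) (proj2 T) \<in> hom C ?S (pb_ob C \<pi> g)"
    by (rule point_arr(1); simp add: hom_def)+
  have "point (ptgt (PA E) \<cdot> ?K1) (proj2 T) \<in> hom C ?S (pb_ob C \<pi> g)" using pu(1) by simp
  note [simp] = homD[OF this] homD[OF pu(2)]
  have stH: "psrc ?W \<cdot> ?H = e \<cdot> point (?u \<cdot> proj1 T) (proj2 T)" "ptgt ?W \<cdot> ?H = e \<cdot> point (u' \<cdot> proj1 T) (proj2 T)"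
    using jWD(8)[of ?L] jWD(9)[of ?L] stL by simp_all
  have kqL: "path_homotopic p ?R (kq \<cdot> ?H) L"
  proof -
    have h: "pr1 C (p \<cdot> ptgt ?R) d \<in> paths (path_ob C ?D) ?R" by (simp add: hom_def DO)
    have r: "pr1 C (p \<cdot> ptgt ?R) d \<cdot> prefl ?D = prefl ?R \<cdot> q"
      "psrc ?R \<cdot> pr1 C (p \<cdot> ptgt ?R) d = q \<cdot> psrc ?D" "ptgt ?R \<cdot> pr1 C (p \<cdot> ptgt ?R) d = q \<cdot> ptgt ?D"
      using cst by (simp_all add: bc_path_def base_change_def)
    have rq: "prefl ?R \<cdot> q \<in> paths (pb_ob C p d) ?R" by (simp add: hom_def)
    have m: "is_path_map C p ?D ?R q (pr1 C (p \<cdot> ptgt ?R) d)"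
      unfolding is_path_map_def r using h path_homotopic_refl[OF paths(6) rq] by simp
    have "is_path_map C p ?D ?R (q \<cdot> Id C (pb_ob C p d)) (kq \<cdot> jW)"
      by (rule path_map_comp[OF D(1) paths(8,6) Wh qh jW kq])
    then have m': "is_path_map C p ?D ?R q (kq \<cdot> jW)" by simp
    have "path_homotopic p ?R ((kq \<cdot> jW) \<cdot> ?L) (pr1 C (p \<cdot> ptgt ?R) d \<cdot> ?L)"
      by (rule fib_homotopic_comp[OF path_map_unique[OF D(1) paths(6) qh m' m], of _ ?S])
        (simp add: hom_def)
    then show ?thesis using co by simp
  qed
  \<comment> \<open>Fullness over \<open>B\<close> speaks of the base change of \<open>T\<close>, so the path is carried there and back.\<close>
  note i = bc_iso[OF w]
  note bu = base_change_to_bc[OF uh, unfolded \<pi>uw] and bu' = base_change_to_bc[OF u']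
  note [simp] = homD[OF i(2)] homD[OF i(3)] i(1)
  have Hf: "?H \<cdot> from_bc ?w \<in> paths (pb_ob C ?w g) ?W" by (simp add: hom_def)
  have "psrc ?W \<cdot> (?H \<cdot> from_bc ?w) = e \<cdot> base_change C g \<pi> ?u"
    using comp_eq_ext2[OF stH(1), of "from_bc ?w"] bu(3) by simp
  moreover have "ptgt ?W \<cdot> (?H \<cdot> from_bc ?w) = e \<cdot> base_change C g \<pi> u'"
    using comp_eq_ext2[OF stH(2), of "from_bc ?w"] bu'(3) by simp
  ultimately obtain M where M: "M \<in> paths T ?P" "psrc ?P \<cdot> M = ?u" "ptgt ?P \<cdot> M = u'"
    and MH: "path_homotopic f ?W (ke \<cdot> pair C (\<pi> \<cdot> psrc ?P) g (M \<cdot> pr1 C ?w g) (pr2 C ?w g)) (?H \<cdot> from_bc ?w)"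
    using eE[OF w uh \<pi>uw u' refl Hf] by metis
  note [simp] = homD[OF M(1)]
  let ?M = "M \<cdot> proj1 T"
  let ?b = "pair C (\<pi> \<cdot> psrc ?P) g ?M (pairX B (\<pi> \<cdot> (psrc ?P \<cdot> ?M)) (proj2 T))"
  have Mf: "?M \<in> paths ?S ?P" by (simp add: hom_def)
  have cs' [simp]: "cospan (\<pi> \<cdot> ptgt ?P) g" using path_tgt_acyclic[OF paths(7)] by (simp add: cospan_def)
  have BcO: "path_ob C ?Bc = pb_ob C (\<pi> \<cdot> ptgt ?P) g" using Bc(2) by simp
  note [simp] = keD(2-4)[unfolded BcO]
  have keH: "path_homotopic f ?W (ke \<cdot> ?b) ?H"
  proof -
    have \<pi>M: "\<pi> \<cdot> (ptgt ?P \<cdot> M) = ?w" using M(3) by simp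
    have cM: "cone (\<pi> \<cdot> ptgt ?P) g (M \<cdot> pr1 C ?w g) (pr2 C ?w g)"
      using pr_eq[OF i(1)] comp_eq_ext[OF M(3), of "pr1 C ?w g"] by (intro coneI) simp_all
    have D': "Dom C (ke \<cdot> pair C (\<pi> \<cdot> psrc ?P) g (M \<cdot> pr1 C ?w g) (pr2 C ?w g)) = pb_ob C ?w g"
      using cM by simp
    have "path_homotopic f ?W ((ke \<cdot> pair C (\<pi> \<cdot> psrc ?P) g (M \<cdot> pr1 C ?w g) (pr2 C ?w g)) \<cdot> to_bc ?w)
       ((?H \<cdot> from_bc ?w) \<cdot> to_bc ?w)"
      by (rule fib_homotopic_comp[OF MH, of _ ?S]) (use i(2) D' in simp)
    moreover have "(?H \<cdot> from_bc ?w) \<cdot> to_bc ?w = ?H" using i(4) by simp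
    moreover have "(ke \<cdot> pair C (\<pi> \<cdot> psrc ?P) g (M \<cdot> pr1 C ?w g) (pr2 C ?w g)) \<cdot> to_bc ?w = ke \<cdot> ?b"
    proof -
      have "(ke \<cdot> pair C (\<pi> \<cdot> psrc ?P) g (M \<cdot> pr1 C ?w g) (pr2 C ?w g)) \<cdot> to_bc ?w =
        ke \<cdot> pair C (\<pi> \<cdot> ptgt ?P) g ?M (pairX B (?w \<cdot> proj1 T) (proj2 T))"
        using cM i(6,7) by simp
      also have "?w \<cdot> proj1 T = \<pi> \<cdot> (psrc ?P \<cdot> ?M)"
        using comp_eq_ext[OF M(3), of "proj1 T"] by simp
      finally show ?thesis by simp
    qed
    ultimately show ?thesis by simp
  qed
  \<comment> \<open>Acting by \<open>eval\<close> turns \<open>K1\<close> followed by \<open>M\<close> into \<open>N\<close> followed by \<open>L\<close>, that is, into \<open>H\<close>.\<close>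
  obtain \<tau>E where \<tau>E: "is_concat C (bang C E) (PA E) \<tau>E" using concat_ex[OF paths(5)] .
  have jM: "jE \<cdot> M \<in> paths T (PA E)" by (simp add: hom_def)
  have tK: "ptgt (PA E) \<cdot> K1 = psrc (PA E) \<cdot> (jE \<cdot> M)" using M(2) by simp
  note c = concat_arr[OF paths(5) \<tau>E K1(1) jM tK]
  let ?K = "concat_path (PA E) \<tau>E K1 (jE \<cdot> M)"
  have jMf: "jE \<cdot> ?M \<in> paths ?S (PA E)" by (simp add: hom_def)
  have tKf: "ptgt (PA E) \<cdot> ?K1 = psrc (PA E) \<cdot> (jE \<cdot> ?M)"
    using comp_eq_ext2[OF tK, of "proj1 T"] by simp
  let ?aM = "act (PA E) (PA X) k (jE \<cdot> ?M) (proj2 T)"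
  note aM = act_arr[OF akE jMf proj2]
  have "path_homotopic (bang C Y) (PA Y) ?aM (jY \<cdot> (kq \<cdot> (ke \<cdot> ?b)))"
    by (rule act_fiberwise[OF Mf proj2])
  also have "path_homotopic (bang C Y) (PA Y) (jY \<cdot> (kq \<cdot> (ke \<cdot> ?b))) (jY \<cdot> L)"
    by (rule path_map_cong[OF paths(6,3) Yh jY
          fib_homotopic_trans[OF path_map_cong[OF paths(8,6) qh kq keH] kqL]])
  finally have aML: "path_homotopic (bang C Y) (PA Y) ?aM (jY \<cdot> L)" .
  have "path_homotopic (bang C Y) (PA Y) (act (PA E) (PA X) k (?K \<cdot> proj1 T) (proj2 T))
    (concat_path (PA Y) \<tau> ?N ?aM)"
    using act_concat[OF akE \<tau>E \<tau> K1f jMf tKf proj2] c(5)[OF proj1] by simp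
  also have "path_homotopic (bang C Y) (PA Y) (concat_path (PA Y) \<tau> ?N ?aM)
    (concat_path (PA Y) \<tau> ?N (jY \<cdot> L))"
  proof (rule concat_cong[OF paths(3) \<tau> path_homotopic_refl[OF paths(3) N(1)] aML DN])
    show "Dom C ?aM = ?S" using aM(1) by (simp add: hom_def)
    show "ptgt (PA Y) \<cdot> ?N = psrc (PA Y) \<cdot> ?aM" using N(3) aM(2) tKf by simp
  qed
  also note NL
  finally have "path_homotopic (bang C Y) (PA Y) (act (PA E) (PA X) k (?K \<cdot> proj1 T) (proj2 T)) H" .
  moreover have "psrc (PA E) \<cdot> ?K = u" "ptgt (PA E) \<cdot> ?K = u'" using c(3,4) K1(2) M(3) by simp_all
  ultimately show ?thesis using c(2) by blast
qed

end

lemma exp_ftor_eval_ess_surj: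
  assumes T: "T \<in> Ob C"
    and dB: "ess_surj (hom_gpd1 C T B) (hom_gpd1 C (prod_ob C T X) Z) (exp_ftor C X Z B d)"
    and eE: "\<And>y. y \<in> Arr C \<Longrightarrow> Cod C y = Cod C g \<Longrightarrow>
      ess_surj (hom_gpd C y \<pi> (the_path C \<pi>)) (hom_gpd C (pr2 C y g) f (the_path C f))
        (pi_ftor C f g \<pi> e)"
  shows "ess_surj (hom_gpd1 C T E) (hom_gpd1 C (prod_ob C T X) Y) (exp_ftor C X Y E eval)"
  unfolding exp_ess_surj[OF base(1,3,5) T eval_hom]
proof
  fix v assume v: "v \<in> hom C (prod_ob C T X) Y"
  show "\<exists>u \<in> hom C T E. fib_homotopic C (bang C Y) (eval \<cdot> prod_map C u (Id C X)) v"
  proof (rule eval_ess_surj[OF T _ _ v])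
    show "\<exists>w \<in> hom C T B. fib_homotopic C (bang C Z) (d \<cdot> prod_map C w (Id C X)) v'"
      if "v' \<in> hom C (prod_ob C T X) Z" for v'
      using dB that unfolding exp_ess_surj[OF base(1,4,2) T d] by blast
  next
    fix w v'
    assume w: "w \<in> hom C T B" and v': "v' \<in> hom C (pb_ob C w g) (pb_ob C p d)" "f \<cdot> v' = pr2 C w g"
    have h: "f \<in> Fib C" "g \<in> Fib C" "Cod C \<pi> = Cod C g" "e \<in> hom C (pb_ob C \<pi> g) (Dom C f)"
      "w \<in> hom C T (Cod C g)" "v' \<in> hom C (pb_ob C w g) (Dom C f)"
      using e w v' by simp_all
    have "w \<in> Arr C" "Cod C w = Cod C g" using w by (simp_all add: hom_def)
    from pi_ess_surj[OF h(1,2) \<pi>(1) h(3,4) e(2) h(5) eE[OF this] h(6) v'(2)]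
    show "\<exists>u. u \<in> hom C T E \<and> \<pi> \<cdot> u = w \<and> fib_homotopic C f (e \<cdot> base_change C g \<pi> u) v'"
      by blast
  qed
qed

lemma exp_ftor_eval_full:
  assumes T: "T \<in> Ob C"
    and dB: "full (hom_gpd1 C T B) (hom_gpd1 C (prod_ob C T X) Z) (exp_ftor C X Z B d)"
    and eE: "\<And>y. y \<in> Arr C \<Longrightarrow> Cod C y = Cod C g \<Longrightarrow>
      full (hom_gpd C y \<pi> (the_path C \<pi>)) (hom_gpd C (pr2 C y g) f (the_path C f))
        (pi_ftor C f g \<pi> e)"
  shows "full (hom_gpd1 C T E) (hom_gpd1 C (prod_ob C T X) Y) (exp_ftor C X Y E eval)"
proof -
  let ?PA = "\<lambda>A. the_path C (bang C A)"
  have PA: "is_path_object C (bang C A) (?PA A)" if "A \<in> Ob C" for A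
    by (rule the_path) (use that in simp)
  have fF: "f \<in> Fib C" by simp
  have gA: "g \<in> Arr C" "Cod C \<pi> = Cod C g" and dA: "d \<in> Arr C" "Cod C p = Cod C d" by simp_all
  note PX = PA[OF base(1)] and PB = PA[OF base(2)] and PY = PA[OF base(3)] and PZ = PA[OF base(4)]
    and PE = PA[OF base(5)] and R = the_path[OF base(6)] and P = the_path[OF \<pi>(1)] and W = the_path[OF fF]
  note EX = prod_path_object(1)[OF PE PX base(5,1)] and BX = prod_path_object(1)[OF PB PX base(2,1)]
    and Bc = bc_path_object(1)[OF P gA] and D = bc_path_object(1)[OF R dA]
  note [simp] = path_simps[OF PY] path_simps[OF PE] path_simps[OF R] path_simps[OF P] path_simps[OF W]
    path_simps[OF EX] path_simps[OF BX] path_simps[OF Bc] path_simps[OF D] homD[OF eval_hom]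
  have fe: "f \<cdot> (e \<cdot> psrc (bc_path C g \<pi> (the_path C \<pi>))) = f \<cdot> (e \<cdot> ptgt (bc_path C g \<pi> (the_path C \<pi>)))"
    using comp_eq_ext[OF e(2), of "psrc (bc_path C g \<pi> (the_path C \<pi>))"]
      comp_eq_ext[OF e(2), of "ptgt (bc_path C g \<pi> (the_path C \<pi>))"] by simp
  have pq: "p \<cdot> (q \<cdot> psrc (the_path C f)) = p \<cdot> (q \<cdot> ptgt (the_path C f))"
    using pb_ob_dom[of p d "psrc (the_path C f)"] pb_ob_dom[of p d "ptgt (the_path C f)"] by simp
  obtain kp where kp: "is_path_map C (bang C Z) (?PA Y) (?PA Z) p kp"
    by (rule path_map_ex[OF PY PZ, of p]) (simp_all add: hom_def)
  obtain kd where kd: "is_path_map C (bang C Z) (prod_path C (?PA B) (?PA X)) (?PA Z) d kd"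
    by (rule path_map_ex[OF BX PZ, of d]) (simp_all add: hom_def)
  obtain k where k: "is_path_map C (bang C Y) (prod_path C (?PA E) (?PA X)) (?PA Y) eval k"
    by (rule path_map_ex[OF EX PY, of eval]) (simp_all add: hom_def)
  obtain k\<pi> where k\<pi>: "is_path_map C (bang C B) (?PA E) (?PA B) \<pi> k\<pi>"
    by (rule path_map_ex[OF PE PB, of \<pi>]) (simp_all add: hom_def)
  obtain ke where
    ke: "is_path_map C f (bc_path C g \<pi> (the_path C \<pi>)) (the_path C f) e ke"
    by (rule path_map_ex[OF Bc W, of e]) (use fe in \<open>simp_all add: hom_def\<close>)
  obtain jY where jY: "is_path_map C (bang C Y) (the_path C p) (?PA Y) (Id C Y) jY"
    by (rule path_map_ex[OF R PY, of "Id C Y"]) (simp_all add: hom_def)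
  obtain jE where jE: "is_path_map C (bang C E) (the_path C \<pi>) (?PA E) (Id C E) jE"
    by (rule path_map_ex[OF P PE, of "Id C E"]) (simp_all add: hom_def)
  obtain jW where
    jW: "is_path_map C f (bc_path C d p (the_path C p)) (the_path C f) (Id C (pb_ob C p d)) jW"
    by (rule path_map_ex[OF D W, of "Id C (pb_ob C p d)"]) (simp_all add: hom_def)
  obtain kq where kq: "is_path_map C p (the_path C f) (the_path C p) q kq"
    by (rule path_map_ex[OF W R, of q]) (use pq in \<open>simp_all add: hom_def\<close>)
  note ef = eval_full[OF kp kd k k\<pi> ke jY jE jW kq T]
  show ?thesis
    unfolding exp_full[OF base(1,3,5) T eval_hom k]
  proof (intro ballI impI, rule ef)
    fix w w' H
    assume "w \<in> hom C T B" "w' \<in> hom C T B" "H \<in> paths (prod_ob C T X) (?PA Z)"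
      "psrc (?PA Z) \<cdot> H = d \<cdot> prod_map C w (Id C X)" "ptgt (?PA Z) \<cdot> H = d \<cdot> prod_map C w' (Id C X)"
    then show "\<exists>K \<in> paths T (?PA B). psrc (?PA B) \<cdot> K = w \<and> ptgt (?PA B) \<cdot> K = w' \<and>
        path_homotopic (bang C Z) (?PA Z) (act (?PA B) (?PA X) kd (K \<cdot> proj1 T) (proj2 T)) H"
      using dB unfolding exp_full[OF base(1,4,2) T d kd] by blast
  next
    fix w u u' H
    assume w: "w \<in> hom C T B" and u: "u \<in> hom C T E" "\<pi> \<cdot> u = w" and u': "u' \<in> hom C T E" "\<pi> \<cdot> u' = w"
      and H: "H \<in> paths (pb_ob C w g) (the_path C f)"
        "psrc (the_path C f) \<cdot> H = e \<cdot> base_change C g \<pi> u"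
        "ptgt (the_path C f) \<cdot> H = e \<cdot> base_change C g \<pi> u'"
    have h: "g \<in> Fib C" "Cod C \<pi> = Cod C g" "e \<in> hom C (pb_ob C \<pi> g) (Dom C f)" "w \<in> hom C T (Cod C g)"
      using e w by simp_all
    have "w \<in> Arr C" "Cod C w = Cod C g" using w by (simp_all add: hom_def)
    from pi_full[OF fF h(1) \<pi>(1) h(2-4) ke eE[OF this] u u' H]
    show "\<exists>K \<in> paths T (the_path C \<pi>). psrc (the_path C \<pi>) \<cdot> K = u \<and>
        ptgt (the_path C \<pi>) \<cdot> K = u' \<and>
        path_homotopic f (the_path C f)
          (ke \<cdot> pair C (\<pi> \<cdot> psrc (the_path C \<pi>)) g (K \<cdot> pr1 C w g) (pr2 C w g)) H"
      by blast
  qed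
qed

end

lemma (in path_category) section_spaceI:
  assumes "X \<in> Ob C" "B \<in> Ob C" "p \<in> Fib C" "p \<in> hom C Y Z" "d \<in> hom C (prod_ob C B X) Z"
    and "\<pi> \<in> Fib C" "Cod C \<pi> = Cod C (prod_pr1 B X)"
    and "e \<in> hom C (pb_ob C \<pi> (prod_pr1 B X)) (Dom C (pr2 C p d))"
    and "pr2 C p d \<cdot> e = pr2 C \<pi> (prod_pr1 B X)"
  shows "section_space C X Y Z B p d \<pi> e"
proof unfold_locales
  have "cospan p d" using assms(3) homD[OF assms(4)] homD[OF assms(5)] by (simp add: cospan_def)
  then show "e \<in> hom C (pb_ob C \<pi> (prod_pr1 B X)) (pb_ob C p d)"
    using assms(8) by simp
qed (use assms in simp_all)

lemma (in path_category) evaluation_pullback_fib: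
  assumes "X \<in> Ob C" "B \<in> Ob C" "p \<in> Fib C" "p \<in> hom C Y Z" "d \<in> hom C (prod_ob C B X) Z"
  shows "pr2 C p d \<in> Fib C" "prod_pr1 B X \<in> Fib C"
    "Cod C (pr2 C p d) = Dom C (prod_pr1 B X)"
proof -
  note [simp] = assms(1-3) homD[OF assms(4)] homD[OF assms(5)]
  have [simp]: "cospan p d" by (simp add: cospan_def)
  show "pr2 C p d \<in> Fib C" "prod_pr1 B X \<in> Fib C"
    "Cod C (pr2 C p d) = Dom C (prod_pr1 B X)"
    by (simp_all add: prod_ob_def)
qed

theorem proposition5p1:
  fixes C :: "('o, 'm) fwcat" and X Y Z :: 'o and p :: 'm
  assumes "path_category C"
    and "X \<in> Ob C"
    and "p \<in> Fib C" and "p \<in> hom C Y Z"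
  shows
    "(has_weak_Pi_types C \<longrightarrow>
       (\<forall>ZX \<epsilon>\<^sub>Z. weak_exponential C X Z ZX \<epsilon>\<^sub>Z \<longrightarrow>
          (\<exists>YX \<epsilon>\<^sub>Y pX. weak_exponential C X Y YX \<epsilon>\<^sub>Y \<and>
             pX \<in> Fib C \<and> pX \<in> hom C YX ZX \<and>
             p \<cdot>\<^bsub>C\<^esub> \<epsilon>\<^sub>Y = \<epsilon>\<^sub>Z \<cdot>\<^bsub>C\<^esub> prod_map C pX (Id C X))))
     \<and>
     (has_strong_Pi_types C \<longrightarrow>
       (\<forall>ZX \<epsilon>\<^sub>Z. strong_exponential C X Z ZX \<epsilon>\<^sub>Z \<longrightarrow>
          (\<exists>YX \<epsilon>\<^sub>Y pX. strong_exponential C X Y YX \<epsilon>\<^sub>Y \<and>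
             pX \<in> Fib C \<and> pX \<in> hom C YX ZX \<and>
             p \<cdot>\<^bsub>C\<^esub> \<epsilon>\<^sub>Y = \<epsilon>\<^sub>Z \<cdot>\<^bsub>C\<^esub> prod_map C pX (Id C X))))"
proof -
  interpret path_category C by (rule assms(1))
  show ?thesis
  proof (intro conjI impI allI)
    fix B d
    assume Pi: "has_weak_Pi_types C" and B: "weak_exponential C X Z B d"
    have Bd: "B \<in> Ob C" "d \<in> hom C (prod_ob C B X) Z" using B by (simp_all add: weak_exponential_def)
    note fg = evaluation_pullback_fib[OF assms(2) Bd(1) assms(3,4) Bd(2)]
    obtain \<pi> e where Pi_type: "weak_Pi_type C (pr2 C p d) (pr1 C (bang C B) (bang C X)) \<pi> e"
      using Pi fg unfolding has_weak_Pi_types_def by blast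
    interpret section_space C X Y Z B p d \<pi> e
      using Pi_type assms(2-4) Bd unfolding weak_Pi_type_def by (intro section_spaceI) simp_all
    have "ess_surj (hom_gpd1 C T E) (hom_gpd1 C (prod_ob C T X) Y) (exp_ftor C X Y E eval)"
      if "T \<in> Ob C" for T
    proof (rule exp_ftor_eval_ess_surj[OF that])
      show "ess_surj (hom_gpd1 C T B) (hom_gpd1 C (prod_ob C T X) Z) (exp_ftor C X Z B d)"
        using B that unfolding weak_exponential_def by blast
    qed (use Pi_type in \<open>unfold weak_Pi_type_def, blast\<close>)
    then have "weak_exponential C X Y E eval"
      using eval_hom by (simp add: weak_exponential_def)
    moreover have "\<pi> \<in> hom C E B" by (simp add: hom_def)
    ultimately show "\<exists>YX \<epsilon>\<^sub>Y pX. weak_exponential C X Y YX \<epsilon>\<^sub>Y \<and> pX \<in> Fib C \<and> pX \<in> hom C YX B \<and>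
        p \<cdot>\<^bsub>C\<^esub> \<epsilon>\<^sub>Y = d \<cdot>\<^bsub>C\<^esub> prod_map C pX (Id C X)"
      using \<pi>(1) eval_over by blast
  next
    fix B d
    assume Pi: "has_strong_Pi_types C" and B: "strong_exponential C X Z B d"
    have Bd: "B \<in> Ob C" "d \<in> hom C (prod_ob C B X) Z" using B by (simp_all add: strong_exponential_def)
    note fg = evaluation_pullback_fib[OF assms(2) Bd(1) assms(3,4) Bd(2)]
    obtain \<pi> e where Pi_type: "strong_Pi_type C (pr2 C p d) (pr1 C (bang C B) (bang C X)) \<pi> e"
      using Pi fg unfolding has_strong_Pi_types_def by blast
    interpret section_space C X Y Z B p d \<pi> e
      using Pi_type assms(2-4) Bd unfolding strong_Pi_type_def by (intro section_spaceI) simp_all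
    have "ess_surj_full (hom_gpd1 C T E) (hom_gpd1 C (prod_ob C T X) Y) (exp_ftor C X Y E eval)"
      if "T \<in> Ob C" for T
      unfolding ess_surj_full_def
    proof
      have dB: "ess_surj (hom_gpd1 C T B) (hom_gpd1 C (prod_ob C T X) Z) (exp_ftor C X Z B d)"
        "full (hom_gpd1 C T B) (hom_gpd1 C (prod_ob C T X) Z) (exp_ftor C X Z B d)"
        using B that unfolding strong_exponential_def ess_surj_full_def by blast+
      show "ess_surj (hom_gpd1 C T E) (hom_gpd1 C (prod_ob C T X) Y) (exp_ftor C X Y E eval)"
        by (rule exp_ftor_eval_ess_surj[OF that dB(1)])
          (use Pi_type in \<open>unfold strong_Pi_type_def ess_surj_full_def, blast\<close>)
      show "full (hom_gpd1 C T E) (hom_gpd1 C (prod_ob C T X) Y) (exp_ftor C X Y E eval)"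
        by (rule exp_ftor_eval_full[OF that dB(2)])
          (use Pi_type in \<open>unfold strong_Pi_type_def ess_surj_full_def, blast\<close>)
    qed
    then have "strong_exponential C X Y E eval"
      using eval_hom by (simp add: strong_exponential_def)
    moreover have "\<pi> \<in> hom C E B" by (simp add: hom_def)
    ultimately show "\<exists>YX \<epsilon>\<^sub>Y pX. strong_exponential C X Y YX \<epsilon>\<^sub>Y \<and> pX \<in> Fib C \<and> pX \<in> hom C YX B \<and>
        p \<cdot>\<^bsub>C\<^esub> \<epsilon>\<^sub>Y = d \<cdot>\<^bsub>C\<^esub> prod_map C pX (Id C X)"
      using \<pi>(1) eval_over by blast
  qed
qed

end
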